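(* Let $l$ be an even integer with $|l|\geq 2$. If $k$ is an integer with $k\neq l$ and $|k|\geq 2$, then $D(k,l)$ is smooth over $\mathbb{Q}$. If $|l|>2$, then $D_1(l,l)$ is smooth over $\mathbb{Q}$.
   Context: $f_j\in\mathbb{Z}[u]$ ($j\in\mathbb{Z}$) is defined by $f_0=0$, $f_1=1$, $f_{j+1}-uf_j+f_{j-1}=0$ (up and down), and $g_j=f_j-f_{j-1}$. For all $j$, $\Phi_{2j}=f_j$ and $\Phi_{2j-1}=g_j$. $D(k,l)\subset\mathbb{P}^1_{\mathbb{Q}}(r)\times\mathbb{P}^1_{\mathbb{Q}}(t)$ is the projective closure of the affine variety given by $\Phi_{k+1}(r)\Phi_{l-1}(t)=\Phi_{k-1}(r)\Phi_{l+1}(t)$. For nonzero even $l=2n$, $D_0(l,l)$ is the component of $D(l,l)$ given by $r=t$, and $D_1(l,l)$ is the projective closure of the scheme-theoretic complement of $D_0(l,l)$ in $D(l,l)$, i.e. the projective closure of the affine curve given by $\big(g_{n+1}(r)g_n(t)-g_n(r)g_{n+1}(t)\big)/(t-r)=0$. *)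

theory Defs
  imports Complex_Main "HOL-Computational_Algebra.Polynomial"
begin

section \<open>The polynomials $f_j$, $g_j$ and $\Phi_j$\<close>

function fpol :: "int \<Rightarrow> int poly" where
  "fpol j =
    (if j = 0 then 0
     else if j = 1 then 1
     else if j > 1 then [:0, 1:] * fpol (j - 1) - fpol (j - 2)
     else [:0, 1:] * fpol (j + 1) - fpol (j + 2))"
  by pat_completeness auto
termination
  by (relation "measure (\<lambda>j. nat \<bar>2 * j - 1\<bar>)") auto

declare fpol.simps [simp del]

lemma fpol_0: "fpol 0 = 0" and fpol_1: "fpol 1 = 1"
  by (simp_all add: fpol.simps)

lemma fpol_recurrence: "fpol (j + 1) - [:0, 1:] * fpol j + fpol (j - 1) = 0"
proof (cases "j \<ge> 1")
  case True
  then show ?thesis by (subst fpol.simps) simp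
next
  case False
  then show ?thesis by (subst (3) fpol.simps) (simp add: add.commute)
qed

definition gpol :: "int \<Rightarrow> int poly" where
  "gpol j = fpol j - fpol (j - 1)"

definition Phi :: "int \<Rightarrow> int poly" where
  "Phi j = (if even j then fpol (j div 2) else gpol ((j + 1) div 2))"

lemma Phi_even: "Phi (2 * j) = fpol j" and Phi_odd: "Phi (2 * j - 1) = gpol j"
  by (simp_all add: Phi_def)

section \<open>Curves in the product of two projective lines\<close>

text \<open>
  An element of $\mathbb{Q}[r,t]$ is a polynomial in $t$ (outer variable) whose coefficients are
  polynomials in $r$ (inner variable).
\<close>

type_synonym bipoly = "rat poly poly"

definition in_r :: "int poly \<Rightarrow> bipoly" where
  "in_r p = [:map_poly of_int p:]"

definition in_t :: "int poly \<Rightarrow> bipoly" where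
  "in_t p = map_poly (\<lambda>c. [:of_int c:]) p"

definition eval2 :: "bipoly \<Rightarrow> complex \<Rightarrow> complex \<Rightarrow> complex" where
  "eval2 G x y = poly (poly (map_poly (map_poly of_rat) G) [:y:]) x"

definition d_r :: "bipoly \<Rightarrow> bipoly" where
  "d_r G = map_poly pderiv G"

definition d_t :: "bipoly \<Rightarrow> bipoly" where
  "d_t G = pderiv G"

definition degree_r :: "bipoly \<Rightarrow> nat" where
  "degree_r G = Max ((\<lambda>j. degree (coeff G j)) ` {..degree G})"

text \<open>
  Let $G^h(r_0,r_1;t_0,t_1)$ be the bihomogenization of $G$, of bidegree
  $(\deg_r G,\deg_t G)$, so that $G(r,t)=G^h(r,1;t,1)$. The next two functions return
  $G^h(1,r;t,1)$ and $G^h(r,1;1,t)$; their composition returns $G^h(1,r;1,t)$.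
\<close>

definition invert_r :: "bipoly \<Rightarrow> bipoly" where
  "invert_r G = map_poly (\<lambda>c. monom 1 (degree_r G - degree c) * reflect_poly c) G"

definition invert_t :: "bipoly \<Rightarrow> bipoly" where
  "invert_t G = reflect_poly G"

text \<open>
  The closed subscheme of $\mathbb{P}^1\times\mathbb{P}^1$ that is the projective closure of the
  affine scheme $V(I)$ is cut out by the bihomogenizations of all elements of the ideal $I$. It is
  represented by its restrictions to the four standard affine charts, with coordinates
  $(r,t)$, $(1/r,t)$, $(r,1/t)$ and $(1/r,1/t)$; each restriction is given as a generating set of
  its ideal.
\<close>

definition projective_closure :: "bipoly set \<Rightarrow> bipoly set set" where
  "projective_closure I =
    {I, invert_r ` I, invert_t ` I, (\<lambda>G. invert_r (invert_t G)) ` I}"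

text \<open>
  The Jacobian criterion for a subscheme $V(J)$ of the affine plane of pure dimension 1: at each
  geometric point the Jacobian matrix has rank equal to the codimension 1, i.e. (as the rank cannot
  exceed the codimension) it does not vanish. Nonreduced points are therefore not smooth. Geometric
  points are taken in the algebraically closed extension $\mathbb{C}$ of $\mathbb{Q}$. The
  condition only depends on the ideal generated by $J$, and the empty scheme is smooth.
\<close>

definition smooth_affine_curve :: "bipoly set \<Rightarrow> bool" where
  "smooth_affine_curve J \<longleftrightarrow>
    (\<forall>x y. (\<forall>G\<in>J. eval2 G x y = 0) \<longrightarrow>
      (\<exists>G\<in>J. eval2 (d_r G) x y \<noteq> 0 \<or> eval2 (d_t G) x y \<noteq> 0))"

definition smooth_curve :: "bipoly set set \<Rightarrow> bool" where
  "smooth_curve X \<longleftrightarrow> (\<forall>J\<in>X. smooth_affine_curve J)"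

section \<open>The curves $D(k,l)$ and $D_1(l,l)$\<close>

definition D_poly :: "int \<Rightarrow> int \<Rightarrow> bipoly" where
  "D_poly k l = in_r (Phi (k + 1)) * in_t (Phi (l - 1)) - in_r (Phi (k - 1)) * in_t (Phi (l + 1))"

definition curve_D :: "int \<Rightarrow> int \<Rightarrow> bipoly set set" where
  "curve_D k l = projective_closure {G. D_poly k l dvd G}"

definition t_minus_r :: bipoly where
  "t_minus_r = [:[:0, -1:], 1:]"

text \<open>
  The division in \<open>D1_poly\<close> is exact for even \<open>l\<close>, see \<open>D1_poly_mult\<close>.
\<close>

definition D1_poly :: "int \<Rightarrow> bipoly" where
  "D1_poly l =
    (let n = l div 2
     in (in_r (gpol (n + 1)) * in_t (gpol n) - in_r (gpol n) * in_t (gpol (n + 1))) div t_minus_r)"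

text \<open>This is $D_1(l,l)$, to be used for nonzero even \<open>l\<close> only.\<close>

definition curve_D1 :: "int \<Rightarrow> bipoly set set" where
  "curve_D1 l = projective_closure {G. D1_poly l dvd G}"

lemma D_poly_diagonal:
  assumes "even l"
  defines "n \<equiv> l div 2"
  shows "D_poly l l = in_r (gpol (n + 1)) * in_t (gpol n) - in_r (gpol n) * in_t (gpol (n + 1))"
proof -
  have "l + 1 = 2 * (n + 1) - 1" "l - 1 = 2 * n - 1"
    using assms by auto
  then show ?thesis unfolding D_poly_def by (simp only: Phi_odd)
qed

lemma t_minus_r_dvd: "t_minus_r dvd in_r p * in_t q - in_r q * in_t p"
proof -
  have ev: "poly (in_t s) [:0, 1:] = map_poly of_int s" for s
  proof (induction s)
    case 0
    then show ?case by (simp add: in_t_def)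
  next
    case (pCons a s)
    then show ?case by (simp add: in_t_def map_poly_pCons)
  qed
  have "poly (in_r p * in_t q - in_r q * in_t p) [:0, 1:] = 0"
    by (simp add: ev, simp add: in_r_def)
  then have "[:- [:0, 1:], 1:] dvd in_r p * in_t q - in_r q * in_t p"
    by (rule poly_eq_0_iff_dvd[THEN iffD1])
  then show ?thesis
    by (simp add: t_minus_r_def)
qed

lemma D1_poly_mult:
  assumes "even l"
  shows "D1_poly l * t_minus_r = D_poly l l"
  using t_minus_r_dvd by (simp add: D1_poly_def Let_def D_poly_diagonal[OF assms])

end

theory Submission
  imports Defs
begin

text \<open>
  The curve \<open>D(k,l)\<close> is the fibre product over the projective line of the rational functions
  \<open>h\<^sub>k = \<Phi>\<^bsub>k+1\<^esub>/\<Phi>\<^bsub>k-1\<^esub>\<close> and \<open>h\<^sub>l\<close>. It is singular at \<open>(r,t)\<close> exactly if \<open>r\<close> is a critical point of \<open>h\<^sub>k\<close>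
  and \<open>t\<close> is a critical point of \<open>h\<^sub>l\<close>, with the same critical value (\<open>singular_separated\<close>). The
  functions \<open>h\<^sub>k\<close> are unramified at infinity, so only the affine chart matters
  (\<open>smooth_component\<close>). Hence smoothness of \<open>D(k,l)\<close> means that \<open>h\<^sub>k\<close> and \<open>h\<^sub>l\<close> have no common
  critical value. A singular point of \<open>D\<^sub>1(l,l)\<close> off the diagonal would give two critical points of
  \<open>h\<^sub>l\<close> with the same critical value, and one on the diagonal a degenerate critical point
  (\<open>diagonal_singularity\<close>).

  The Wronskian of \<open>\<Phi>\<^bsub>k+1\<^esub>\<close> and \<open>\<Phi>\<^bsub>k-1\<^esub>\<close> is, up to sign, a sum of squares of consecutive \<open>g\<^sub>i\<close>
  (\<open>k\<close> even) or \<open>f\<^sub>i\<close> (\<open>k\<close> odd), and it equals \<open>(f\<^sub>k(u) + k)/(u + 2)\<close> or \<open>(f\<^sub>k(u) - k)/(u\<^sup>2 - 4)\<close>. Together with the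
  Cassini identity this gives, at a critical point \<open>u\<close> with critical value \<open>a\<close>, the relation
  \<open>u = y - z/k\<close> where \<open>y = a + 1/a\<close> and \<open>z = a - 1/a\<close> (\<open>critical_relation\<close>). So \<open>a\<close> determines \<open>u\<close>,
  which proves that the critical values of a single \<open>h\<^sub>l\<close> are distinct; that the critical points
  are nondegenerate follows from a formula for the derivative of \<open>f\<^sub>k\<close>.

  That \<open>h\<^sub>k\<close> and \<open>h\<^sub>l\<close> share no critical value is a statement at the prime 2. Fix a valuation ring of
  \<open>\<complex>\<close> in which 2 is not invertible, and write \<open>|a|\<close> for the class of \<open>a\<close> in its value group. The
  Wronskian does not vanish at any \<open>u\<close> divisible by 2 if \<open>|k| \<ge> 2\<close>, because there it has, up
  to a factor 2, the size of a nonzero integer (\<open>wronskian_g_same\<close>, \<open>wronskian_f_same\<close>). So \<open>|2| < |t| \<le> 1\<close>, and the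
  quadratic equation for \<open>z/l\<close> yields \<open>|z| = |l t|\<close>. If \<open>k\<close> is odd, then \<open>r = y - z/k\<close> is divisible by
  2, a contradiction. If \<open>k\<close> is even, then also \<open>|z| = |k r|\<close>, which forces \<open>|k| = |l|\<close>. Write
  \<open>t = x + 1/x\<close> and \<open>r = X + 1/X\<close>. The points \<open>t\<close> and \<open>r\<close> differ by \<open>z(k - l)/(kl)\<close>, which makes \<open>X\<close>
  close to \<open>x\<close> and \<open>X\<^sup>k\<close> close to either \<open>x\<^sup>l\<close> or its inverse. In the first case \<open>x\<^bsup>k-l\<^esup>\<close> is
  too close to 1 for the known size of \<open>x\<^bsup>2l\<^esup> - 1\<close>; in the second case the sum of the equations
  \<open>x\<^sup>l - x\<^bsup>-l\<^esup> = -l(x - 1/x)\<close> and \<open>X\<^sup>k - X\<^bsup>-k\<^esup> = -k(X - 1/X)\<close> has sides of different size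
  (\<open>no_common_critical_value_even\<close>).
\<close>

section \<open>A valuation ring of the complex numbers above 2\<close>

definition subring_of_complex :: "complex set \<Rightarrow> bool" where
  "subring_of_complex R \<longleftrightarrow> 1 \<in> R \<and> (\<forall>a\<in>R. \<forall>b\<in>R. a - b \<in> R \<and> a * b \<in> R)"

context
  fixes R :: "complex set"
  assumes R: "subring_of_complex R"
begin

lemma subring_one: "1 \<in> R" and subring_diff: "a \<in> R \<Longrightarrow> b \<in> R \<Longrightarrow> a - b \<in> R"
  and subring_mult: "a \<in> R \<Longrightarrow> b \<in> R \<Longrightarrow> a * b \<in> R"
  using R by (auto simp: subring_of_complex_def)

lemma subring_zero: "0 \<in> R"
  using subring_diff[OF subring_one subring_one] by simp

lemma subring_uminus: "a \<in> R \<Longrightarrow> - a \<in> R"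
  using subring_diff[OF subring_zero, of a] by simp

lemma subring_add: "a \<in> R \<Longrightarrow> b \<in> R \<Longrightarrow> a + b \<in> R"
  using subring_diff[OF _ subring_uminus, of a b] by simp

lemma subring_power: "a \<in> R \<Longrightarrow> a ^ n \<in> R"
  by (induction n) (auto intro: subring_one subring_mult)

lemma subring_sum: "(\<And>i. i \<in> I \<Longrightarrow> h i \<in> R) \<Longrightarrow> sum h I \<in> R"
  by (induction I rule: infinite_finite_induct) (auto intro: subring_zero subring_add)

lemma subring_of_nat: "of_nat n \<in> R"
  by (induction n) (auto intro: subring_zero subring_add subring_one)

lemma subring_of_int: "of_int n \<in> R"
  by (cases n) (auto simp del: of_nat_Suc intro: subring_of_nat subring_uminus[OF subring_of_nat])

definition adjoin :: "complex \<Rightarrow> complex set" where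
  "adjoin c = {poly p c | p. \<forall>i. coeff p i \<in> R}"

lemma subring_adjoin: "subring_of_complex (adjoin c)"
  unfolding subring_of_complex_def
proof (intro conjI ballI)
  have "\<forall>i. coeff (1 :: complex poly) i \<in> R"
    by (auto simp: coeff_1 subring_one subring_zero)
  then show "1 \<in> adjoin c"
    unfolding adjoin_def by (intro CollectI exI[of _ 1]) auto
next
  fix a b assume "a \<in> adjoin c" "b \<in> adjoin c"
  then obtain p q where pq: "a = poly p c" "b = poly q c" "\<forall>i. coeff p i \<in> R" "\<forall>i. coeff q i \<in> R"
    by (auto simp: adjoin_def)
  have "\<forall>i. coeff (p - q) i \<in> R" "\<forall>i. coeff (p * q) i \<in> R"
    using pq by (auto simp: coeff_mult intro!: subring_sum subring_mult subring_diff)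
  then show "a - b \<in> adjoin c" "a * b \<in> adjoin c"
    unfolding adjoin_def pq(1,2) poly_diff[symmetric] poly_mult[symmetric] by blast+
qed

lemma adjoin_contains: "R \<subseteq> adjoin c" "c \<in> adjoin c"
proof -
  have "\<forall>i. coeff [:a:] i \<in> R" if "a \<in> R" for a
    using that by (auto simp: coeff_pCons subring_zero split: nat.split)
  moreover have "poly [:a:] c = a" for a by simp
  ultimately show "R \<subseteq> adjoin c" unfolding adjoin_def by (smt (verit) mem_Collect_eq subsetI)
  have "\<forall>i. coeff [:0, 1:] i \<in> R"
    by (auto simp: coeff_pCons subring_zero subring_one split: nat.split)
  moreover have "poly [:0, 1:] c = c" by simp
  ultimately show "c \<in> adjoin c" unfolding adjoin_def by (smt (verit) mem_Collect_eq)
qed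

end

text \<open>
  Chevalley's argument: the relation for \<open>1/x\<close> expresses \<open>x\<^sup>n\<close>, with \<open>n = degree p\<close>, as twice a
  combination of lower powers of \<open>x\<close>, since its constant term can be moved to the left, where it
  becomes a unit. Substituting this for the leading term of \<open>p\<close> lowers the degree.
\<close>
lemma half_relation_descent:
  assumes R: "subring_of_complex R"
    and unit: "\<And>a. a \<in> R \<Longrightarrow> inverse (1 - 2 * a) \<in> R"
    and half: "1 / 2 \<notin> R"
    and p: "\<forall>i. coeff p i \<in> R" "poly p x = 1 / 2"
    and q: "\<forall>i. coeff q i \<in> R" "poly q (inverse x) = 1 / 2"
    and deg: "degree q \<le> degree p" and x: "x \<noteq> 0"
  shows "\<exists>p'. (\<forall>i. coeff p' i \<in> R) \<and> poly p' x = 1 / 2 \<and> degree p' < degree p"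
proof -
  note ring_closed = subring_mult[OF R] subring_add[OF R] subring_diff[OF R] subring_zero[OF R]
    subring_one[OF R] subring_of_nat[OF R] subring_sum[OF R]
  define n where "n = degree p"
  define m where "m = degree q"
  define b where "b = 1 - 2 * coeff q 0"
  have "coeff q 0 \<in> R" using q by blast
  then have b0: "b \<noteq> 0" using half unfolding b_def
    by (metis eq_iff_diff_eq_0 nonzero_mult_div_cancel_left zero_neq_numeral)
  have binv: "inverse b \<in> R" unfolding b_def using unit q by blast
  have two: "2 \<in> R" using subring_of_nat[OF R, of 2] by simp
  define c where "c j = inverse b * (2 * coeff q j)" for j
  have cR: "c j \<in> R" for j unfolding c_def using binv two q(1) ring_closed(1) by blast
  have n0: "n \<noteq> 0"
  proof
    assume "n = 0"
    then obtain a where "p = [:a:]" unfolding n_def by (metis degree_eq_zeroE)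
    with p(1) have "coeff [:a:] 0 \<in> R" by blast
    moreover have "a = 1 / 2" using p(2) \<open>p = [:a:]\<close> by simp
    ultimately show False using half by simp
  qed
  have "1 / 2 = (\<Sum>j\<le>m. coeff q j * inverse x ^ j)"
    using q(2) unfolding m_def poly_altdef by simp
  also have "{..m} = insert 0 {1..m}" by auto
  finally have "b = (\<Sum>j=1..m. 2 * coeff q j * inverse x ^ j)"
    unfolding b_def by (simp add: sum_distrib_left mult.assoc field_simps)
  then have "1 = (\<Sum>j=1..m. c j * inverse x ^ j)"
    using b0 unfolding c_def mult.assoc sum_distrib_left[symmetric] by simp
  then have "x ^ n = (\<Sum>j=1..m. c j * inverse x ^ j) * x ^ n" by simp
  also have "\<dots> = (\<Sum>j=1..m. c j * x ^ (n - j))"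
    unfolding sum_distrib_right
  proof (rule sum.cong)
    fix j assume "j \<in> {1..m}"
    then have "j \<le> n" using deg unfolding n_def m_def by simp
    then show "c j * inverse x ^ j * x ^ n = c j * x ^ (n - j)"
      using x by (simp add: power_diff field_simps)
  qed simp
  finally have xn: "x ^ n = (\<Sum>j=1..m. c j * x ^ (n - j))" .
  define s where "s = (\<Sum>j=1..m. monom (coeff p n * c j) (n - j))"
  define p' where "p' = p - monom (coeff p n) n + s"
  have "coeff s i \<in> R" for i
    unfolding s_def coeff_sum using p(1) cR by (auto intro!: ring_closed)
  then have "\<forall>i. coeff p' i \<in> R"
    unfolding p'_def using p(1) by (auto intro!: ring_closed)
  moreover have "poly p' x = 1 / 2"
    using p(2) unfolding p'_def s_def
    by (simp add: poly_sum poly_monom xn sum_distrib_left mult.assoc)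
  moreover have "degree p' < n"
  proof (rule degree_lessI)
    show "p' \<noteq> 0 \<or> 0 < n" using n0 by simp
    show "\<forall>i\<ge>n. coeff p' i = 0"
    proof (intro allI impI)
      fix i assume i: "i \<ge> n"
      have "coeff s i = 0" unfolding s_def coeff_sum using i n0 by (intro sum.neutral) auto
      moreover have "coeff (p - monom (coeff p n) n) i = 0"
        using i by (cases "i = n") (auto simp: n_def coeff_eq_0)
      ultimately show "coeff p' i = 0" unfolding p'_def by simp
    qed
  qed
  ultimately show ?thesis unfolding n_def by blast
qed

text \<open>
  A subring that is maximal among those without \<open>1/2\<close> is a valuation ring: if neither \<open>x\<close> nor \<open>1/x\<close>
  belonged to it, both adjunctions would contain \<open>1/2\<close>, and the two relations could be shortened
  against each other forever.
\<close>
theorem exists_valuation_ring_over_two: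
  "\<exists>R. subring_of_complex R \<and> 1 / 2 \<notin> R \<and> (\<forall>x. x \<in> R \<or> inverse x \<in> R)"
proof -
  define F where "F = {R. subring_of_complex R \<and> 1 / 2 \<notin> R}"
  have "\<int> \<in> F"
  proof -
    have "(1 / 2 :: complex) \<notin> \<int>"
    proof
      assume "(1 / 2 :: complex) \<in> \<int>"
      then obtain n :: int where "(1 / 2 :: complex) = of_int n" by (auto elim: Ints_cases)
      then have "(of_int 1 :: complex) = of_int (2 * n)" by (simp add: field_simps)
      then have "1 = 2 * n" using of_int_eq_iff by blast
      then show False by presburger
    qed
    then show ?thesis by (auto simp: F_def subring_of_complex_def)
  qed
  then have "F \<noteq> {}" by blast
  moreover have "\<Union>\<C> \<in> F" if "\<C> \<noteq> {}" "subset.chain F \<C>" for \<C>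
  proof -
    have mem: "subring_of_complex A \<and> 1 / 2 \<notin> A" if "A \<in> \<C>" for A
      using that \<open>subset.chain F \<C>\<close> by (auto simp: subset_chain_def F_def)
    have common: "\<exists>A\<in>\<C>. a \<in> A \<and> b \<in> A" if "a \<in> \<Union>\<C>" "b \<in> \<Union>\<C>" for a b
      using that \<open>subset.chain F \<C>\<close> unfolding subset_chain_def by blast
    have "a - b \<in> \<Union>\<C> \<and> a * b \<in> \<Union>\<C>" if "a \<in> \<Union>\<C>" "b \<in> \<Union>\<C>" for a b
      using common[OF that] mem unfolding subring_of_complex_def by blast
    then show ?thesis using mem \<open>\<C> \<noteq> {}\<close> by (fastforce simp: F_def subring_of_complex_def)
  qed
  ultimately obtain R where RF: "R \<in> F" and max: "\<And>X. X \<in> F \<Longrightarrow> R \<subseteq> X \<Longrightarrow> X = R"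
    using subset_Zorn_nonempty[of F] by blast
  have R: "subring_of_complex R" and half: "1 / 2 \<notin> R" using RF by (auto simp: F_def)
  have adj: "\<exists>p. (\<forall>i. coeff p i \<in> R) \<and> poly p c = 1 / 2" if "c \<notin> R" for c
  proof -
    have "adjoin R c \<noteq> R" using adjoin_contains(2)[OF R, of c] that by auto
    then have "adjoin R c \<notin> F" using max adjoin_contains(1)[OF R, of c] by blast
    then have "1 / 2 \<in> adjoin R c" using subring_adjoin[OF R, of c] by (auto simp: F_def)
    then show ?thesis unfolding adjoin_def[OF R] by (auto dest: sym)
  qed
  have unit: "inverse (1 - 2 * a) \<in> R" if a: "a \<in> R" for a
  proof (rule ccontr)
    define b where "b = 1 - 2 * a"
    assume "inverse (1 - 2 * a) \<notin> R"
    then obtain p where p: "\<forall>i. coeff p i \<in> R" "poly p (inverse b) = 1 / 2"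
      using adj unfolding b_def by blast
    have b0: "b \<noteq> 0" using half a unfolding b_def
      by (metis eq_iff_diff_eq_0 nonzero_mult_div_cancel_left zero_neq_numeral)
    have bR: "b \<in> R" unfolding b_def
      using subring_diff[OF R subring_one[OF R] subring_mult[OF R subring_of_nat[OF R, of 2] a]] by simp
    have pow: "\<exists>c\<in>R. b ^ n = 1 - 2 * c" for n
    proof (induction n)
      case 0
      show ?case using subring_zero[OF R] by (intro bexI[of _ 0]) auto
    next
      case (Suc n)
      then obtain c where c: "c \<in> R" "b ^ n = 1 - 2 * c" by blast
      have "b ^ Suc n = 1 - 2 * (a + c * b)"
        unfolding power_Suc2 c(2) by (simp add: b_def algebra_simps)
      moreover have "a + c * b \<in> R"
        by (intro subring_add[OF R] subring_mult[OF R] a c bR)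
      ultimately show ?case by blast
    qed
    define n where "n = degree p"
    have "b ^ n * (1 / 2) = (\<Sum>i\<le>n. coeff p i * b ^ (n - i))"
      unfolding p(2)[symmetric] poly_altdef n_def[symmetric] sum_distrib_left
      using b0 by (intro sum.cong) (auto simp: power_diff field_simps)
    also have "\<dots> \<in> R"
      using p(1) bR by (intro subring_sum[OF R] subring_mult[OF R] subring_power[OF R]) auto
    finally have *: "b ^ n * (1 / 2) \<in> R" .
    obtain c where c: "c \<in> R" "b ^ n = 1 - 2 * c" using pow by blast
    have "1 / 2 = b ^ n * (1 / 2) + c" using c by (simp add: field_simps)
    then show False using half subring_add[OF R * c(1)] by metis
  qed
  have descent: "False" if "\<forall>i. coeff p i \<in> R" "poly p x = 1 / 2"
      "\<forall>i. coeff q i \<in> R" "poly q (inverse x) = 1 / 2" "x \<noteq> 0" for p q x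
    using that
  proof (induction "degree p + degree q" arbitrary: p q rule: less_induct)
    case less
    show ?case
    proof (cases "degree q \<le> degree p")
      case True
      from half_relation_descent[OF R unit half less.prems(1-4) True less.prems(5)]
      obtain p' where "\<forall>i. coeff p' i \<in> R" "poly p' x = 1 / 2" "degree p' < degree p" by blast
      with less show ?thesis by (meson add_less_mono1)
    next
      case False
      have "poly p (inverse (inverse x)) = 1 / 2" using less.prems by simp
      from half_relation_descent[OF R unit half less.prems(3,4,1) this] False less.prems(5)
      obtain q' where "\<forall>i. coeff q' i \<in> R" "poly q' (inverse x) = 1 / 2" "degree q' < degree q"
        by auto
      with less show ?thesis by (meson add_strict_left_mono)
    qed
  qed
  have "x \<in> R \<or> inverse x \<in> R" for x
  proof (rule ccontr)
    assume *: "\<not> (x \<in> R \<or> inverse x \<in> R)"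
    then have "x \<noteq> 0" using subring_zero[OF R] by auto
    moreover obtain p q where "\<forall>i. coeff p i \<in> R" "poly p x = 1 / 2"
      "\<forall>i. coeff q i \<in> R" "poly q (inverse x) = 1 / 2"
      using adj[of x] adj[of "inverse x"] * by blast
    ultimately show False using descent by blast
  qed
  with R half show ?thesis by blast
qed

text \<open>
  The relations \<open>\<preceq>\<close>, \<open>\<prec>\<close> and \<open>\<asymp>\<close> below compare the valuations of two numbers; read \<open>a \<preceq> b\<close> as
  \<open>|a| \<le> |b|\<close> for a multiplicative ultrametric absolute value with \<open>|2| < 1\<close>. Divisibility in the
  ring replaces the value group, so that zero needs no separate treatment.
\<close>
locale dyadic_valuation_ring =
  fixes R :: "complex set"
  assumes subring: "subring_of_complex R"
    and half_notin: "1 / 2 \<notin> R"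
    and mem_or_inverse_mem: "\<And>x. x \<in> R \<or> inverse x \<in> R"
begin

lemmas ring_closed = subring_zero[OF subring] subring_one[OF subring] subring_add[OF subring]
  subring_diff[OF subring] subring_mult[OF subring] subring_uminus[OF subring]
  subring_of_nat[OF subring] subring_of_int[OF subring] subring_power[OF subring]
  subring_sum[OF subring]

definition le :: "complex \<Rightarrow> complex \<Rightarrow> bool" (infix "\<preceq>" 50) where
  "a \<preceq> b \<longleftrightarrow> (\<exists>c\<in>R. a = c * b)"

definition lt :: "complex \<Rightarrow> complex \<Rightarrow> bool" (infix "\<prec>" 50) where
  "a \<prec> b \<longleftrightarrow> \<not> b \<preceq> a"

definition same :: "complex \<Rightarrow> complex \<Rightarrow> bool" (infix "\<asymp>" 50) where
  "a \<asymp> b \<longleftrightarrow> a \<preceq> b \<and> b \<preceq> a"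

lemma le_one_iff: "a \<preceq> 1 \<longleftrightarrow> a \<in> R"
  by (auto simp: le_def)

lemma le_refl [simp, intro!]: "a \<preceq> a"
  unfolding le_def by (intro bexI[of _ 1]) (auto intro: ring_closed)

lemma zero_le [simp, intro!]: "0 \<preceq> a"
  unfolding le_def by (intro bexI[of _ 0]) (auto intro: ring_closed)

lemma le_zero_iff [simp]: "a \<preceq> 0 \<longleftrightarrow> a = 0"
  by (auto simp: le_def intro: ring_closed)

lemma le_trans [trans]: "a \<preceq> b \<Longrightarrow> b \<preceq> c \<Longrightarrow> a \<preceq> c"
  unfolding le_def by (metis ring_closed(5) mult.assoc)

lemma le_linear: "a \<preceq> b \<or> b \<preceq> a"
proof (cases "a = 0 \<or> b = 0")
  case False
  then have "a = (a / b) * b" "b = inverse (a / b) * a" by (auto simp: field_simps)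
  then show ?thesis unfolding le_def using mem_or_inverse_mem[of "a / b"] by blast
qed auto

lemma le_mult: "a \<preceq> b \<Longrightarrow> c \<preceq> d \<Longrightarrow> a * c \<preceq> b * d"
  unfolding le_def by (metis ring_closed(5) mult.assoc mult.commute)

lemma le_mult_left: "c \<preceq> 1 \<Longrightarrow> a \<preceq> b \<Longrightarrow> c * a \<preceq> b"
  using le_mult[of c 1 a b] by simp

lemma le_mult_right: "a \<preceq> b \<Longrightarrow> c \<preceq> 1 \<Longrightarrow> a * c \<preceq> b"
  using le_mult[of a b c 1] by simp

lemma le_mult_cancel: "c \<noteq> 0 \<Longrightarrow> a * c \<preceq> b * c \<longleftrightarrow> a \<preceq> b"
  unfolding le_def by (metis mult.assoc mult_right_cancel)

lemma le_power: "a \<preceq> b \<Longrightarrow> a ^ n \<preceq> b ^ n"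
  by (induction n) (auto intro: le_mult)

lemma le_add: "a \<preceq> c \<Longrightarrow> b \<preceq> c \<Longrightarrow> a + b \<preceq> c"
  unfolding le_def by (metis ring_closed(3) distrib_right)

lemma uminus_le_iff [simp]: "- a \<preceq> b \<longleftrightarrow> a \<preceq> b"
  unfolding le_def by (metis ring_closed(6) minus_minus mult_minus_left)

lemma le_uminus_iff [simp]: "a \<preceq> - b \<longleftrightarrow> a \<preceq> b"
  unfolding le_def by (metis ring_closed(6) minus_minus mult_minus_left mult_minus_right)

lemma le_diff: "a \<preceq> c \<Longrightarrow> b \<preceq> c \<Longrightarrow> a - b \<preceq> c"
  using le_add[of a c "- b"] by simp

lemma lt_imp_le: "a \<prec> b \<Longrightarrow> a \<preceq> b"
  using le_linear lt_def by blast

lemma lt_irrefl [simp]: "\<not> a \<prec> a"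
  by (simp add: lt_def)

lemma lt_le_trans [trans]: "a \<prec> b \<Longrightarrow> b \<preceq> c \<Longrightarrow> a \<prec> c"
  unfolding lt_def using le_trans by blast

lemma le_lt_trans [trans]: "a \<preceq> b \<Longrightarrow> b \<prec> c \<Longrightarrow> a \<prec> c"
  unfolding lt_def using le_trans by blast

lemma lt_trans [trans]: "a \<prec> b \<Longrightarrow> b \<prec> c \<Longrightarrow> a \<prec> c"
  using lt_le_trans lt_imp_le by blast

lemma lt_imp_nonzero: "a \<prec> b \<Longrightarrow> b \<noteq> 0"
  by (auto simp: lt_def)

lemma zero_lt_iff [simp]: "0 \<prec> a \<longleftrightarrow> a \<noteq> 0"
  by (auto simp: lt_def)

lemma lt_mult_cancel: "c \<noteq> 0 \<Longrightarrow> a * c \<prec> b * c \<longleftrightarrow> a \<prec> b"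
  unfolding lt_def by (simp add: le_mult_cancel)

lemma lt_mult_le: "a \<prec> b \<Longrightarrow> c \<preceq> d \<Longrightarrow> d \<noteq> 0 \<Longrightarrow> a * c \<prec> b * d"
proof (cases "c = 0")
  case False
  assume *: "a \<prec> b" "c \<preceq> d" "d \<noteq> 0"
  have "a * c \<prec> b * c" using * False by (simp add: lt_mult_cancel)
  also have "\<dots> \<preceq> b * d" using * by (intro le_mult) auto
  finally show ?thesis .
qed (auto dest: lt_imp_nonzero)

lemma lt_add: "a \<prec> c \<Longrightarrow> b \<prec> c \<Longrightarrow> a + b \<prec> c"
  using le_linear[of a b] le_add[of a b b] le_add[of a a b] le_lt_trans by blast

lemma uminus_lt_iff [simp]: "- a \<prec> b \<longleftrightarrow> a \<prec> b" and lt_uminus_iff [simp]: "a \<prec> - b \<longleftrightarrow> a \<prec> b"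
  by (auto simp: lt_def)

lemma lt_diff: "a \<prec> c \<Longrightarrow> b \<prec> c \<Longrightarrow> a - b \<prec> c"
  using lt_add[of a c "- b"] by simp

lemma same_refl [simp, intro!]: "a \<asymp> a"
  by (simp add: same_def)

lemma same_sym: "a \<asymp> b \<Longrightarrow> b \<asymp> a"
  by (simp add: same_def)

lemma same_trans [trans]: "a \<asymp> b \<Longrightarrow> b \<asymp> c \<Longrightarrow> a \<asymp> c"
  unfolding same_def using le_trans by blast

lemma same_le_trans [trans]: "a \<asymp> b \<Longrightarrow> b \<preceq> c \<Longrightarrow> a \<preceq> c"
  and le_same_trans [trans]: "a \<preceq> b \<Longrightarrow> b \<asymp> c \<Longrightarrow> a \<preceq> c"
  and same_lt_trans [trans]: "a \<asymp> b \<Longrightarrow> b \<prec> c \<Longrightarrow> a \<prec> c"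
  and lt_same_trans [trans]: "a \<prec> b \<Longrightarrow> b \<asymp> c \<Longrightarrow> a \<prec> c"
  unfolding same_def using le_trans le_lt_trans lt_le_trans by blast+

lemma same_mult: "a \<asymp> b \<Longrightarrow> c \<asymp> d \<Longrightarrow> a * c \<asymp> b * d"
  by (simp add: same_def le_mult)

lemma same_mult_cancel: "c \<noteq> 0 \<Longrightarrow> a * c \<asymp> b * c \<longleftrightarrow> a \<asymp> b"
  by (simp add: same_def le_mult_cancel)

lemma same_zero_iff: "a \<asymp> b \<Longrightarrow> a = 0 \<longleftrightarrow> b = 0"
  by (auto simp: same_def)

lemma same_uminus_iff [simp]: "- a \<asymp> b \<longleftrightarrow> a \<asymp> b" "a \<asymp> - b \<longleftrightarrow> a \<asymp> b"
  by (auto simp: same_def)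

lemma same_power: "a \<asymp> b \<Longrightarrow> a ^ n \<asymp> b ^ n"
  by (simp add: same_def le_power)

lemma same_add: "b \<prec> a \<Longrightarrow> a + b \<asymp> a"
proof -
  assume b: "b \<prec> a"
  then have "a + b \<preceq> a" by (simp add: le_add lt_imp_le)
  moreover have "a \<preceq> a + b"
  proof (rule ccontr)
    assume "\<not> a \<preceq> a + b"
    then have "a + b \<prec> a" by (simp add: lt_def)
    from lt_diff[OF this b] show False by simp
  qed
  ultimately show ?thesis by (simp add: same_def)
qed

lemma same_add': "b \<prec> a \<Longrightarrow> b + a \<asymp> a"
  using same_add[of b a] by (simp add: add.commute)

lemma same_diff: "b \<prec> a \<Longrightarrow> a - b \<asymp> a" and same_diff': "b \<prec> a \<Longrightarrow> b - a \<asymp> a"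
  using same_add[of "- b" a] same_add'[of b "- a"] by simp_all

lemma le_imp_lt_or_same: "a \<preceq> b \<Longrightarrow> a \<prec> b \<or> a \<asymp> b"
  by (auto simp: lt_def same_def)

lemma square_le_imp_le: "a ^ 2 \<preceq> b ^ 2 \<Longrightarrow> a \<preceq> b"
proof (rule ccontr)
  assume *: "a ^ 2 \<preceq> b ^ 2" "\<not> a \<preceq> b"
  then have "b \<prec> a" by (simp add: lt_def)
  then have "b * b \<prec> a * a" by (intro lt_mult_le lt_imp_le) (auto dest: lt_imp_nonzero)
  then show False using * by (simp add: lt_def power2_eq_square)
qed

lemma square_same_imp_same: "a ^ 2 \<asymp> b ^ 2 \<Longrightarrow> a \<asymp> b"
  by (auto simp: same_def intro: square_le_imp_le)

lemma of_int_le_one [simp, intro!]: "of_int n \<preceq> 1" and of_nat_le_one [simp, intro!]: "of_nat k \<preceq> 1"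
  and numeral_le_one [simp, intro!]: "numeral w \<preceq> 1"
  using ring_closed(7)[of "numeral w"] by (auto simp: le_one_iff intro: ring_closed)

lemma two_lt_one: "2 \<prec> 1"
proof -
  have "\<not> 1 \<preceq> 2"
  proof
    assume "1 \<preceq> 2"
    then obtain c where "c \<in> R" "1 = c * 2" by (auto simp: le_def)
    moreover from this have "c = 1 / 2" by (simp add: field_simps)
    ultimately show False using half_notin by simp
  qed
  then show ?thesis by (simp add: lt_def)
qed

lemma four_lt_two: "4 \<prec> 2"
  using lt_mult_cancel[of 2 2 1] two_lt_one by simp

lemma even_le_two: "even (n :: int) \<Longrightarrow> of_int n \<preceq> 2"
  by (auto simp: le_def elim!: evenE intro!: bexI[of _ "of_int _"] ring_closed)

lemma odd_same_one: "odd (n :: int) \<Longrightarrow> of_int n \<asymp> 1"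
proof -
  assume "odd n"
  then obtain m where "n = 2 * m + 1" by (auto elim: oddE)
  then have "of_int n = 1 + (2 * of_int m :: complex)" by simp
  moreover have "2 * complex_of_int m \<prec> 1"
    by (rule le_lt_trans[OF le_mult_right two_lt_one]) auto
  ultimately show ?thesis using same_add by metis
qed

lemma odd_nat_same_one: "odd (n :: nat) \<Longrightarrow> of_nat n \<asymp> 1"
  using odd_same_one[of "int n"] by simp

lemma same_one_imp_nonzero: "a \<asymp> 1 \<Longrightarrow> a \<noteq> 0"
  by (auto simp: same_def)

lemma same_one_cong: "u \<asymp> 1 \<Longrightarrow> u * a \<asymp> a" "u \<asymp> 1 \<Longrightarrow> a * u \<asymp> a"
  using same_mult[of u 1 a a] same_mult[of a a u 1] by simp_all

lemma same_one_inverse: "u \<asymp> 1 \<Longrightarrow> inverse u \<asymp> 1"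
  using same_mult_cancel[of u "inverse u" 1] same_one_imp_nonzero[of u] by (simp add: same_sym)

lemma same_one_powi: "u \<asymp> 1 \<Longrightarrow> u powi n \<asymp> 1"
  using same_power[of u 1] same_power[OF same_one_inverse, of u] by (simp add: power_int_def)

lemma power_minus_one_le: "e \<preceq> 1 \<Longrightarrow> e ^ n - 1 \<preceq> e - 1"
proof -
  assume e: "e \<preceq> 1"
  then have "(\<Sum>i<n. e ^ i) \<preceq> 1" by (auto simp: le_one_iff intro!: ring_closed)
  moreover have "e ^ n - 1 = (e - 1) * (\<Sum>i<n. e ^ i)" by (rule power_diff_1_eq)
  ultimately show ?thesis by (simp add: le_mult_right)
qed

lemma power_odd_minus_one:
  assumes e: "e - 1 \<prec> 1" and n: "odd n"
  shows "e ^ n - 1 \<asymp> e - 1"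
proof -
  have e1: "e \<preceq> 1" using le_add[OF lt_imp_le[OF e] le_refl] by simp
  have "(\<Sum>i<m. e ^ i - 1) \<preceq> e - 1" for m
    by (induction m) (auto intro: le_add power_minus_one_le e1)
  then have "(\<Sum>i<n. e ^ i - 1) \<prec> 1" using e le_lt_trans by blast
  moreover have "1 \<asymp> complex_of_nat n" using n by (simp add: odd_nat_same_one same_sym)
  ultimately have "(\<Sum>i<n. e ^ i - 1) \<prec> of_nat n" by (rule lt_same_trans)
  then have "(\<Sum>i<n. e ^ i - 1) + of_nat n \<asymp> of_nat n" by (rule same_add')
  also have "\<dots> \<asymp> 1" using n by (rule odd_nat_same_one)
  also have "(\<Sum>i<n. e ^ i - 1) + of_nat n = (\<Sum>i<n. e ^ i)"
    by (simp add: sum_subtractf)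
  finally show ?thesis unfolding power_diff_1_eq[of e n] by (rule same_one_cong)
qed

text \<open>
  The exact and the approximate form of \<open>|e\<^sup>n - 1| = |n| |e - 1|\<close> for \<open>e\<close> near 1. An odd factor of
  \<open>n\<close> never matters; a factor 2 multiplies \<open>e\<^sup>m - 1\<close> by \<open>e\<^sup>m + 1\<close>, which differs from 2 by
  \<open>e\<^sup>m - 1\<close>. So the estimate needs \<open>|e - 1| \<le> |2|\<close> and equality needs strictness there.
\<close>
lemma power_minus_one_le_times:
  assumes e: "e - 1 \<preceq> 2"
  shows "e ^ n - 1 \<preceq> of_nat n * (e - 1)"
proof (induction n rule: less_induct)
  case (less n)
  have e1: "e \<preceq> 1" using le_add[OF le_trans[OF e lt_imp_le[OF two_lt_one]] le_refl] by simp
  show ?case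
  proof (cases "even n")
    case True
    then obtain m where m: "n = 2 * m" by (auto elim: evenE)
    have "e ^ m + 1 \<preceq> 2"
      using le_add[OF le_trans[OF power_minus_one_le[OF e1, of m] e], of 2] by (simp add: add.commute)
    moreover have "e ^ m - 1 \<preceq> of_nat m * (e - 1)"
      using less[of m] m by (cases "m = 0") auto
    ultimately have "(e ^ m + 1) * (e ^ m - 1) \<preceq> 2 * (of_nat m * (e - 1))" by (intro le_mult)
    then show ?thesis by (simp add: m power_mult power2_eq_square algebra_simps)
  next
    case False
    have "e ^ n - 1 \<preceq> 1 * (e - 1)" using power_minus_one_le[OF e1] by simp
    also have "\<dots> \<asymp> of_nat n * (e - 1)"
      by (intro same_mult same_refl same_sym[OF odd_nat_same_one[OF False]])
    finally show ?thesis .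
  qed
qed

lemma power_minus_one_same_times:
  assumes e: "e - 1 \<prec> 2"
  shows "e ^ n - 1 \<asymp> of_nat n * (e - 1)"
proof (induction n rule: less_induct)
  case (less n)
  have e': "e - 1 \<prec> 1" using lt_trans[OF e two_lt_one] .
  then have e1: "e \<preceq> 1" using le_add[OF lt_imp_le le_refl, of "e - 1" 1] by simp
  show ?case
  proof (cases "even n")
    case True
    then obtain m where m: "n = 2 * m" by (auto elim: evenE)
    have "(e ^ m - 1) + 2 \<asymp> 2"
      by (intro same_add' le_lt_trans[OF power_minus_one_le[OF e1] e])
    then have "e ^ m + 1 \<asymp> 2" by (simp add: add.commute)
    moreover have "e ^ m - 1 \<asymp> of_nat m * (e - 1)"
      using less[of m] m by (cases "m = 0") auto
    ultimately have "(e ^ m + 1) * (e ^ m - 1) \<asymp> 2 * (of_nat m * (e - 1))" by (intro same_mult)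
    then show ?thesis by (simp add: m power_mult power2_eq_square algebra_simps)
  next
    case False
    have "e ^ n - 1 \<asymp> 1 * (e - 1)" using power_odd_minus_one[OF e'] False by simp
    also have "\<dots> \<asymp> of_nat n * (e - 1)"
      by (intro same_mult same_refl same_sym[OF odd_nat_same_one[OF False]])
    finally show ?thesis .
  qed
qed

lemma powi_minus_one_same_power:
  assumes e: "e \<asymp> 1"
  shows "e powi n - 1 \<asymp> e ^ nat \<bar>n\<bar> - 1"
proof (cases "n \<ge> 0")
  case False
  define m where "m = nat (- n)"
  have "e ^ m \<noteq> 0" using same_one_imp_nonzero[OF e] by simp
  then have "e powi n - 1 = - inverse (e ^ m) * (e ^ m - 1)"
    using False by (simp add: power_int_def m_def field_simps)
  moreover have "- inverse (e ^ m) \<asymp> 1"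
    using same_one_inverse[of "e ^ m"] same_power[OF e, of m] by simp
  ultimately show ?thesis using same_one_cong(1) False by (simp add: m_def)
qed (simp add: power_int_def)

lemma powi_minus_one_le_times:
  assumes e: "e \<asymp> 1" "e - 1 \<preceq> 2"
  shows "e powi n - 1 \<preceq> of_int n * (e - 1)"
proof -
  note powi_minus_one_same_power[OF e(1)]
  also have "e ^ nat \<bar>n\<bar> - 1 \<preceq> of_nat (nat \<bar>n\<bar>) * (e - 1)" by (rule power_minus_one_le_times[OF e(2)])
  finally show ?thesis using le_uminus_iff[of "e powi n - 1" "of_int n * (e - 1)"]
    by (cases "n \<ge> 0") simp_all
qed

lemma powi_odd_minus_one:
  assumes e: "e \<asymp> 1" "e - 1 \<prec> 1" "odd n"
  shows "e powi n - 1 \<asymp> e - 1"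
proof -
  note powi_minus_one_same_power[OF e(1)]
  also have "e ^ nat \<bar>n\<bar> - 1 \<asymp> e - 1" using e by (intro power_odd_minus_one) (auto simp: even_nat_iff)
  finally show ?thesis .
qed

text \<open>
  The Newton polygon of \<open>(X - a) (X - b)\<close>: if the product is smaller than the square of the sum,
  its two slopes differ and the larger root has the size of the sum.
\<close>
lemma same_sum_of_small_product:
  assumes sum: "a + b \<asymp> c" and prod: "a * b \<prec> c * c"
  shows "a \<asymp> c \<or> b \<asymp> c"
proof -
  have gen: "b \<asymp> c" if "a \<preceq> b" "a + b \<asymp> c" "a * b \<prec> c * c" for a b
  proof -
    have "a \<prec> b"
    proof (rule ccontr)
      assume "\<not> a \<prec> b"
      then have "b \<preceq> a" by (simp add: lt_def)
      have "c \<preceq> a + b" using that by (simp add: same_def)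
      also have "\<dots> \<preceq> a" using \<open>b \<preceq> a\<close> by (simp add: le_add)
      finally have "c \<preceq> a" .
      moreover from this that have "c \<preceq> b" using le_trans by blast
      ultimately have "c * c \<preceq> a * b" by (rule le_mult)
      with that show False by (simp add: lt_def)
    qed
    then have "b \<asymp> a + b" by (rule same_sym[OF same_add'])
    also note that(2)
    finally show ?thesis .
  qed
  show ?thesis using gen[of a b] gen[of b a] le_linear[of a b] assms by (auto simp: ac_simps)
qed

end

section \<open>The sequences and their Wronskians\<close>

text \<open>
  Identities that are linear or quadratic in the sequences propagate along the recurrence in both
  directions; this induction proves them for all integer indices at once.
\<close>
lemma int_shift_induct:
  fixes P :: "int \<Rightarrow> bool"
  assumes "P a" "\<And>j. P j \<longleftrightarrow> P (j + 1)"
  shows "P j"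
  using assms(1)
  by (induction j rule: int_induct[where k = a]) (use assms(2) in \<open>auto simp: assms(2)[of "_ - 1"]\<close>)

abbreviation cpoly :: "int poly \<Rightarrow> complex poly" where
  "cpoly \<equiv> map_poly of_int"

definition fval :: "complex \<Rightarrow> int \<Rightarrow> complex" where
  "fval u j = poly (cpoly (fpol j)) u"

definition dfval :: "complex \<Rightarrow> int \<Rightarrow> complex" where
  "dfval u j = poly (pderiv (cpoly (fpol j))) u"

lemma cpoly_fpol_Suc: "cpoly (fpol (j + 1)) = [:0, 1:] * cpoly (fpol j) - cpoly (fpol (j - 1))"
proof -
  have "fpol (j + 1) = [:0, 1:] * fpol j - fpol (j - 1)"
    using fpol_recurrence[of j] by (simp add: algebra_simps)
  moreover have "cpoly (p - q) = cpoly p - cpoly q" for p q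
    by (rule poly_eqI) (simp add: coeff_map_poly)
  moreover have "cpoly ([:0, 1:] * p) = [:0, 1:] * cpoly p" for p
    by (rule poly_eqI) (simp add: coeff_map_poly coeff_pCons split: nat.split)
  ultimately show ?thesis by metis
qed

lemma fval_0 [simp]: "fval u 0 = 0" and fval_1 [simp]: "fval u 1 = 1"
  and dfval_0 [simp]: "dfval u 0 = 0" and dfval_1 [simp]: "dfval u 1 = 0"
  by (simp_all add: fval_def dfval_def fpol_0 fpol_1)

lemma fval_Suc: "fval u (j + 1) = u * fval u j - fval u (j - 1)"
  unfolding fval_def cpoly_fpol_Suc by simp

lemma dfval_Suc: "dfval u (j + 1) = u * dfval u j + fval u j - dfval u (j - 1)"
  unfolding fval_def dfval_def cpoly_fpol_Suc by (simp add: pderiv_diff pderiv_mult pderiv_pCons)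

lemma fval_prev: "fval u (j - 1) = u * fval u j - fval u (j + 1)"
  using fval_Suc[of u j] by simp

lemma fval_minus_one [simp]: "fval u (- 1) = - 1" and fval_two [simp]: "fval u 2 = u"
  using fval_prev[of u 0] fval_Suc[of u 1] by simp_all

text \<open>
  Solutions of the recurrence form a two-dimensional space with a basis of shifts of \<open>f\<close>. The
  addition formulas below are instances.
\<close>
lemma recurrence_solution:
  fixes s :: "int \<Rightarrow> complex"
  assumes rec: "\<And>j. s (j + 1) = u * s j - s (j - 1)"
  shows "s j = s 1 * fval u j - s 0 * fval u (j - 1)"
proof -
  define P where "P j \<longleftrightarrow> s j = s 1 * fval u j - s 0 * fval u (j - 1) \<and>
    s (j + 1) = s 1 * fval u (j + 1) - s 0 * fval u j" for j
  have "P 0" by (simp add: P_def)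
  moreover have "P j \<longleftrightarrow> P (j + 1)" for j
    unfolding P_def add_diff_cancel_right' rec[of "j + 1"] fval_Suc[of u "j + 1"] fval_Suc[of u j] rec[of j]
    by algebra
  ultimately have "P j" by (rule int_shift_induct)
  then show ?thesis by (simp add: P_def)
qed

lemma fval_add: "fval u (i + j) = fval u (i + 1) * fval u j - fval u i * fval u (j - 1)"
  using recurrence_solution[of "\<lambda>j. fval u (i + j)" u j] fval_Suc[of u "i + _"]
  by (simp add: algebra_simps)

lemma fval_uminus: "fval u (- j) = - fval u j"
proof -
  have "fval u (- (j + 1)) = u * fval u (- j) - fval u (- (j - 1))" for j
  proof -
    have "- (j + 1) = - j - 1" "- (j - 1) = - j + 1" by simp_all
    then show ?thesis by (metis fval_prev)
  qed
  from recurrence_solution[of "\<lambda>j. fval u (- j)", OF this] show ?thesis by simp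
qed

lemma fval_cassini: "fval u (j + 1) ^ 2 - u * fval u (j + 1) * fval u j + fval u j ^ 2 = 1"
proof (induct j rule: int_shift_induct[where a = 0])
  case (2 j)
  show ?case
    unfolding add_diff_cancel_right' fval_Suc[of u "j + 1"] by algebra
qed simp

lemma fval_diff: "fval u (n - i) = fval u (n - 1) * fval u i - fval u n * fval u (i - 1)"
  using fval_add[of u "n - 1" "1 - i"] fval_uminus[of u "i - 1"] fval_uminus[of u i] by simp

lemma fval_add': "fval u (n + i) = fval u n * fval u (i + 1) - fval u (n - 1) * fval u i"
  using fval_add[of u "n - 1" "i + 1"] by simp

lemma fval_double: "fval u (2 * j) = fval u j * (fval u (j + 1) - fval u (j - 1))"
  using fval_add[of u j j] by (simp add: algebra_simps)

lemma fval_double_succ: "fval u (2 * j + 1) = fval u (j + 1) ^ 2 - fval u j ^ 2"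
  using fval_add[of u j "j + 1"] by (simp add: power2_eq_square algebra_simps)

definition gval :: "complex \<Rightarrow> int \<Rightarrow> complex" where
  "gval u j = fval u j - fval u (j - 1)"

text \<open>
  The values of \<open>F'G - FG'\<close> for \<open>(F,G) = (f\<^sub>m, f\<^bsub>m-1\<^esub>)\<close> and for \<open>(F,G) = (g\<^bsub>m+1\<^esub>, g\<^sub>m)\<close>, which are
  the pairs \<open>(\<Phi>\<^bsub>k+1\<^esub>, \<Phi>\<^bsub>k-1\<^esub>)\<close> for \<open>k = 2m - 1\<close> and for \<open>k = 2m\<close>. By the recurrence they are the sums
  of \<open>f\<^sub>i\<^sup>2\<close> over \<open>1 \<le> i < m\<close> and of \<open>g\<^sub>i\<^sup>2\<close> over \<open>1 \<le> i \<le> m\<close> when \<open>m \<ge> 1\<close>.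
\<close>
definition wronskian_f :: "complex \<Rightarrow> int \<Rightarrow> complex" where
  "wronskian_f u m = dfval u m * fval u (m - 1) - fval u m * dfval u (m - 1)"

definition wronskian_g :: "complex \<Rightarrow> int \<Rightarrow> complex" where
  "wronskian_g u m = (dfval u (m + 1) - dfval u m) * gval u m - gval u (m + 1) * (dfval u m - dfval u (m - 1))"

lemma wronskian_f_Suc: "wronskian_f u (m + 1) = wronskian_f u m + fval u m ^ 2"
  unfolding wronskian_f_def add_diff_cancel_right' fval_Suc[of u m] dfval_Suc[of u m] by algebra

lemma wronskian_f_1 [simp]: "wronskian_f u 1 = 0" by (simp add: wronskian_f_def)

lemma wronskian_f_0 [simp]: "wronskian_f u 0 = 0" using wronskian_f_Suc[of u 0] by simp

lemma wronskian_g_Suc: "wronskian_g u (m + 1) = wronskian_g u m + gval u (m + 1) ^ 2"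
proof -
  have "fval u (m - 1) = u * fval u m - fval u (m + 1)"
    "dfval u (m - 1) = u * dfval u m + fval u m - dfval u (m + 1)"
    using fval_Suc[of u m] dfval_Suc[of u m] by (simp_all add: algebra_simps)
  then show ?thesis
    unfolding wronskian_g_def gval_def add_diff_cancel_right' fval_Suc[of u "m + 1"] dfval_Suc[of u "m + 1"]
    by algebra
qed

lemma wronskian_g_0 [simp]: "wronskian_g u 0 = 0"
proof -
  have "dfval u (-1) = 0" using dfval_Suc[of u 0] by simp
  then show ?thesis by (simp add: wronskian_g_def)
qed

lemma wronskian_g_eq: "(u + 2) * wronskian_g u m = fval u (2 * m) + of_int (2 * m)"
proof (induct m rule: int_shift_induct[where a = 0])
  case (2 m)
  define p q where "p = fval u (m + 1)" and "q = fval u m"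
  have c: "p ^ 2 - u * p * q + q ^ 2 = 1" using fval_cassini by (simp add: p_def q_def)
  have "fval u (2 * m) = q * (2 * p - u * q)"
    unfolding fval_double by (simp add: p_def q_def fval_prev algebra_simps)
  moreover have "fval u (2 * (m + 1)) = p * (u * p - 2 * q)"
    unfolding fval_double add_diff_cancel_right' fval_Suc[of u "m + 1"] p_def[symmetric] q_def[symmetric]
    by algebra
  ultimately have "fval u (2 * (m + 1)) + 2 - fval u (2 * m) = (u + 2) * (p - q) ^ 2"
    using c by algebra
  moreover have "wronskian_g u (m + 1) = wronskian_g u m + (p - q) ^ 2"
    unfolding wronskian_g_Suc by (simp add: gval_def p_def q_def)
  moreover have "complex_of_int (2 * (m + 1)) = of_int (2 * m) + 2" by simp
  ultimately show ?case by algebra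
qed simp

lemma wronskian_f_eq: "(u ^ 2 - 4) * wronskian_f u (m + 1) = fval u (2 * m + 1) - of_int (2 * m + 1)"
proof (induct m rule: int_shift_induct[where a = 0])
  case (2 m)
  define p q where "p = fval u (m + 1)" and "q = fval u m"
  have c: "p ^ 2 - u * p * q + q ^ 2 = 1" using fval_cassini by (simp add: p_def q_def)
  have "fval u (m + 1 + 1) = u * p - q" using fval_Suc[of u "m + 1"] by (simp add: p_def q_def)
  then have "fval u (2 * (m + 1) + 1) - 2 - fval u (2 * m + 1) = (u ^ 2 - 4) * p ^ 2"
    using c unfolding fval_double_succ p_def[symmetric] q_def[symmetric] by simp algebra
  moreover have "wronskian_f u (m + 1 + 1) = wronskian_f u (m + 1) + p ^ 2"
    unfolding wronskian_f_Suc by (simp add: p_def)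
  moreover have "complex_of_int (2 * (m + 1) + 1) = of_int (2 * m + 1) + 2" by simp
  ultimately show ?case by algebra
qed simp

text \<open>
  Sums of squares double well because \<open>g\<^bsub>n+i+1\<^esub>\<^sup>2 - g\<^bsub>n-i\<^esub>\<^sup>2\<close> factors as
  \<open>(u - 2) f\<^bsub>2n\<^esub> f\<^bsub>2i+1\<^esub>\<close> and the \<open>f\<^bsub>2i+1\<^esub>\<close> with \<open>0 \<le> i < n\<close> add up to \<open>f\<^sub>n\<^sup>2\<close>: the upper half of the sum is
  the lower half plus a term with the factor \<open>f\<^bsub>2n\<^esub>\<close>, which is small at arguments divisible by 2.
\<close>
lemma wronskian_g_double:
  "wronskian_g u (2 * n) = 2 * wronskian_g u n + (u - 2) * fval u (2 * n) * fval u n ^ 2"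
proof -
  have "wronskian_g u (n + i) + wronskian_g u (n - i) =
    2 * wronskian_g u n + (u - 2) * fval u (2 * n) * fval u i ^ 2" for i
  proof (induct i rule: int_shift_induct[where a = 0])
    case (2 i)
    define a b p q where "a = fval u n" and "b = fval u (n - 1)"
      and "p = fval u (i + 1)" and "q = fval u i"
    have c: "p ^ 2 - u * p * q + q ^ 2 = 1" "a ^ 2 - u * a * b + b ^ 2 = 1"
      using fval_cassini[of u i] fval_cassini[of u "n - 1"] by (simp_all add: p_def q_def a_def b_def)
    have s: "fval u (n + 1) = u * a - b"
      using fval_Suc[of u n] by (simp add: a_def b_def)
    have "fval u (n + i) = a * p - b * q" "fval u (n + i + 1) = (u * a - b) * p - a * q"
        "fval u (n - i - 1) = b * p - a * q"
      using fval_add'[of u n i] fval_add[of u n "i + 1"] fval_diff[of u n "i + 1"] s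
      by (simp_all add: p_def q_def a_def b_def add.assoc diff_diff_eq)
    moreover have "fval u (n - i) = b * q - a * (u * q - p)"
      using fval_diff[of u n i] fval_prev[of u i] by (simp add: p_def q_def a_def b_def)
    ultimately have "gval u (n + i + 1) = ((u * a - b) * p - a * q) - (a * p - b * q)"
      "gval u (n - i) = (b * q - a * (u * q - p)) - (b * p - a * q)"
      unfolding gval_def by simp_all
    moreover have "fval u (2 * n) = a * (u * a - 2 * b)"
      unfolding fval_double s by (simp add: a_def b_def algebra_simps)
    ultimately have "gval u (n + i + 1) ^ 2 - gval u (n - i) ^ 2 =
        (u - 2) * fval u (2 * n) * (p ^ 2 - q ^ 2)"
      using c by algebra
    moreover have "wronskian_g u (n + (i + 1)) = wronskian_g u (n + i) + gval u (n + i + 1) ^ 2"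
      using wronskian_g_Suc[of u "n + i"] by (simp add: algebra_simps)
    moreover have "wronskian_g u (n - i) = wronskian_g u (n - (i + 1)) + gval u (n - i) ^ 2"
      using wronskian_g_Suc[of u "n - i - 1"] by (simp add: algebra_simps)
    ultimately show ?case
      unfolding p_def[symmetric] q_def[symmetric] by algebra
  qed simp
  from this[of n] show ?thesis by simp
qed

text \<open>
  The analogous factorization is \<open>f\<^bsub>n+i\<^esub>\<^sup>2 - f\<^bsub>n-i\<^esub>\<^sup>2 = f\<^bsub>2n\<^esub> f\<^bsub>2i\<^esub>\<close>, and the \<open>f\<^bsub>2i\<^esub>\<close> with \<open>1 \<le> i \<le> n\<close> add up
  to \<open>f\<^sub>n f\<^bsub>n+1\<^esub>\<close>.
\<close>
lemma wronskian_f_double: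
  "wronskian_f u (2 * n + 1) = 2 * wronskian_f u (n + 1) - fval u n ^ 2
     + fval u (2 * n) * fval u n * fval u (n + 1)"
proof -
  have "wronskian_f u (n + i + 1) + wronskian_f u (n - i) =
    wronskian_f u (n + 1) + wronskian_f u n + fval u (2 * n) * (fval u i * fval u (i + 1))" for i
  proof (induct i rule: int_shift_induct[where a = 0])
    case (2 i)
    define a b p q where "a = fval u n" and "b = fval u (n - 1)"
      and "p = fval u (i + 1)" and "q = fval u i"
    have c: "p ^ 2 - u * p * q + q ^ 2 = 1" "a ^ 2 - u * a * b + b ^ 2 = 1"
      using fval_cassini[of u i] fval_cassini[of u "n - 1"] by (simp_all add: p_def q_def a_def b_def)
    have s: "fval u (n + 1) = u * a - b" "fval u (i + 1 + 1) = u * p - q"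
      using fval_Suc[of u n] fval_Suc[of u "i + 1"] by (simp_all add: a_def b_def p_def q_def)
    have "fval u (n + i + 1) = (u * a - b) * p - a * q" "fval u (n - i - 1) = b * p - a * q"
      using fval_add[of u n "i + 1"] fval_diff[of u n "i + 1"] s
      by (simp_all add: p_def q_def a_def b_def add.assoc diff_diff_eq)
    moreover have "fval u (2 * n) = a * (u * a - 2 * b)"
      unfolding fval_double s by (simp add: a_def b_def algebra_simps)
    ultimately have "fval u (n + i + 1) ^ 2 - fval u (n - i - 1) ^ 2 =
        fval u (2 * n) * (p * (u * p - q) - q * p)"
      using c by algebra
    moreover have "wronskian_f u (n + (i + 1) + 1) = wronskian_f u (n + i + 1) + fval u (n + i + 1) ^ 2"
      using wronskian_f_Suc[of u "n + i + 1"] by (simp add: algebra_simps)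
    moreover have "wronskian_f u (n - i) = wronskian_f u (n - (i + 1)) + fval u (n - i - 1) ^ 2"
      using wronskian_f_Suc[of u "n - i - 1"] by (simp add: algebra_simps)
    moreover note s(2)
    ultimately show ?case
      unfolding p_def[symmetric] q_def[symmetric] by algebra
  qed simp
  from this[of n] show ?thesis using wronskian_f_Suc[of u n] by simp
qed

text \<open>
  In the coordinate \<open>u = x + 1/x\<close> this is the derivative of \<open>(x\<^sup>j - x\<^bsup>-j\<^esup>)/(x - 1/x)\<close>. Induction along
  the recurrence also covers \<open>u = \<plusminus> 2\<close>.
\<close>
lemma dfval_eq: "(u ^ 2 - 4) * dfval u j = of_int j * (fval u (j + 1) - fval u (j - 1)) - u * fval u j"
proof -
  define P where "P j \<longleftrightarrow> (u ^ 2 - 4) * dfval u j = of_int j * (fval u (j + 1) - fval u (j - 1)) - u * fval u j" for j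
  have "P j \<and> P (j + 1)"
  proof (induct j rule: int_shift_induct[where a = 0])
    case 1
    show ?case by (simp add: P_def)
  next
    case (2 j)
    define p q where "p = fval u (j + 1)" and "q = fval u j"
    have f: "fval u (j + 1 + 1) = u * p - q" "fval u (j - 1) = u * q - p"
       "fval u (j + 1 + 1 + 1) = u * (u * p - q) - p" "fval u (j + 1 - 1) = q" "fval u (j + 1 + 1 - 1) = p"
      unfolding add_diff_cancel_right' fval_Suc[of u "j + 1 + 1"] fval_Suc[of u "j + 1"] fval_prev[of u j]
        p_def q_def by simp_all
    have d: "dfval u (j + 1 + 1) = u * dfval u (j + 1) + p - dfval u j"
      using dfval_Suc[of u "j + 1"] by (simp add: p_def)
    have "P j \<longleftrightarrow> P (j + 1 + 1)" if "P (j + 1)"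
      using that unfolding P_def f d p_def[symmetric] q_def[symmetric] of_int_add of_int_1 by algebra
    then show ?case by blast
  qed
  then show ?thesis by (simp add: P_def)
qed

lemma powi_shift:
  fixes x :: complex
  assumes "x \<noteq> 0"
  shows "x powi (j + 1) = x powi j * x" "x powi (j - 1) = x powi j * inverse x"
    "x powi (- (j + 1)) = x powi (- j) * inverse x" "x powi (- (j - 1)) = x powi (- j) * x"
  using assms power_int_add[of x j 1] power_int_add[of x j "- 1"]
    power_int_add[of x "- j" 1] power_int_add[of x "- j" "- 1"] by (simp_all add: power_int_minus)
lemma fval_powi:
  assumes x: "x \<noteq> 0" "u = x + inverse x"
  shows "(x - inverse x) * fval u j = x powi j - x powi (- j)"
proof -
  have rec: "x powi (j + 1) - x powi (- (j + 1)) =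
     u * (x powi j - x powi (- j)) - (x powi (j - 1) - x powi (- (j - 1)))" for j
    unfolding powi_shift[OF x(1)] x(2) by algebra
  show ?thesis
    using recurrence_solution[of "\<lambda>j. x powi j - x powi (- j)", OF rec, of j]
    by (simp add: power_int_minus)
qed

lemma fval_reciprocal:
  assumes x: "x \<noteq> 0" "u = x + inverse x" "x - inverse x \<noteq> 0"
  shows "fval u (j + 1) - fval u (j - 1) = x powi j + x powi (- j)"
proof -
  have "(x - inverse x) * (fval u (j + 1) - fval u (j - 1)) =
      (x powi (j + 1) - x powi (- (j + 1))) - (x powi (j - 1) - x powi (- (j - 1)))"
    unfolding right_diff_distrib fval_powi[OF x(1,2)] ..
  also have "\<dots> = (x - inverse x) * (x powi j + x powi (- j))"
    unfolding powi_shift[OF x(1)] by algebra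
  finally show ?thesis using x(3) by simp
qed

lemma exists_reciprocal_pair: "\<exists>x :: complex. x \<noteq> 0 \<and> u = x + inverse x"
proof -
  define s where "s = csqrt (u ^ 2 - 4)"
  have "s ^ 2 = u ^ 2 - 4" by (simp add: s_def)
  then have *: "((u + s) / 2) * ((u - s) / 2) = 1" by (simp add: field_simps power2_eq_square)
  then have "inverse ((u + s) / 2) = (u - s) / 2" by (rule inverse_unique)
  with * show ?thesis by (intro exI[of _ "(u + s) / 2"]) (auto simp: field_simps)
qed
lemma gval_reflect: "gval u (1 - j) = gval u j"
  using fval_uminus[of u "j - 1"] fval_uminus[of u j] by (simp add: gval_def)

lemma wronskian_g_uminus: "wronskian_g u (- m) = - wronskian_g u m"
proof (induct m rule: int_shift_induct[where a = 0])
  case (2 m)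
  have "wronskian_g u (- m) = wronskian_g u (- (m + 1)) + gval u (m + 1) ^ 2"
    using wronskian_g_Suc[of u "- (m + 1)"] gval_reflect[of u "m + 1"] by simp
  then show ?case unfolding wronskian_g_Suc[of u m] by algebra
qed simp

lemma wronskian_f_uminus: "wronskian_f u (- m) = - wronskian_f u (m + 1)"
proof (induct m rule: int_shift_induct[where a = 0])
  case (2 m)
  have "wronskian_f u (- m) = wronskian_f u (- (m + 1)) + fval u (m + 1) ^ 2"
    using wronskian_f_Suc[of u "- (m + 1)"] fval_uminus[of u "m + 1"] by simp
  then show ?case using wronskian_f_Suc[of u "m + 1"] by (auto simp: algebra_simps)
qed simp

section \<open>Critical points at the prime 2\<close>

context dyadic_valuation_ring
begin

lemma fval_le_one: "u \<preceq> 1 \<Longrightarrow> fval u j \<preceq> 1"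
proof -
  assume u: "u \<preceq> 1"
  have "fval u j \<preceq> 1 \<and> fval u (j + 1) \<preceq> 1"
  proof (induct j rule: int_shift_induct[where a = 0])
    case (2 j)
    have "fval u (j + 1 + 1) = u * fval u (j + 1) - fval u j" using fval_Suc[of u "j + 1"] by simp
    moreover have "fval u j = u * fval u (j + 1) - fval u (j + 1 + 1)" using fval_Suc[of u "j + 1"] by simp
    ultimately show ?case by (metis le_diff le_mult_left u)
  qed auto
  then show ?thesis ..
qed

text \<open>
  By the Cassini identity, \<open>g\<^sub>j\<^sup>2 - 1 = (u - 2) f\<^sub>j f\<^bsub>j-1\<^esub>\<close>.
\<close>
lemma gval_square_near_one:
  assumes u: "u \<prec> 1"
  shows "gval u j ^ 2 - 1 \<prec> 1"
proof -
  have f: "fval u i \<preceq> 1" for i using fval_le_one lt_imp_le[OF u] .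
  have "gval u j ^ 2 - 1 = (u - 2) * (fval u j * fval u (j - 1))"
    using fval_cassini[of u "j - 1"] unfolding gval_def by simp algebra
  also have "\<dots> \<preceq> u - 2" using le_mult[OF f f, of j "j - 1"] by (auto intro: le_mult_right)
  also have "\<dots> \<prec> 1" using u two_lt_one by (rule lt_diff)
  finally show ?thesis .
qed

lemma wronskian_g_odd_same_one:
  assumes u: "u \<prec> 1" and m: "odd m"
  shows "wronskian_g u m \<asymp> 1"
proof -
  have "wronskian_g u m - of_int m \<prec> 1"
  proof (induct m rule: int_shift_induct[where a = 0])
    case (2 j)
    have e: "wronskian_g u (j + 1) - of_int (j + 1) = (wronskian_g u j - of_int j) + (gval u (j + 1) ^ 2 - 1)"
      by (simp add: wronskian_g_Suc)
    then have "wronskian_g u j - of_int j = (wronskian_g u (j + 1) - of_int (j + 1)) - (gval u (j + 1) ^ 2 - 1)"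
      by simp
    then show ?case using e gval_square_near_one[OF u, of "j + 1"] by (metis lt_add lt_diff)
  qed simp
  then have "wronskian_g u m - of_int m \<prec> of_int m"
    using odd_same_one[OF m] same_sym lt_same_trans by blast
  from same_add'[OF this] have "wronskian_g u m \<asymp> of_int m" by simp
  also note odd_same_one[OF m]
  finally show ?thesis .
qed

context
  fixes u :: complex
  assumes u: "u \<preceq> 2"
begin

lemma u_small: "u \<prec> 1" "u \<preceq> 1"
  using le_lt_trans[OF u two_lt_one] by (auto intro: lt_imp_le)

lemmas f_le_one = fval_le_one[OF u_small(2)]

lemma cval_le_two: "fval u (j + 1) - fval u (j - 1) \<preceq> 2"
proof -
  have "fval u (j + 1) - fval u (j - 1) = u * fval u j - 2 * fval u (j - 1)"
    by (simp add: fval_Suc)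
  moreover have "u * fval u j \<preceq> 2" "2 * fval u (j - 1) \<preceq> 2"
    using u f_le_one by (auto intro: le_mult_right)
  ultimately show ?thesis by (metis le_diff)
qed

lemma fval_even_le: "fval u (2 * int n) \<preceq> 2 * of_nat n"
proof (induction n rule: less_induct)
  case (less n)
  have "fval u (int n) \<preceq> of_nat n"
  proof (cases "even n")
    case True
    then obtain m where "n = 2 * m" by (auto elim: evenE)
    then show ?thesis using less[of m] by (cases "m = 0") auto
  next
    case False
    then show ?thesis using f_le_one[of "int n"] odd_nat_same_one same_sym le_same_trans by blast
  qed
  then have "fval u (int n) * (fval u (int n + 1) - fval u (int n - 1)) \<preceq> of_nat n * 2"
    using cval_le_two by (rule le_mult)
  then show ?case unfolding fval_double by (metis mult.commute)
qed

lemma four_nat_lt: "n \<noteq> 0 \<Longrightarrow> 4 * of_nat n \<prec> 2 * of_nat n"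
  using four_lt_two lt_mult_cancel[of "of_nat n" 4 2] by simp

text \<open>
  Induction on the power of 2 in \<open>n\<close>. For odd \<open>n\<close> this is a sum of \<open>n\<close> squares that are all close to
  1. Doubling \<open>n\<close> doubles the sum, up to the smaller term of \<open>wronskian_g_double\<close>.
\<close>
lemma wronskian_g_same: "n \<noteq> 0 \<Longrightarrow> wronskian_g u (int n) \<asymp> of_nat n"
proof (induction n rule: less_induct)
  case (less n)
  show ?case
  proof (cases "even n")
    case True
    then obtain m where m: "n = 2 * m" "m \<noteq> 0" using less.prems by (auto elim: evenE)
    have "(u - 2) * fval u (2 * int m) * fval u (int m) ^ 2 \<preceq> 2 * (2 * of_nat m) * 1 ^ 2"
      by (intro le_mult le_power fval_even_le f_le_one le_diff u le_refl)
    also have "\<dots> \<prec> 2 * of_nat m" using four_nat_lt[OF m(2)] by simp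
    also have "2 * of_nat m \<asymp> 2 * wronskian_g u (int m)"
      using less.IH[of m] m by (intro same_mult same_sym[of _ "of_nat m"]) auto
    finally have *: "(u - 2) * fval u (2 * int m) * fval u (int m) ^ 2 \<prec> 2 * wronskian_g u (int m)" .
    have "wronskian_g u (2 * int m) \<asymp> 2 * wronskian_g u (int m)"
      unfolding wronskian_g_double by (rule same_add[OF *])
    also have "\<dots> \<asymp> 2 * of_nat m" using less.IH[of m] m by (intro same_mult) auto
    finally show ?thesis using m by simp
  next
    case False
    then have "wronskian_g u (int n) \<asymp> 1" using wronskian_g_odd_same_one[OF u_small(1)] by simp
    also have "1 \<asymp> complex_of_nat n" using odd_nat_same_one[OF False] by (rule same_sym)
    finally show ?thesis .
  qed
qed

lemma wronskian_g_nonzero: "m \<noteq> 0 \<Longrightarrow> wronskian_g u m \<noteq> 0"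
proof -
  assume m: "m \<noteq> 0"
  have "wronskian_g u (int n) \<noteq> 0" if "n \<noteq> 0" for n
    using same_zero_iff[OF wronskian_g_same[OF that]] that by simp
  from this[of "nat \<bar>m\<bar>"] show ?thesis using m wronskian_g_uminus[of u m] by (cases "m \<ge> 0") auto
qed

lemma fval_odd_square: "odd m \<Longrightarrow> fval u (int m) ^ 2 \<asymp> 1"
proof -
  assume m: "odd m"
  then obtain n where n: "m = 2 * n + 1" by (auto elim: oddE)
  have "fval u (2 * int n) \<preceq> 2"
    by (rule le_trans[OF fval_even_le]) (auto intro: le_mult_right)
  then have "fval u (2 * int n) \<prec> 1" using two_lt_one le_lt_trans by blast
  then have "(u * fval u (2 * int n + 1) - fval u (2 * int n)) * fval u (2 * int n) \<prec> 1 * 1"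
    by (subst mult.commute) (intro lt_mult_le le_diff f_le_one le_mult_left u_small, auto)
  moreover have "fval u (int m) ^ 2 =
      1 + (u * fval u (2 * int n + 1) - fval u (2 * int n)) * fval u (2 * int n)"
    using fval_cassini[of u "2 * int n"] by (simp add: n power2_eq_square algebra_simps)
  ultimately show ?thesis using same_add by simp
qed

text \<open>
  This is a sum of \<open>2n\<close> squares, for which \<open>wronskian_f_double\<close> has three terms. If \<open>n\<close> is odd, the
  term \<open>f\<^sub>n\<^sup>2\<close> is a unit and dominates; if \<open>n\<close> is even, twice the sum of \<open>n\<close> squares dominates.
\<close>
lemma wronskian_f_same: "n \<noteq> 0 \<Longrightarrow> wronskian_f u (2 * int n + 1) \<asymp> of_nat n"
proof (induction n rule: less_induct)
  case (less n)
  have third: "fval u (2 * int n) * fval u (int n) * fval u (int n + 1) \<preceq> 2 * of_nat n"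
    by (intro le_mult_right fval_even_le f_le_one)
  show ?case
  proof (cases "even n")
    case True
    then obtain m where m: "n = 2 * m" "m \<noteq> 0" using less.prems by (auto elim: evenE)
    have "fval u (int n) ^ 2 \<preceq> (2 * of_nat m) ^ 2"
      using fval_even_le[of m] by (intro le_power) (simp add: m)
    also have "\<dots> \<preceq> 4 * of_nat m"
      using le_mult[OF le_refl of_nat_le_one, of "4 * of_nat m" m] by (simp add: power2_eq_square algebra_simps)
    finally have "fval u (2 * int n) * fval u (int n) * fval u (int n + 1) - fval u (int n) ^ 2
        \<preceq> 4 * of_nat m"
      using third m by (intro le_diff) auto
    also have "\<dots> \<prec> 2 * of_nat m" using four_nat_lt[OF m(2)] .
    also have "\<dots> \<asymp> 2 * wronskian_f u (2 * int m + 1)"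
      using less.IH[of m] m by (intro same_mult same_sym[of _ "of_nat m"]) auto
    finally have *: "2 * wronskian_f u (2 * int m + 1) + (fval u (2 * int n) * fval u (int n) * fval u (int n + 1) - fval u (int n) ^ 2)
      \<asymp> 2 * wronskian_f u (2 * int m + 1)" by (rule same_add)
    also have "\<dots> \<asymp> 2 * of_nat m" using less.IH[of m] m by (intro same_mult) auto
    finally show ?thesis unfolding wronskian_f_double[of u "int n"] using m by (simp add: algebra_simps)
  next
    case False
    have w: "wronskian_f u (int j + 1) \<preceq> 1" for j
    proof (induction j)
      case (Suc j)
      then show ?case using wronskian_f_Suc[of u "int j + 1"] le_power[OF f_le_one, of "int j + 1" 2]
        by (simp add: add.commute le_add)
    qed simp
    have "2 * wronskian_f u (int n + 1) + fval u (2 * int n) * fval u (int n) * fval u (int n + 1) \<preceq> 2"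
      using w third by (intro le_add) (auto intro: le_mult_right le_trans)
    also have "2 \<prec> 1" by (rule two_lt_one)
    also have "1 \<asymp> - (fval u (int n) ^ 2)" using fval_odd_square[OF False] by (simp add: same_sym)
    finally have "2 * wronskian_f u (int n + 1) + fval u (2 * int n) * fval u (int n) * fval u (int n + 1)
       + - (fval u (int n) ^ 2) \<asymp> - (fval u (int n) ^ 2)"
      by (rule same_add')
    also have "\<dots> \<asymp> 1" using fval_odd_square[OF False] by simp
    also have "1 \<asymp> complex_of_nat n" using odd_nat_same_one[OF False] by (rule same_sym)
    finally show ?thesis unfolding wronskian_f_double by (simp add: algebra_simps)
  qed
qed

text \<open>
  If the number of squares in the sum is odd, one more square can be added: it is too small to
  change the size of the sum.
\<close>
lemma wronskian_f_nonzero: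
  assumes "m \<noteq> 0" "m \<noteq> 1"
  shows "wronskian_f u m \<noteq> 0"
proof -
  have pos: "wronskian_f u (int j + 1) \<noteq> 0" if "j \<noteq> 0" for j
  proof (cases "even j")
    case True
    then obtain n where n: "j = 2 * n" by (rule evenE)
    then have "n \<noteq> 0" using that by simp
    from same_zero_iff[OF wronskian_f_same[OF this]] this show ?thesis by (simp add: n)
  next
    case False
    then obtain n where "j = 2 * n + 1" by (auto elim: oddE)
    define m where "m = Suc n"
    have j: "int j + 1 = 2 * int m" using \<open>j = 2 * n + 1\<close> by (simp add: m_def)
    have "fval u (2 * int m) ^ 2 \<preceq> (2 * of_nat m) ^ 2" by (intro le_power fval_even_le)
    also have "\<dots> \<preceq> 2 * of_nat m"
      using le_mult[OF le_refl, of "2 * of_nat m" 1 "2 * of_nat m"] le_mult[OF numeral_le_one of_nat_le_one, of _ m]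
      by (simp add: power2_eq_square)
    also have "\<dots> \<prec> 1 * of_nat m" using two_lt_one by (subst lt_mult_cancel) (auto simp: m_def simp del: of_nat_Suc)
    also have "\<dots> \<asymp> wronskian_f u (2 * int m + 1)"
      using wronskian_f_same[of m] by (simp add: m_def same_sym del: of_nat_Suc)
    finally have "fval u (2 * int m) ^ 2 \<noteq> wronskian_f u (2 * int m + 1)" by auto
    then show ?thesis unfolding j using wronskian_f_Suc[of u "2 * int m"] by auto
  qed
  show ?thesis
  proof (cases "m \<ge> 0")
    case True
    then show ?thesis using pos[of "nat (m - 1)"] assms by auto
  next
    case False
    then show ?thesis using pos[of "nat (- m)"] wronskian_f_uminus[of u "- m"] by auto
  qed
qed

end

text \<open>
  Roots satisfy \<open>f\<^bsub>2m\<^esub>(u) = -2m\<close>, but for \<open>|u| > 1\<close> the values \<open>|f\<^sub>n(u)|\<close> increase strictly with \<open>n\<close>.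
\<close>
lemma wronskian_g_root_integral:
  assumes m: "m \<noteq> 0" and root: "wronskian_g u m = 0"
  shows "u \<preceq> 1"
proof (rule ccontr)
  assume "\<not> u \<preceq> 1"
  then have u: "1 \<prec> u" by (simp add: lt_def)
  have grow: "fval u (int n) \<prec> fval u (int n + 1)" for n
  proof (induction n)
    case (Suc n)
    let ?p = "fval u (int n + 1)"
    have p0: "?p \<noteq> 0" using Suc by (auto dest: lt_imp_nonzero)
    have "?p \<prec> u * ?p" using lt_mult_cancel[OF p0, of 1 u] u by simp
    moreover from this have "fval u (int n) \<prec> u * ?p" using Suc lt_trans by blast
    then have "u * ?p \<asymp> u * ?p - fval u (int n)" by (rule same_sym[OF same_diff])
    ultimately show ?case using lt_same_trans fval_Suc[of u "int n + 1"]
      by (simp add: add.commute)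
  qed simp
  have large: "1 \<preceq> fval u (int n + 1)" for n
  proof (induction n)
    case (Suc n)
    have "fval u (int (Suc n)) = fval u (int n + 1)" by (simp add: add.commute)
    then show ?case using le_trans[OF Suc] lt_imp_le[OF grow[of "Suc n"]] by simp
  qed simp
  define n where "n = nat \<bar>m\<bar>"
  have n: "n \<noteq> 0" and "wronskian_g u (int n) = 0"
    using m root wronskian_g_uminus[of u m] by (cases "m \<ge> 0"; simp add: n_def)+
  then have "fval u (2 * int n) = - of_nat (2 * n)" using wronskian_g_eq[of u "int n"] by (simp add: add_eq_0_iff)
  then have "fval u (2 * int n) \<preceq> 1" by (simp del: of_nat_mult)
  moreover have "1 \<prec> fval u (2 * int n)"
  proof -
    obtain k where k: "n = Suc k" using n by (cases n) auto
    have "int (2 * k) + 1 = int (2 * k + 1)" "int (2 * k + 1) + 1 = 2 * int n" by (simp_all add: k)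
    then show ?thesis using le_lt_trans[OF large[of "2 * k"], of "fval u (2 * int n)"] grow[of "2 * k + 1"] by metis
  qed
  ultimately show False by (simp add: lt_def)
qed

end

section \<open>Common critical values for two even indices\<close>

context dyadic_valuation_ring
begin

lemma of_int_eq_two_power_odd:
  assumes "n \<noteq> 0"
  obtains i m where "n = 2 ^ i * m" "odd (m :: int)" "of_int n \<asymp> 2 ^ i"
proof -
  obtain m where m: "n = 2 ^ multiplicity 2 n * m" "\<not> 2 dvd m"
    using multiplicity_decompose'[of n 2] assms by auto
  have "of_int n = 2 ^ multiplicity 2 n * complex_of_int m" by (subst m(1)) simp
  moreover have "2 ^ multiplicity 2 n * complex_of_int m \<asymp> 2 ^ multiplicity 2 n"
    using same_one_cong(2)[OF odd_same_one] m(2) by blast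
  ultimately show ?thesis using that[OF m] by simp
qed

lemma two_power_lt: "i < j \<Longrightarrow> 2 ^ j \<preceq> 2 * (2 :: complex) ^ i"
proof -
  assume "i < j"
  then obtain d where "j = Suc i + d" using less_iff_Suc_add by auto
  then have "(2 :: complex) ^ j = 2 ^ d * (2 * 2 ^ i)" by (simp add: power_add)
  also have "\<dots> \<preceq> 2 * 2 ^ i" using le_power[of 2 1 d] by (intro le_mult_left le_refl) simp
  finally show ?thesis .
qed

lemma two_power_le_two: "j > 0 \<Longrightarrow> (2 :: complex) ^ j \<preceq> 2"
  using two_power_lt[of 0 j] by simp

lemma unit_of_integral_sum:
  assumes "x \<noteq> 0" "x + inverse x \<preceq> 1"
  shows "x \<asymp> 1"
proof -
  have gen: "x \<preceq> 1" if "x + inverse x \<preceq> 1" for x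
  proof -
    have "x = (x + inverse x) - inverse x" by simp
    then show ?thesis using mem_or_inverse_mem[of x] that le_diff le_one_iff by metis
  qed
  have "inverse x \<preceq> 1" using gen[of "inverse x"] assms by (simp add: add.commute)
  then have "x * inverse x \<preceq> x * 1" by (intro le_mult) auto
  then show ?thesis using gen[OF assms(2)] assms(1) by (simp add: same_def)
qed

text \<open>
  If the sizes of \<open>w\<close> and \<open>t\<close> differed, the larger one of \<open>w\<^sup>2 e\<close> and \<open>t\<^sup>2\<close> would exceed all other terms.
\<close>
lemma quadratic_root_same:
  assumes t: "2 \<prec> t" "t \<preceq> 1" and e: "e \<asymp> 1" and eq: "w ^ 2 * e + 2 * t * w + t ^ 2 - 4 = 0"
  shows "w \<asymp> t"
proof -
  have tt: "t ^ 2 - 4 \<asymp> t ^ 2"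
  proof (rule same_diff)
    have "2 * 2 \<prec> t * t" using t by (intro lt_mult_le lt_imp_le) (auto dest: lt_imp_nonzero)
    then show "4 \<prec> t ^ 2" by (simp add: power2_eq_square)
  qed
  have tw: "2 * t * w \<prec> s ^ 2" if "t \<preceq> s" "w \<preceq> s" for s
  proof -
    have "s \<noteq> 0" using that t by (auto dest: lt_imp_nonzero)
    have "2 * (t * w) \<prec> 1 * (s * s)"
      by (rule lt_mult_le[OF two_lt_one le_mult]) (use that \<open>s \<noteq> 0\<close> in auto)
    then show ?thesis by (simp add: power2_eq_square mult.assoc)
  qed
  have ww: "w ^ 2 * e \<asymp> w ^ 2" using e by (rule same_one_cong)
  have "\<not> t \<prec> w"
  proof
    assume lt: "t \<prec> w"
    have "t * t \<prec> w * w" using lt by (intro lt_mult_le lt_imp_le) (auto dest: lt_imp_nonzero)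
    then have "t ^ 2 - 4 \<prec> w ^ 2" using same_lt_trans[OF tt] by (simp add: power2_eq_square)
    then have "- (2 * t * w + (t ^ 2 - 4)) \<prec> w ^ 2"
      using lt tw[of w] by (subst uminus_lt_iff, intro lt_add) (auto intro: lt_imp_le)
    moreover have "- (2 * t * w + (t ^ 2 - 4)) = w ^ 2 * e" using eq by algebra
    ultimately show False using ww same_sym same_lt_trans lt_irrefl by metis
  qed
  moreover have "\<not> w \<prec> t"
  proof
    assume lt: "w \<prec> t"
    have "w * w \<prec> t * t" using lt by (intro lt_mult_le lt_imp_le) (auto dest: lt_imp_nonzero)
    then have "w ^ 2 * e \<prec> t ^ 2" using same_lt_trans[OF ww] by (simp add: power2_eq_square)
    then have "- (2 * t * w + w ^ 2 * e) \<prec> t ^ 2"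
      using lt tw[of t] by (subst uminus_lt_iff, intro lt_add) (auto intro: lt_imp_le)
    moreover have "- (2 * t * w + w ^ 2 * e) = t ^ 2 - 4" using eq by algebra
    ultimately show False using tt same_sym same_lt_trans lt_irrefl by metis
  qed
  ultimately show ?thesis by (auto simp: lt_def same_def)
qed

text \<open>
  Eliminating \<open>y\<close> from \<open>t = y - z/l\<close> and \<open>y\<^sup>2 = z\<^sup>2 + 4\<close> gives
  \<open>(1 - l\<^sup>2) w\<^sup>2 + 2 t w + t\<^sup>2 - 4 = 0\<close> for \<open>w = z/l\<close>, and \<open>1 - l\<^sup>2\<close> is a unit as \<open>l\<close> is even.
\<close>
lemma critical_point_size:
  assumes l: "even l" and t: "2 \<prec> t" "t \<preceq> 1"
    and yz: "y ^ 2 = z ^ 2 + 4" "of_int l * t = of_int l * y - z" and l0: "l \<noteq> 0"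
  shows "z \<asymp> of_int l * t"
proof -
  define w where "w = z / of_int l"
  have z: "z = of_int l * w" and t': "t = y - w"
    using yz(2) l0 by (simp_all add: w_def field_simps)
  have "odd (1 - l ^ 2)" using l by simp
  from odd_same_one[OF this] have e: "1 - complex_of_int l ^ 2 \<asymp> 1" by simp
  have "w ^ 2 * (1 - of_int l ^ 2) + 2 * t * w + t ^ 2 - 4 = 0"
    using yz(1) unfolding z t' by algebra
  from quadratic_root_same[OF t e this] show ?thesis unfolding z by (intro same_mult same_refl)
qed

lemma size_of_reciprocal_difference:
  assumes x: "x \<noteq> 0" "u = x + inverse x" and u: "2 \<prec> u"
  shows "x - inverse x \<asymp> u"
proof (rule square_same_imp_same)
  have "2 * 2 \<prec> u * u" using u by (intro lt_mult_le lt_imp_le) (auto dest: lt_imp_nonzero)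
  then have "4 \<prec> u ^ 2" by (simp add: power2_eq_square)
  moreover have "(x - inverse x) ^ 2 = u ^ 2 - 4" using x by (simp add: power2_eq_square algebra_simps)
  ultimately show "(x - inverse x) ^ 2 \<asymp> u ^ 2" using same_diff by simp
qed

text \<open>
  Let \<open>C = x\<^sup>l + x\<^bsup>-l\<^esup>\<close> and \<open>D = x - 1/x\<close>, so that \<open>C\<^sup>2 = l\<^sup>2 D\<^sup>2 + 4\<close>. If 4 divides \<open>l\<close>, then
  \<open>|C| = |2|\<close>, and \<open>|2| < |u|\<close> suffices. If \<open>l = 2m\<close> with \<open>m\<close> odd, then \<open>u\<close> is a unit because the
  Wronskian is a unit wherever \<open>|u| < 1\<close>; and \<open>|C| \<le> |4|\<close> would give \<open>u\<^sup>2 \<equiv> -1\<close> modulo 4, hence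
  \<open>x\<^bsup>12\<^esup> \<equiv> 1\<close> and \<open>x\<^bsup>6l\<^esup> \<equiv> 1\<close> modulo 4, whereas \<open>x\<^bsup>6l\<^esup> - 1\<close> has the size of \<open>l D\<close>, which is that of 2.
\<close>
lemma four_lt_trace:
  assumes l: "even l" "l \<noteq> 0" and u: "2 \<prec> u" "u \<preceq> 1" and root: "wronskian_g u (l div 2) = 0"
    and x: "x \<noteq> 0" "u = x + inverse x" and x1: "x \<asymp> 1"
    and A: "x powi l - x powi (- l) = - of_int l * (x - inverse x)"
  shows "4 \<prec> u * (x powi l + x powi (- l))"
proof -
  define A where "A = x powi l"
  define C where "C = A + inverse A"
  define D where "D = x - inverse x"
  have A0: "A \<noteq> 0" "A \<asymp> 1" using x(1) same_one_powi[OF x1] by (auto simp: A_def)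
  have AD: "A - inverse A = - of_int l * D" using A by (simp add: A_def D_def power_int_minus)
  have C2: "C ^ 2 = of_int l ^ 2 * D ^ 2 + 4"
    using A0(1) AD unfolding C_def by (simp add: power2_eq_square field_simps) (algebra)
  have D2: "D ^ 2 = u ^ 2 - 4" using x by (simp add: D_def power2_eq_square algebra_simps)
  have Du: "D \<asymp> u" unfolding D_def using x u(1) by (rule size_of_reciprocal_difference)
  have C: "C = x powi l + x powi (- l)" by (simp add: C_def A_def power_int_minus)
  show ?thesis
  proof (cases "4 dvd l")
    case True
    then obtain n where n: "l = 4 * n" by (rule dvdE)
    have "of_int l ^ 2 * D ^ 2 = 16 * of_int (n ^ 2) * D ^ 2" by (simp add: n power_mult_distrib)
    also have "\<dots> \<preceq> 16"
      using same_le_trans[OF Du u(2)] le_power[of D 1 2] by (intro le_mult_right) (auto simp del: of_int_power)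
    also have "16 \<prec> 4" using lt_mult_cancel[of 4 4 1] lt_trans[OF four_lt_two two_lt_one] by simp
    finally have "C ^ 2 \<asymp> 2 ^ 2" unfolding C2 using same_add' by simp
    then have C2': "C \<asymp> 2" by (rule square_same_imp_same)
    then have "C \<noteq> 0" using same_zero_iff by fastforce
    then have "2 * 2 \<prec> u * C" using u(1) C2' by (intro lt_mult_le) (simp_all add: same_def)
    then show ?thesis using C by simp
  next
    case False
    define m where "m = l div 2"
    have l: "l = 2 * m" using l by (simp add: m_def)
    have m: "odd m" using False l by auto
    have u1: "u \<asymp> 1"
    proof (rule ccontr)
      assume "\<not> u \<asymp> 1"
      then have "u \<prec> 1" using u(2) le_imp_lt_or_same by blast
      from wronskian_g_odd_same_one[OF this m] root show False
        by (simp add: m_def same_def)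
    qed
    have "\<not> C \<preceq> 4"
    proof
      assume C4: "C \<preceq> 4"
      have four: "(4 :: complex) \<prec> 1" using four_lt_two two_lt_one by (rule lt_trans)
      obtain s where s: "m = 2 * s + 1" using m by (rule oddE)
      define c where "c = C / 4"
      have c: "c \<preceq> 1" "C = 4 * c" using C4 le_mult_cancel[of 4 "C / 4" 1] by (simp_all add: c_def)
      have "u ^ 2 + 1 = 4 * (c ^ 2 - of_int (s * (s + 1)) * u ^ 2 + of_int m ^ 2)"
      proof -
        have "16 * c ^ 2 = 4 * of_int m ^ 2 * (u ^ 2 - 4) + 4"
          using C2 D2 unfolding c(2) l by (simp add: power_mult_distrib)
        then show ?thesis unfolding s by simp algebra
      qed
      also have "\<dots> \<preceq> 4"
        by (intro le_mult_right le_add le_diff le_mult_left) (use u(2) c(1) le_power[of _ 1 2] in \<open>auto simp del: of_int_mult of_int_add\<close>)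
      finally have u4: "u ^ 2 + 1 \<preceq> 4" .
      have x12: "x ^ 12 - 1 \<preceq> 4"
      proof -
        have "x ^ 12 - 1 = x ^ 6 * u * D * ((u ^ 2 + 1) - 4) * (u ^ 2 - 1)"
        proof -
          have "x * u = x ^ 2 + 1" "x * D = x ^ 2 - 1"
            using x by (simp_all add: D_def power2_eq_square algebra_simps)
          moreover have "x ^ 6 * u * D * ((u ^ 2 + 1) - 4) * (u ^ 2 - 1) =
            (x * u) * (x * D) * ((x * u) ^ 2 - 3 * x ^ 2) * ((x * u) ^ 2 - x ^ 2)" by algebra
          ultimately have "x ^ 6 * u * D * ((u ^ 2 + 1) - 4) * (u ^ 2 - 1) =
            (x ^ 2 + 1) * (x ^ 2 - 1) * ((x ^ 2 + 1) ^ 2 - 3 * x ^ 2) * ((x ^ 2 + 1) ^ 2 - x ^ 2)" by simp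
          also have "\<dots> = x ^ 12 - 1" by algebra
          finally show ?thesis ..
        qed
        also have "\<dots> \<preceq> 4"
        proof -
          have "x ^ 6 * u * D \<preceq> 1"
            using le_power[of x 1 6] x1 u(2) same_le_trans[OF Du u(2)]
            by (intro le_mult_right) (simp_all add: same_def)
          moreover have "u ^ 2 + 1 - 4 \<preceq> 4" using u4 by (intro le_diff le_refl)
          moreover have "u ^ 2 - 1 \<preceq> 1" using le_power[OF u(2), of 2] by (intro le_diff) auto
          ultimately show ?thesis by (rule le_mult_right[OF le_mult_left])
        qed
        finally show ?thesis .
      qed
      have "A ^ 6 - 1 \<preceq> 4"
      proof -
        have "A ^ 6 = x powi (l * 6)"
          unfolding A_def by (simp only: power_int_mult power_int_numeral)
        moreover have "(x ^ 12) powi m = x powi (12 * m)"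
          by (simp only: power_int_mult power_int_numeral)
        ultimately have eq: "A ^ 6 - 1 = (x ^ 12) powi m - 1" by (simp add: l mult.commute)
        have one: "x ^ 12 \<asymp> 1" using same_power[OF x1, of 12] by simp
        have "(x ^ 12) powi m - 1 \<asymp> (x ^ 12) ^ nat \<bar>m\<bar> - 1"
          using one by (rule powi_minus_one_same_power)
        also have "\<dots> \<preceq> x ^ 12 - 1"
          using one by (intro power_minus_one_le) (simp add: same_def)
        also note x12
        finally show ?thesis unfolding eq .
      qed
      moreover have "A ^ 6 - 1 \<asymp> 2"
      proof -
        have "A ^ 6 - 1 = A ^ 3 * (- (2 * of_int m * D)) * (C ^ 2 - 1)"
        proof -
          have "A * inverse A = 1" using A0 by simp
          moreover have "- (2 * of_int m * D) = A - inverse A" using AD by (simp add: l)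
          ultimately show ?thesis unfolding C_def by algebra
        qed
        also have "\<dots> \<asymp> 1 * 2 * 1"
        proof (intro same_mult)
          show "A ^ 3 \<asymp> 1" using same_power[OF A0(2), of 3] by simp
          have "2 * of_int m * D \<asymp> 2 * 1 * 1"
            using same_trans[OF Du u1] odd_same_one[OF m] by (intro same_mult same_refl)
          then show "- (2 * of_int m * D) \<asymp> 2" by simp
          have "C ^ 2 \<prec> 1"
            using le_lt_trans[OF C4 four] lt_mult_le[of C 1 C 1] by (simp add: power2_eq_square lt_imp_le)
          from same_diff'[OF this] show "C ^ 2 - 1 \<asymp> 1" .
        qed
        finally show ?thesis by simp
      qed
      ultimately show False using four_lt_two by (metis le_lt_trans lt_irrefl same_def)
    qed
    then have "4 \<prec> C" by (simp add: lt_def)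
    also have "C \<asymp> u * C" using same_one_cong(1)[OF u1] by (rule same_sym)
    finally show ?thesis using C by simp
  qed
qed

lemma two_lt_critical_point:
  assumes "m \<noteq> 0" "wronskian_g u m = 0"
  shows "2 \<prec> u"
  using wronskian_g_nonzero[of u m] assms by (auto simp: lt_def)

text \<open>
  Sizes of integers are powers of \<open>|2|\<close>, and \<open>|t/r|\<close> lies strictly between \<open>|2|\<close> and \<open>|1/2|\<close>.
\<close>
lemma sizes_of_indices_agree:
  assumes k: "k \<noteq> 0" and l: "l \<noteq> 0"
    and t: "2 \<prec> t" "t \<preceq> 1" and r: "2 \<prec> r" "r \<preceq> 1"
    and eq: "of_int l * t \<asymp> of_int k * r"
  obtains e m n where "k = 2 ^ e * m" "odd m" "l = 2 ^ e * n" "odd n"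
proof -
  have not_less: "\<not> i < j" if eq: "2 ^ i * r \<asymp> 2 ^ j * t" and r: "2 \<prec> r" and t: "t \<preceq> 1" for i j r t
  proof
    assume "i < j"
    have "r * 2 ^ i \<asymp> 2 ^ j * t" using eq by (simp add: mult.commute)
    also have "2 ^ j * t \<preceq> 2 * 2 ^ i" using two_power_lt[OF \<open>i < j\<close>] t by (rule le_mult_right)
    finally have "r \<preceq> 2" by (subst (asm) le_mult_cancel) auto
    with r show False by (simp add: lt_def)
  qed
  obtain i m where k: "k = 2 ^ i * m" "odd m" "of_int k \<asymp> 2 ^ i"
    using of_int_eq_two_power_odd[OF k] by blast
  obtain j n where l: "l = 2 ^ j * n" "odd n" "of_int l \<asymp> 2 ^ j"
    using of_int_eq_two_power_odd[OF l] by blast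
  have "2 ^ j * t \<asymp> of_int l * t" by (intro same_mult same_refl same_sym[OF l(3)])
  also note eq
  also have "of_int k * r \<asymp> 2 ^ i * r" by (intro same_mult same_refl k(3))
  finally have "2 ^ j * t \<asymp> 2 ^ i * r" .
  then have "i = j"
    using not_less[of j t i r] not_less[of i r j t] t r same_sym by (metis linorder_neqE_nat)
  then show ?thesis using that k l by blast
qed

text \<open>
  Let \<open>L = |k| = |l|\<close> and \<open>P = |(k - l)/l|\<close>, both powers of \<open>|2|\<close> below 1. With \<open>A = x\<^sup>l\<close> and \<open>B = X\<^sup>k\<close>,
  the relations at the critical points become \<open>A - 1/A = -l(x - 1/x)\<close> and \<open>A + 1/A = y - l z\<close>, and
  likewise for \<open>B\<close>. As \<open>(B - A)(A - 1/B)\<close> is \<open>A\<close> times the difference of \<open>y - k z\<close> and \<open>y - l z\<close>,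
  one of its two factors has size \<open>L P\<close>. Since \<open>X/x\<close> is within \<open>P\<close> of 1, its \<open>k\<close>-th power is
  within \<open>L P\<close> of 1.

  If \<open>B\<close> is close to \<open>A\<close>, then \<open>x\<^bsup>k-l\<^esup>\<close> is within \<open>L P\<close> of 1. But a power of it with odd exponent is
  \<open>A\<close> raised to \<open>2\<^sup>j\<close> times an odd number, where \<open>P = |2\<^sup>j|\<close>, and \<open>|A\<^sup>2 - 1| = L |t|\<close> together with
  \<open>four_lt_trace\<close> shows that this is further away from 1.

  If \<open>B\<close> is close to \<open>1/A\<close>, then \<open>(B - 1/B) + (A - 1/A)\<close> has size at most \<open>|2| L P\<close>; but it equals
  \<open>-k(X - 1/X) - l(x - 1/x)\<close>, whose size is \<open>|2 t| L\<close>.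
\<close>
lemma no_common_critical_value_even:
  assumes k: "even k" "k \<noteq> 0" and l: "even l" "l \<noteq> 0" and kl: "k \<noteq> l"
    and r0: "wronskian_g r (k div 2) = 0" and t0: "wronskian_g t (l div 2) = 0"
    and yz: "y ^ 2 = z ^ 2 + 4"
    and kr: "of_int k * r = of_int k * y - z" and lt: "of_int l * t = of_int l * y - z"
    and Cr: "fval r (k + 1) - fval r (k - 1) = y - of_int k * z"
    and Ct: "fval t (l + 1) - fval t (l - 1) = y - of_int l * z"
  shows False
proof -
  have k2: "k div 2 \<noteq> 0" and l2: "l div 2 \<noteq> 0" using k l by auto
  have t: "2 \<prec> t" "t \<preceq> 1" using t0 l2 two_lt_critical_point wronskian_g_root_integral by blast+
  have r: "2 \<prec> r" "r \<preceq> 1" using r0 k2 two_lt_critical_point wronskian_g_root_integral by blast+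
  have t00: "t \<noteq> 0" using t by (auto dest: lt_imp_nonzero)
  have zt: "z \<asymp> of_int l * t" using critical_point_size[OF l(1) t yz lt l(2)] .
  have zr: "z \<asymp> of_int k * r" using critical_point_size[OF k(1) r yz kr k(2)] .
  obtain e m n where kf: "k = 2 ^ e * m" "odd m" and lf: "l = 2 ^ e * n" "odd n"
    using sizes_of_indices_agree[OF k(2) l(2) t r same_trans[OF same_sym[OF zt] zr]] by blast
  \<comment> \<open>This \<open>L\<close>, and \<open>P\<close> further down, are numbers of the sizes so called above.\<close>
  define L where "L = (2 :: complex) ^ e"
  have L0: "L \<noteq> 0" by (simp add: L_def)
  have ck: "of_int k = L * of_int m" and cl: "of_int l = L * of_int n" by (simp_all add: kf lf L_def)
  have kL: "of_int k \<asymp> L" and lL: "of_int l \<asymp> L"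
    unfolding ck cl using odd_same_one kf lf same_one_cong(2) by blast+
  have L2: "L \<preceq> 2"
    using same_le_trans[OF same_sym[OF lL] even_le_two[OF l(1)]] .
  have tr: "r \<asymp> t"
  proof -
    have "r * of_int k \<asymp> z" using zr by (simp add: mult.commute same_sym)
    also have "z \<asymp> t * of_int l" using zt by (simp add: mult.commute)
    also have "\<dots> \<asymp> t * of_int k" using kL lL same_sym same_trans by (intro same_mult) blast+
    finally show ?thesis using k by (simp add: same_mult_cancel)
  qed
  have "m - n \<noteq> 0" "even (m - n)" using kl kf lf by auto
  then obtain j d where d: "m - n = 2 ^ j * d" "odd d" "of_int (m - n) \<asymp> 2 ^ j"
    using of_int_eq_two_power_odd[of "m - n"] by blast
  with \<open>even (m - n)\<close> have j: "j > 0" by (cases j) auto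
  define P where "P = (2 :: complex) ^ j"
  have P0: "P \<noteq> 0" and P2: "P \<preceq> 2" using j two_power_le_two by (simp_all add: P_def)
  have Pt: "P \<prec> t" using P2 t(1) by (rule le_lt_trans)
  have cd: "of_int m - of_int n = P * of_int d" using arg_cong[OF d(1), of complex_of_int] by (simp add: P_def)
  have dP: "P * of_int d \<asymp> P" using odd_same_one[OF d(2)] by (rule same_one_cong)
  have ckl: "of_int k - of_int l = L * (P * of_int d)" unfolding ck cl cd[symmetric] by (simp add: algebra_simps)
  have klP: "of_int k - of_int l \<asymp> L * P" unfolding ckl using dP by (intro same_mult same_refl)
  have rt: "r - t \<asymp> P * t"
  proof -
    have "(r - t) * (of_int k * of_int l) = z * (of_int k - of_int l)" using kr lt by algebra
    also have "\<dots> \<asymp> (L * t) * (L * P)"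
      by (intro same_mult klP same_trans[OF zt] lL same_refl)
    also have "\<dots> = (P * t) * (L * L)" by (simp add: algebra_simps)
    also have "\<dots> \<asymp> (P * t) * (of_int k * of_int l)"
      by (intro same_mult same_refl same_sym[OF kL] same_sym[OF lL])
    finally show ?thesis using k l by (subst (asm) same_mult_cancel) auto
  qed
  obtain x where x: "x \<noteq> 0" "t = x + inverse x" using exists_reciprocal_pair by blast
  obtain X' where X': "X' \<noteq> 0" "r = X' + inverse X'" using exists_reciprocal_pair by blast
  have D': "X' - inverse X' \<asymp> t" using size_of_reciprocal_difference[OF X' r(1)] tr by (rule same_trans)
  \<comment> \<open>The two solutions of \<open>r = X + 1/X\<close> are inverse to each other; choose the one that is
    close to \<open>x\<close>.\<close>
  have "X' - x \<asymp> t \<or> x - inverse X' \<asymp> t"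
  proof (rule same_sum_of_small_product)
    show "X' - x + (x - inverse X') \<asymp> t" using D' by simp
    have "(X' - x) * (x - inverse X') = x * (r - t)"
      using X'(1) x(1) unfolding x(2) X'(2) by (simp add: field_simps)
    also have "\<dots> \<asymp> 1 * (P * t)"
      using x t by (intro same_mult rt unit_of_integral_sum) auto
    also have "\<dots> \<prec> t * t" using Pt t00 by (simp add: lt_mult_cancel)
    finally show "(X' - x) * (x - inverse X') \<prec> t * t" .
  qed
  then obtain X where X: "X \<noteq> 0" "r = X + inverse X" and near: "x - inverse X \<asymp> t"
  proof
    assume "X' - x \<asymp> t"
    then have "x - inverse (inverse X') \<asymp> t" using same_uminus_iff(1)[of "X' - x" t] by simp
    with X' show ?thesis by (intro that[of "inverse X'"]) (auto simp: add.commute)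
  next
    assume "x - inverse X' \<asymp> t"
    with X' show ?thesis by (intro that[of X'])
  qed
  have x1: "x \<asymp> 1" and X1: "X \<asymp> 1" using x X t r by (auto intro: unit_of_integral_sum)
  have Xx: "X - x \<asymp> P"
  proof -
    have "(X - x) * t \<asymp> (X - x) * (x - inverse X)" using near by (intro same_mult same_refl) (rule same_sym)
    also have "\<dots> = x * (r - t)" using X(1) x(1) unfolding x(2) X(2) by (simp add: field_simps)
    also have "\<dots> \<asymp> 1 * (P * t)" by (intro same_mult x1 rt)
    finally show ?thesis using t00 by (simp add: same_mult_cancel)
  qed
  have invXx: "inverse X - inverse x \<asymp> P"
  proof -
    have "inverse X - inverse x = - (inverse X * inverse x) * (X - x)" using X(1) x(1) by (simp add: field_simps)
    also have "\<dots> \<asymp> - (1 * 1) * P"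
      using same_mult[OF same_one_inverse[OF X1] same_one_inverse[OF x1]]
      by (intro same_mult Xx) simp
    finally show ?thesis by simp
  qed
  define D where "D = x - inverse x"
  define D1 where "D1 = X - inverse X"
  have Dt: "D \<asymp> t" unfolding D_def by (rule size_of_reciprocal_difference[OF x t(1)])
  have D1t: "D1 \<asymp> t" unfolding D1_def by (rule same_trans[OF size_of_reciprocal_difference[OF X r(1)] tr])
  have D0: "D \<noteq> 0" "D1 \<noteq> 0" using same_zero_iff[OF Dt] same_zero_iff[OF D1t] t00 by auto
  \<comment> \<open>The difference is \<open>(X - x)(x + 1/X)/x\<close>, and \<open>x + 1/X\<close> is close to \<open>x + 1/x = t\<close>.\<close>
  have xi: "D1 - D \<asymp> P * t"
  proof -
    have "t + (inverse X - inverse x) \<asymp> t" using same_lt_trans[OF invXx Pt] by (rule same_add)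
    moreover have "t + (inverse X - inverse x) = x + inverse X" using x by simp
    ultimately have "(X - x) * (x + inverse X) * inverse x \<asymp> P * t * 1"
      by (intro same_mult Xx same_one_inverse x1) simp
    moreover have "(X - x) * (x + inverse X) * inverse x = D1 - D"
      using x(1) X(1) by (simp add: D_def D1_def field_simps)
    ultimately show ?thesis by simp
  qed
  define A where "A = x powi l"
  define B where "B = X powi k"
  have A1: "A \<asymp> 1" and B1: "B \<asymp> 1" unfolding A_def B_def by (intro same_one_powi x1 X1)+
  have AB0: "A \<noteq> 0" "B \<noteq> 0" using x X by (auto simp: A_def B_def)
  have ft: "fval t l = - of_int l" and fr: "fval r k = - of_int k"
    using wronskian_g_eq[of t "l div 2"] wronskian_g_eq[of r "k div 2"] t0 r0 k l
    by (simp_all add: add_eq_0_iff)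
  have Am: "A - inverse A = - of_int l * D" and Bm: "B - inverse B = - of_int k * D1"
    using fval_powi[OF x, of l] fval_powi[OF X, of k] unfolding ft fr
    by (simp_all add: A_def B_def D_def D1_def power_int_minus algebra_simps)
  have Ap: "A + inverse A = y - of_int l * z" and Bp: "B + inverse B = y - of_int k * z"
    using fval_reciprocal[OF x, of l] fval_reciprocal[OF X, of k] D0 Ct Cr
    by (simp_all add: A_def B_def D_def D1_def power_int_minus)
  have lD: "of_int l * D \<asymp> L * t" and kD: "of_int k * D1 \<asymp> L * t"
    by (intro same_mult lL kL Dt D1t)+
  have C2: "A + inverse A \<preceq> 2"
  proof -
    have "z \<preceq> 2" using same_le_trans[OF zt le_mult_right[OF even_le_two[OF l(1)] t(2)]] .
    then have "z ^ 2 + 4 \<preceq> 4" using le_power[of z 2 2] by (intro le_add) auto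
    then have "y \<preceq> 2" using square_le_imp_le[of y 2] by (simp add: yz)
    with \<open>z \<preceq> 2\<close> show ?thesis unfolding Ap by (intro le_diff le_mult_left) auto
  qed
  define E where "E = X / x"
  have E0: "E \<noteq> 0" and E1: "E \<asymp> 1"
    using same_mult[OF X1 same_one_inverse[OF x1]] X x by (simp_all add: E_def divide_inverse)
  have Ek: "E powi k - 1 \<preceq> L * P"
  proof -
    have "E - 1 = (X - x) * inverse x" using x(1) by (simp add: E_def field_simps)
    also have "\<dots> \<asymp> P * 1" by (intro same_mult Xx same_one_inverse x1)
    finally have EP: "E - 1 \<asymp> P" by simp
    have "E powi k - 1 \<preceq> of_int k * (E - 1)"
      using E1 same_le_trans[OF EP P2] by (rule powi_minus_one_le_times)
    also have "\<dots> \<asymp> L * P" by (intro same_mult kL EP)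
    finally show ?thesis .
  qed
  have prod: "(B - A) * (A - inverse B) \<asymp> (L * P) * (L * t)"
  proof -
    have "(B - A) * (A - inverse B) = A * ((B + inverse B) - (A + inverse A))"
      using AB0 by (simp add: field_simps)
    also have "\<dots> = - (A * ((of_int k - of_int l) * z))" unfolding Ap Bp by (simp add: algebra_simps)
    also have "\<dots> \<asymp> 1 * ((L * P) * (L * t))"
      unfolding same_uminus_iff by (intro same_mult A1 klP same_trans[OF zt] lL same_refl)
    finally show ?thesis by simp
  qed
  have "B - A \<asymp> L * t \<or> A - inverse B \<asymp> L * t"
  proof (rule same_sum_of_small_product)
    have "B - A + (A - inverse B) = - (of_int k * D1)" using Bm by simp
    then show "B - A + (A - inverse B) \<asymp> L * t" using kD by simp
    note prod
    also have "(L * P) * (L * t) = P * (L * (L * t))" by simp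
    also have "\<dots> \<prec> t * (L * (L * t))" using Pt L0 t00 by (subst lt_mult_cancel) auto
    also have "\<dots> = (L * t) * (L * t)" by simp
    finally show "(B - A) * (A - inverse B) \<prec> (L * t) * (L * t)" .
  qed
  then show False
  proof
    assume AB: "A - inverse B \<asymp> L * t"
    have "(B - A) * (L * t) \<asymp> (B - A) * (A - inverse B)" using AB by (intro same_mult same_refl) (rule same_sym)
    also note prod
    finally have BA: "B - A \<asymp> L * P" using L0 t00 by (subst (asm) same_mult_cancel) auto
    have xd: "x powi (k - l) - 1 \<preceq> L * P"
    proof -
      have Ekx: "B = x powi k * E powi k"
        using x X by (simp add: B_def E_def power_int_divide_distrib)
      have "x powi (k - l) - 1 = (inverse A * (B - A) - (E powi k - 1)) * inverse (E powi k)"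
        using x(1) E0 AB0 unfolding power_int_diff[OF disjI1[OF x(1)]]
        by (simp add: Ekx A_def[symmetric] field_simps)
      also have "\<dots> \<preceq> L * P"
      proof (rule le_mult_right)
        have "inverse A * (B - A) \<preceq> L * P"
          using same_one_inverse[OF A1] BA by (intro le_mult_left) (simp_all add: same_def)
        then show "inverse A * (B - A) - (E powi k - 1) \<preceq> L * P" using Ek by (rule le_diff)
        show "inverse (E powi k) \<preceq> 1"
          using same_one_inverse[OF same_one_powi[OF E1]] by (simp add: same_def)
      qed
      finally show ?thesis .
    qed
    have AP: "(A ^ 2 ^ j) powi d - 1 \<preceq> L * P"
    proof -
      have "(A ^ 2 ^ j) powi d = x powi (l * (2 ^ j * d))"
        unfolding A_def by (simp only: power_int_mult flip: power_int_of_nat) simp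
      also have "l * (2 ^ j * d) = (k - l) * n" unfolding kf(1) lf(1) d(1)[symmetric] by (simp add: algebra_simps)
      also have "x powi ((k - l) * n) = (x powi (k - l)) powi n" by (rule power_int_mult)
      finally have eq: "(A ^ 2 ^ j) powi d = (x powi (k - l)) powi n" .
      have u: "x powi (k - l) \<asymp> 1" using x1 by (rule same_one_powi)
      have "(x powi (k - l)) powi n - 1 \<asymp> (x powi (k - l)) ^ nat \<bar>n\<bar> - 1"
        using u by (rule powi_minus_one_same_power)
      also have "\<dots> \<preceq> x powi (k - l) - 1" using u by (intro power_minus_one_le) (simp add: same_def)
      also note xd
      finally show ?thesis unfolding eq .
    qed
    have A2: "A ^ 2 - 1 \<asymp> L * t"
    proof -
      have "A ^ 2 - 1 = A * - (of_int l * D)" using Am AB0 by (simp add: field_simps power2_eq_square)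
      also have "\<dots> \<asymp> 1 * (L * t)" using lD by (intro same_mult A1) simp
      finally show ?thesis by simp
    qed
    obtain i where i: "j = Suc i" using j by (cases j) auto
    have Alt: "A ^ 2 ^ j - 1 \<prec> 1"
    proof -
      have "A ^ 2 ^ j - 1 = (A ^ 2) ^ 2 ^ i - 1" by (simp add: i power_mult)
      also have "\<dots> \<preceq> A ^ 2 - 1" using le_power[of A 1 2] A1 by (intro power_minus_one_le) (simp add: same_def)
      also note A2
      also have "L * t \<preceq> 2" using L2 t(2) by (rule le_mult_right)
      also note two_lt_one
      finally show ?thesis .
    qed
    have "A ^ 2 ^ j - 1 \<asymp> (A ^ 2 ^ j) powi d - 1"
      using same_power[OF A1, of "2 ^ j"] Alt d(2) by (intro same_sym[OF powi_odd_minus_one]) simp_all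
    also note AP
    finally have small: "A ^ 2 ^ j - 1 \<preceq> L * P" .
    show False
    proof (cases i)
      case 0
      have "L * t \<asymp> A ^ 2 ^ j - 1" using A2 by (simp add: i 0 same_sym)
      also note small
      also have "L * P = L * 2" by (simp add: P_def i 0)
      finally have "t * L \<preceq> 2 * L" by (simp add: mult.commute)
      with L0 t(1) show False by (simp add: le_mult_cancel lt_def)
    next
      case (Suc h)
      define C where "C = A + inverse A"
      have A4: "A ^ 4 - 1 \<asymp> L * t * C"
      proof -
        have "A ^ 4 - 1 = A * ((A ^ 2 - 1) * C)"
          using AB0 by (simp add: C_def field_simps power2_eq_square power4_eq_xxxx)
        also have "\<dots> \<asymp> 1 * ((L * t) * C)" by (intro same_mult A1 A2 same_refl)
        finally show ?thesis by simp
      qed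
      have "L * t * C \<preceq> 2 * 2" using L2 t(2) C2 unfolding C_def by (intro le_mult le_mult_right)
      then have "L * t * C \<prec> 2" using four_lt_two by (auto intro: le_lt_trans)
      then have "(A ^ 4) ^ 2 ^ h - 1 \<asymp> of_nat (2 ^ h) * (A ^ 4 - 1)"
        by (intro power_minus_one_same_times same_lt_trans[OF A4])
      also have "\<dots> \<asymp> 2 ^ h * (L * t * C)" using A4 by (intro same_mult) auto
      finally have "2 ^ h * (L * t * C) \<asymp> (A ^ 4) ^ 2 ^ h - 1" by (rule same_sym)
      also have "(A ^ 4) ^ 2 ^ h = A ^ 2 ^ j" by (simp add: i Suc flip: power_mult)
      also note small
      also have "L * P = 4 * (2 ^ h * L)" by (simp add: P_def i Suc)
      finally have "(t * C) * (2 ^ h * L) \<preceq> 4 * (2 ^ h * L)" by (simp add: algebra_simps)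
      then have "t * C \<preceq> 4" using L0 by (subst (asm) le_mult_cancel) auto
      moreover have "4 \<prec> t * C"
        using four_lt_trace[OF l t t0 x x1] Am unfolding C_def by (simp add: A_def D_def power_int_minus)
      ultimately show False by (simp add: lt_def)
    qed
  next
    assume "B - A \<asymp> L * t"
    have "(A - inverse B) * (L * t) \<asymp> (B - A) * (A - inverse B)"
      by (subst mult.commute, intro same_mult same_refl same_sym[OF \<open>B - A \<asymp> L * t\<close>])
    also note prod
    finally have AB: "A - inverse B \<asymp> L * P" using L0 t00 by (subst (asm) same_mult_cancel) auto
    have upper: "of_int k * D1 + of_int l * D \<preceq> 2 * (L * P)"
    proof -
      have "inverse A * (A - inverse B) \<asymp> 1 * (L * P)" by (intro same_mult same_one_inverse A1 AB)
      then have f1: "inverse A * (A - inverse B) \<preceq> L * P" by (simp add: same_def)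
      have "B - inverse A = inverse A * B * (A - inverse B)" using AB0 by (simp add: field_simps)
      also have "\<dots> \<asymp> 1 * 1 * (L * P)" by (intro same_mult same_one_inverse A1 B1 AB)
      also have "\<dots> \<preceq> 2"
        using le_trans[OF P2 lt_imp_le[OF two_lt_one]] L2 by (simp add: le_mult_right)
      finally have "B - inverse A \<preceq> 2" .
      from le_add[OF C2 this] have "A + B \<preceq> 2" by simp
      then have "(A + B) * (inverse A * (A - inverse B)) \<preceq> 2 * (L * P)" using f1 by (rule le_mult)
      also have "(A + B) * (inverse A * (A - inverse B)) = (A - inverse A) + (B - inverse B)"
        using AB0 by (simp add: field_simps)
      also have "\<dots> = - (of_int k * D1 + of_int l * D)" unfolding Am Bm by simp
      finally show ?thesis unfolding uminus_le_iff .
    qed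
    have D2t: "2 * D \<asymp> 2 * t" using Dt by (intro same_mult same_refl)
    \<comment> \<open>With \<open>k = 2\<^sup>e m\<close> and \<open>l = 2\<^sup>e n\<close>. If \<open>j > 1\<close>, the number \<open>2 n D\<close> dominates; if \<open>j = 1\<close>,
      it cancels with \<open>(m - n) D\<close> modulo 4, and the odd multiple of \<open>D1 - D\<close> takes over.\<close>
    have "of_int m * D1 + of_int n * D \<asymp> 2 * t"
    proof (cases "j = 1")
      case True
      have P: "P = 2" by (simp add: P_def True)
      have mn: "complex_of_int m = of_int n + 2 * of_int d" using cd unfolding P by algebra
      obtain s where s: "n + d = 2 * s" using lf(2) d(2) by (meson evenE odd_even_add)
      have ns: "complex_of_int n + of_int d = 2 * of_int s" using arg_cong[OF s, of complex_of_int] by simp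
      have eq: "of_int m * D1 + of_int n * D = of_int m * (D1 - D) + 4 * (of_int s * D)"
        unfolding mn using ns by algebra
      have "of_int m * (D1 - D) \<asymp> 1 * (2 * t)" using xi unfolding P by (intro same_mult odd_same_one kf)
      then have main: "of_int m * (D1 - D) \<asymp> 2 * t" by simp
      have "4 * (of_int s * D) \<preceq> 4 * t" 
        using Dt by (intro le_mult[OF le_refl] le_mult_left) (auto simp: same_def)
      also have "\<dots> \<prec> 2 * t" using four_lt_two t00 by (simp add: lt_mult_cancel)
      also have "\<dots> \<asymp> of_int m * (D1 - D)" using main by (rule same_sym)
      finally show ?thesis unfolding eq using same_trans[OF same_add main] by blast
    next
      case False
      then have "P \<preceq> 4" using two_power_lt[of 1 j] j by (simp add: P_def)
      then have "P \<prec> 2" using four_lt_two le_lt_trans by blast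
      then have Ptt: "P * t \<prec> 2 * t" using t00 by (simp add: lt_mult_cancel)
      have eq: "of_int m * D1 + of_int n * D = of_int n * (2 * D) + (of_int n * (D1 - D) + (P * of_int d) * D1)"
        using cd by algebra
      have main: "of_int n * (2 * D) \<asymp> 2 * t"
        using same_mult[OF odd_same_one[OF lf(2)] D2t] by simp
      have "of_int n * (D1 - D) + (P * of_int d) * D1 \<preceq> P * t"
      proof (rule le_add)
        show "of_int n * (D1 - D) \<preceq> P * t" using xi by (intro le_mult_left) (auto simp: same_def)
        show "P * of_int d * D1 \<preceq> P * t" using same_mult[OF dP D1t] by (simp add: same_def)
      qed
      also note Ptt
      also have "2 * t \<asymp> of_int n * (2 * D)" using main by (rule same_sym)
      finally show ?thesis unfolding eq using same_trans[OF same_add main] by blast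
    qed
    then have "L * (2 * t) \<asymp> L * (of_int m * D1 + of_int n * D)"
      by (intro same_mult same_refl same_sym[of _ "2 * t"])
    also have "\<dots> = of_int k * D1 + of_int l * D" unfolding ck cl by (simp add: algebra_simps)
    also note upper
    finally have "t * (2 * L) \<preceq> P * (2 * L)" by (simp add: algebra_simps)
    then have "t \<preceq> P" using L0 by (subst (asm) le_mult_cancel) auto
    then show False using Pt by (simp add: lt_def)
  qed
qed

end

section \<open>Critical points and critical values of the quotients\<close>
definition Phi_poly :: "int \<Rightarrow> complex poly" where
  "Phi_poly j = cpoly (Phi j)"

definition wronskian :: "complex poly \<Rightarrow> complex poly \<Rightarrow> complex poly" where
  "wronskian p q = pderiv p * q - p * pderiv q"

lemma cpoly_diff: "cpoly (p - q) = cpoly p - cpoly q"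
  by (rule poly_eqI) (simp add: coeff_map_poly)

lemma poly_Phi_even: "poly (Phi_poly (2 * m)) u = fval u m"
  by (simp only: Phi_poly_def Phi_even fval_def)

lemma poly_Phi_odd: "poly (Phi_poly (2 * m - 1)) u = gval u m"
  by (simp only: Phi_poly_def Phi_odd gpol_def cpoly_diff poly_diff fval_def gval_def)

lemma poly_Phi_odd': "poly (Phi_poly (2 * m + 1)) u = gval u (m + 1)"
proof -
  have "2 * m + 1 = 2 * (m + 1) - 1" by simp
  then show ?thesis by (simp only: poly_Phi_odd)
qed

lemma wronskian_Phi_even:
  "poly (wronskian (Phi_poly (2 * m + 1)) (Phi_poly (2 * m - 1))) u = wronskian_g u m"
proof -
  have "2 * m + 1 = 2 * (m + 1) - 1" by simp
  then have "Phi_poly (2 * m + 1) = cpoly (fpol (m + 1)) - cpoly (fpol m)"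
    by (simp only: Phi_poly_def Phi_odd gpol_def cpoly_diff add_diff_cancel_right')
  moreover have "Phi_poly (2 * m - 1) = cpoly (fpol m) - cpoly (fpol (m - 1))"
    by (simp only: Phi_poly_def Phi_odd gpol_def cpoly_diff)
  ultimately show ?thesis
    unfolding wronskian_def wronskian_g_def gval_def fval_def dfval_def
    by (simp add: pderiv_diff)
qed

lemma wronskian_Phi_odd:
  assumes k: "k = 2 * m + 1"
  shows "poly (wronskian (Phi_poly (k + 1)) (Phi_poly (k - 1))) u = wronskian_f u (m + 1)"
proof -
  have "k + 1 = 2 * (m + 1)" "k - 1 = 2 * m" using k by simp_all
  then have "Phi_poly (k + 1) = cpoly (fpol (m + 1))" "Phi_poly (k - 1) = cpoly (fpol m)"
    by (simp_all only: Phi_poly_def Phi_even)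
  then show ?thesis unfolding wronskian_def wronskian_f_def fval_def dfval_def by simp
qed

text \<open>
  For odd \<open>k\<close> by the Cassini identity, and for even \<open>k\<close> because the Casoratian of \<open>f\<close> and \<open>g\<close> is 1.
\<close>
lemma Phi_coprime: "poly (Phi_poly (k + 1)) u \<noteq> 0 \<or> poly (Phi_poly (k - 1)) u \<noteq> 0"
proof (cases "even k")
  case True
  then obtain m where k: "k = 2 * m" by (rule evenE)
  have "fval u m * gval u m - fval u (m - 1) * gval u (m + 1) = 1"
    using fval_cassini[of u "m - 1"] fval_Suc[of u m] unfolding gval_def by simp algebra
  moreover have "poly (Phi_poly (k + 1)) u = gval u (m + 1)" "poly (Phi_poly (k - 1)) u = gval u m"
    using poly_Phi_odd'[of m u] poly_Phi_odd[of m u] by (simp_all add: k)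
  ultimately show ?thesis by auto
next
  case False
  then obtain m where k: "k = 2 * m + 1" by (rule oddE)
  then have "k + 1 = 2 * (m + 1)" "k - 1 = 2 * m" by simp_all
  then have "poly (Phi_poly (k + 1)) u = fval u (m + 1)" "poly (Phi_poly (k - 1)) u = fval u m"
    by (simp_all only: poly_Phi_even)
  moreover have "fval u (m + 1) \<noteq> 0 \<or> fval u m \<noteq> 0" using fval_cassini[of u m] by auto
  ultimately show ?thesis by simp
qed

text \<open>
  Both parities lead to the same relation. The quadratic form \<open>p\<^sup>2 - u p q + q\<^sup>2\<close> is 1 for \<open>f\<close> and
  \<open>2 - u\<close> for \<open>g\<close>, while \<open>p\<^sup>2 - q\<^sup>2\<close> is \<open>f\<^sub>k\<close> and \<open>(u - 2) f\<^sub>k\<close>, respectively; and \<open>f\<^sub>k\<close> takes the value \<open>k\<close>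
  and \<open>-k\<close> at a critical point. In terms of \<open>a = p/q\<close> the relation reads \<open>k(a + 1/a - u) = a - 1/a\<close>.
\<close>
lemma critical_relation:
  fixes k u
  defines "p \<equiv> poly (Phi_poly (k + 1)) u" and "q \<equiv> poly (Phi_poly (k - 1)) u"
  assumes crit: "poly (wronskian (Phi_poly (k + 1)) (Phi_poly (k - 1))) u = 0"
  shows "of_int k * (p ^ 2 + q ^ 2 - u * p * q) = p ^ 2 - q ^ 2"
proof (cases "even k")
  case True
  then obtain m where k: "k = 2 * m" by (rule evenE)
  define a b where "a = fval u m" and "b = fval u (m - 1)"
  have c: "a ^ 2 - u * a * b + b ^ 2 = 1" using fval_cassini[of u "m - 1"] by (simp add: a_def b_def)
  have "fval u (m + 1) = u * a - b" by (simp add: fval_Suc a_def b_def)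
  then have f: "fval u (2 * m) = a * (u * a - 2 * b)" and p: "p = u * a - b - a" and q: "q = a - b"
    using poly_Phi_odd'[of m u] poly_Phi_odd[of m u]
    by (simp_all add: fval_double p_def q_def k gval_def a_def b_def)
  have "wronskian_g u m = 0" using crit wronskian_Phi_even[of m u] by (simp add: k)
  then have "fval u (2 * m) = - of_int k" using wronskian_g_eq[of u m] by (simp add: k add_eq_0_iff)
  then have k': "of_int k = - (a * (u * a - 2 * b))" using f by simp
  show ?thesis unfolding k' p q using c by algebra
next
  case False
  then obtain m where k: "k = 2 * m + 1" by (rule oddE)
  then have "k + 1 = 2 * (m + 1)" "k - 1 = 2 * m" by simp_all
  then have p: "p = fval u (m + 1)" and q: "q = fval u m"
    by (simp_all only: p_def q_def poly_Phi_even)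
  have "wronskian_f u (m + 1) = 0" using crit wronskian_Phi_odd[OF k] by simp
  then have "fval u (2 * m + 1) = of_int k" using wronskian_f_eq[of u m] by (simp add: k)
  then have "of_int k = p ^ 2 - q ^ 2" using fval_double_succ[of u m] by (simp add: p q)
  moreover have "p ^ 2 - u * p * q + q ^ 2 = 1" using fval_cassini[of u m] by (simp add: p q)
  ultimately show ?thesis by algebra
qed

text \<open>
  The quantity \<open>f\<^bsub>k+1\<^esub> - f\<^bsub>k-1\<^esub>\<close>, which is \<open>x\<^sup>k + x\<^bsup>-k\<^esup>\<close> for \<open>u = x + 1/x\<close>, is known up to sign from
  \<open>f\<^sub>k = -k\<close>; this relation fixes the sign. In terms of \<open>a = p/q\<close> it says that the quantity is
  \<open>a + 1/a - k(a - 1/a)\<close>.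
\<close>
lemma critical_trace:
  fixes m u
  defines "p \<equiv> gval u (m + 1)" and "q \<equiv> gval u m"
  assumes crit: "wronskian_g u m = 0"
  shows "p * q * (fval u (2 * m + 1) - fval u (2 * m - 1)) = p ^ 2 + q ^ 2 - 2 * of_int m * (p ^ 2 - q ^ 2)"
proof -
  define a b where "a = fval u m" and "b = fval u (m - 1)"
  have c: "a ^ 2 - u * a * b + b ^ 2 = 1" using fval_cassini[of u "m - 1"] by (simp add: a_def b_def)
  have s: "fval u (m + 1) = u * a - b" by (simp add: fval_Suc a_def b_def)
  have p: "p = u * a - b - a" and q: "q = a - b"
    by (simp_all add: p_def q_def gval_def a_def b_def fval_Suc)
  have "fval u (2 * m) = a * (u * a - 2 * b)" unfolding fval_double s by (simp add: a_def b_def)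
  moreover have "fval u (2 * m) = - (2 * of_int m)"
    using crit wronskian_g_eq[of u m] by (simp add: add_eq_0_iff)
  ultimately have m: "2 * of_int m = - (a * (u * a - 2 * b))" by (metis minus_minus)
  have "2 * m - 1 = 2 * (m - 1) + 1" by simp
  then have "fval u (2 * m - 1) = a ^ 2 - b ^ 2"
    using fval_double_succ[of u "m - 1"] by (simp only: a_def b_def diff_add_cancel)
  then have C: "fval u (2 * m + 1) - fval u (2 * m - 1) = (u * a - b) ^ 2 - a ^ 2 - (a ^ 2 - b ^ 2)"
    using fval_double_succ[of u m] s by (simp add: a_def)
  show ?thesis unfolding C p q m using c by algebra
qed

text \<open>
  The critical value \<open>a = p/q\<close> enters the arithmetic through \<open>y = a + 1/a\<close> and \<open>z = a - 1/a\<close>, in which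
  the relations at a critical point are linear and do not depend on the scaling of \<open>(p,q)\<close>.
\<close>
lemma ratio_coordinates:
  fixes p q :: complex
  assumes "p \<noteq> 0" "q \<noteq> 0"
  defines "y \<equiv> (p ^ 2 + q ^ 2) / (p * q)" and "z \<equiv> (p ^ 2 - q ^ 2) / (p * q)"
  shows "y ^ 2 = z ^ 2 + 4"
    and "of_int k * (p ^ 2 + q ^ 2 - u * p * q) = p ^ 2 - q ^ 2 \<Longrightarrow> of_int k * u = of_int k * y - z"
    and "p * q * C = p ^ 2 + q ^ 2 - of_int k * (p ^ 2 - q ^ 2) \<Longrightarrow> C = y - of_int k * z"
proof -
  have y: "y * (p * q) = p ^ 2 + q ^ 2" and z: "z * (p * q) = p ^ 2 - q ^ 2" and pq: "p * q \<noteq> 0"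
    using assms by (simp_all add: y_def z_def)
  have "(y ^ 2) * (p * q) ^ 2 = (z ^ 2 + 4) * (p * q) ^ 2" using y z by algebra
  then show "y ^ 2 = z ^ 2 + 4" using pq by simp
  show "of_int k * u = of_int k * y - z" if "of_int k * (p ^ 2 + q ^ 2 - u * p * q) = p ^ 2 - q ^ 2"
  proof -
    have "(of_int k * u) * (p * q) = (of_int k * y - z) * (p * q)" using y z that by algebra
    then show ?thesis using pq by simp
  qed
  show "C = y - of_int k * z" if "p * q * C = p ^ 2 + q ^ 2 - of_int k * (p ^ 2 - q ^ 2)"
  proof -
    have "C * (p * q) = (y - of_int k * z) * (p * q)" using y z that by algebra
    then show ?thesis using pq by simp
  qed
qed

lemma proportional_pairs:
  fixes a b c d :: complex
  assumes "a * d = b * c" "a \<noteq> 0 \<or> b \<noteq> 0" "c \<noteq> 0 \<or> d \<noteq> 0"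
  obtains s where "s \<noteq> 0" "c = s * a" "d = s * b"
proof (cases "a = 0")
  case True
  then show ?thesis using assms that[of "d / b"] by auto
next
  case False
  then have "d = (c / a) * b" using assms by (simp add: field_simps)
  then show ?thesis using assms False that[of "c / a"] by auto
qed

text \<open>
  If one of the two vanished, \<open>critical_relation\<close> would give \<open>k = 1\<close> or \<open>k = -1\<close>.
\<close>
lemma critical_values_finite_nonzero:
  assumes k: "\<bar>k\<bar> \<ge> 2" and crit: "poly (wronskian (Phi_poly (k + 1)) (Phi_poly (k - 1))) u = 0"
  shows "poly (Phi_poly (k + 1)) u \<noteq> 0" "poly (Phi_poly (k - 1)) u \<noteq> 0"
proof -
  define p q where "p = poly (Phi_poly (k + 1)) u" and "q = poly (Phi_poly (k - 1)) u"
  have "complex_of_int k \<noteq> of_int 1" "complex_of_int k \<noteq> of_int (- 1)"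
    using k unfolding of_int_eq_iff by auto
  then have k1: "of_int k - (1 :: complex) \<noteq> 0" "of_int k + (1 :: complex) \<noteq> 0"
    by (simp_all add: add_eq_0_iff2)
  have rel: "of_int k * (p ^ 2 + q ^ 2 - u * p * q) = p ^ 2 - q ^ 2"
    using critical_relation[OF crit] by (simp add: p_def q_def)
  have "(of_int k + 1) * q ^ 2 = 0" if "p = 0" using rel that by (simp add: distrib_right)
  moreover have "(of_int k - 1) * p ^ 2 = 0" if "q = 0" using rel that by (simp add: left_diff_distrib)
  ultimately show "poly (Phi_poly (k + 1)) u \<noteq> 0" "poly (Phi_poly (k - 1)) u \<noteq> 0"
    using k1 Phi_coprime[of k u] unfolding p_def q_def by auto
qed

text \<open>
  For fixed \<open>k\<close>, the relation \<open>critical_relation\<close> can be solved for \<open>u\<close> in terms of \<open>p/q\<close>.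
\<close>
theorem critical_values_distinct:
  assumes k: "\<bar>k\<bar> \<ge> 2"
    and crit: "poly (wronskian (Phi_poly (k + 1)) (Phi_poly (k - 1))) r = 0"
      "poly (wronskian (Phi_poly (k + 1)) (Phi_poly (k - 1))) t = 0"
    and val: "poly (Phi_poly (k + 1)) r * poly (Phi_poly (k - 1)) t =
      poly (Phi_poly (k - 1)) r * poly (Phi_poly (k + 1)) t"
  shows "r = t"
proof -
  define p q where "p = poly (Phi_poly (k + 1)) r" and "q = poly (Phi_poly (k - 1)) r"
  have pq: "p \<noteq> 0" "q \<noteq> 0" using critical_values_finite_nonzero[OF k crit(1)] by (simp_all add: p_def q_def)
  obtain s where s: "s \<noteq> 0" "poly (Phi_poly (k + 1)) t = s * p" "poly (Phi_poly (k - 1)) t = s * q"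
    using proportional_pairs[OF val] Phi_coprime unfolding p_def q_def by metis
  have "s ^ 2 * (of_int k * (p ^ 2 + q ^ 2 - t * p * q)) = s ^ 2 * (p ^ 2 - q ^ 2)"
    using critical_relation[OF crit(2)] unfolding s(2,3) by algebra
  then have "of_int k * (p ^ 2 + q ^ 2 - t * p * q) = p ^ 2 - q ^ 2" using s(1) by simp
  moreover have "of_int k * (p ^ 2 + q ^ 2 - r * p * q) = p ^ 2 - q ^ 2"
    using critical_relation[OF crit(1)] by (simp add: p_def q_def)
  ultimately have "(of_int k * p * q) * (r - t) = 0" by algebra
  then show "r = t" using pq k by auto
qed

context dyadic_valuation_ring
begin

text \<open>
  From \<open>|z| = |l t| \<le> |2|\<close> and \<open>y\<^sup>2 = z\<^sup>2 + 4\<close> it follows that 2 divides \<open>y\<close>, and then also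
  \<open>r = y - z/k\<close>, where the Wronskian does not vanish.
\<close>
lemma no_common_critical_value_odd:
  assumes k: "odd k" "k \<noteq> 1" "k \<noteq> - 1" and l: "even l" "l \<noteq> 0"
    and r0: "wronskian_f r ((k + 1) div 2) = 0" and t0: "wronskian_g t (l div 2) = 0"
    and yz: "y ^ 2 = z ^ 2 + 4"
    and kr: "of_int k * r = of_int k * y - z" and lt: "of_int l * t = of_int l * y - z"
  shows False
proof -
  have t: "2 \<prec> t" "t \<preceq> 1"
    using t0 l two_lt_critical_point[of "l div 2"] wronskian_g_root_integral[of "l div 2"] by auto
  have "z \<asymp> of_int l * t" using critical_point_size[OF l(1) t yz lt l(2)] .
  also have "\<dots> \<preceq> 2" using even_le_two[OF l(1)] t(2) by (rule le_mult_right)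
  finally have z: "z \<preceq> 2" .
  then have "z ^ 2 + 4 \<preceq> 4" using le_power[of z 2 2] by (intro le_add) auto
  then have y: "y \<preceq> 2" using square_le_imp_le[of y 2] by (simp add: yz)
  have "r \<asymp> of_int k * r" using same_one_cong(1)[OF odd_same_one[OF k(1)]] by (rule same_sym)
  also have "\<dots> \<preceq> 2" unfolding kr using y z by (intro le_diff le_mult_left) auto
  finally have "r \<preceq> 2" .
  moreover have "(k + 1) div 2 \<noteq> 0" "(k + 1) div 2 \<noteq> 1" using k by presburger+
  ultimately show False using wronskian_f_nonzero[of r "(k + 1) div 2"] r0 by blast
qed

lemma wronskian_g_nonzero_at_two: "u ^ 2 = 2 ^ 2 \<Longrightarrow> m \<noteq> 0 \<Longrightarrow> wronskian_g u m \<noteq> 0"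
  using wronskian_g_nonzero[of u m] unfolding power2_eq_iff[of u 2] by auto

end

theorem critical_values_disjoint:
  assumes l: "even l" "\<bar>l\<bar> \<ge> 2" and k: "\<bar>k\<bar> \<ge> 2" and kl: "k \<noteq> l"
    and r: "poly (wronskian (Phi_poly (k + 1)) (Phi_poly (k - 1))) r = 0"
    and t: "poly (wronskian (Phi_poly (l + 1)) (Phi_poly (l - 1))) t = 0"
    and val: "poly (Phi_poly (k + 1)) r * poly (Phi_poly (l - 1)) t =
      poly (Phi_poly (k - 1)) r * poly (Phi_poly (l + 1)) t"
  shows False
proof -
  obtain R where "subring_of_complex R" "1 / 2 \<notin> R" "\<And>x. x \<in> R \<or> inverse x \<in> R"
    using exists_valuation_ring_over_two by blast
  then interpret dyadic_valuation_ring R by unfold_locales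
  define p q where "p = poly (Phi_poly (k + 1)) r" and "q = poly (Phi_poly (k - 1)) r"
  have pq: "p \<noteq> 0" "q \<noteq> 0" using critical_values_finite_nonzero[OF k r] by (simp_all add: p_def q_def)
  obtain s where s: "s \<noteq> 0" "poly (Phi_poly (l + 1)) t = s * p" "poly (Phi_poly (l - 1)) t = s * q"
    using proportional_pairs[OF val] Phi_coprime unfolding p_def q_def by metis
  define y z where "y = (p ^ 2 + q ^ 2) / (p * q)" and "z = (p ^ 2 - q ^ 2) / (p * q)"
  note coords = ratio_coordinates[OF pq, folded y_def z_def]
  have "of_int k * (p ^ 2 + q ^ 2 - r * p * q) = p ^ 2 - q ^ 2"
    using critical_relation[OF r] by (simp add: p_def q_def)
  then have kr: "of_int k * r = of_int k * y - z" by (rule coords)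
  have "s ^ 2 * (of_int l * (p ^ 2 + q ^ 2 - t * p * q)) = s ^ 2 * (p ^ 2 - q ^ 2)"
    using critical_relation[OF t] unfolding s(2,3) by algebra
  then have "of_int l * (p ^ 2 + q ^ 2 - t * p * q) = p ^ 2 - q ^ 2" using s(1) by simp
  then have lt: "of_int l * t = of_int l * y - z" by (rule coords)
  obtain n where n: "l = 2 * n" using l by (auto elim: evenE)
  have t0: "wronskian_g t n = 0" using t wronskian_Phi_even[of n t] by (simp add: n)
  have n0: "n \<noteq> 0" using l n by auto
  show False
  proof (cases "even k")
    case True
    then obtain m where m: "k = 2 * m" by (rule evenE)
    have r0: "wronskian_g r m = 0" using r wronskian_Phi_even[of m r] by (simp add: m)
    have "p = gval r (m + 1)" "q = gval r m"
      using poly_Phi_odd'[of m r] poly_Phi_odd[of m r] by (simp_all add: p_def q_def m)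
    then have Cr: "fval r (k + 1) - fval r (k - 1) = y - of_int k * z"
      using critical_trace[OF r0] by (intro coords) (simp add: m)
    have gs: "gval t (n + 1) = s * p" "gval t n = s * q"
      using poly_Phi_odd'[of n t] poly_Phi_odd[of n t] s by (simp_all add: n)
    have "s ^ 2 * (p * q * (fval t (l + 1) - fval t (l - 1))) =
       s ^ 2 * (p ^ 2 + q ^ 2 - of_int l * (p ^ 2 - q ^ 2))"
      using critical_trace[OF t0] unfolding gs n of_int_mult of_int_numeral by algebra
    then have "p * q * (fval t (l + 1) - fval t (l - 1)) = p ^ 2 + q ^ 2 - of_int l * (p ^ 2 - q ^ 2)"
      using s(1) by simp
    then have Ct: "fval t (l + 1) - fval t (l - 1) = y - of_int l * z" by (rule coords)
    have "k \<noteq> 0" "l \<noteq> 0" "k div 2 = m" "l div 2 = n" using k l m n by auto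
    with no_common_critical_value_even[OF True _ l(1) _ kl _ _ coords(1) kr lt Cr Ct] r0 t0
    show False by simp
  next
    case False
    then obtain m where m: "k = 2 * m + 1" by (rule oddE)
    have r0: "wronskian_f r (m + 1) = 0" using r wronskian_Phi_odd[OF m] by simp
    have "(k + 1) div 2 = m + 1" "l div 2 = n" "k \<noteq> 1" "k \<noteq> - 1" "l \<noteq> 0"
      using k l m n by auto
    with no_common_critical_value_odd[OF False _ _ l(1) _ _ _ coords(1) kr lt] r0 t0
    show False by simp
  qed
qed

text \<open>
  Differentiating \<open>(u + 2) W = f\<^sub>l + l\<close> at a double zero of \<open>W\<close> gives \<open>f\<^sub>l' = 0\<close>, so that
  \<open>dfval_eq\<close> determines \<open>C = f\<^bsub>l+1\<^esub> - f\<^bsub>l-1\<^esub>\<close> as \<open>-u\<close>. Then \<open>C\<^sup>2 = (u\<^sup>2 - 4) f\<^sub>l\<^sup>2 + 4\<close> leaves only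
  \<open>u = \<plusminus> 2\<close>, which is divisible by 2 and hence not a zero of \<open>W\<close>.
\<close>
theorem critical_points_simple:
  assumes l: "even l" "\<bar>l\<bar> \<ge> 2"
    and W: "poly (wronskian (Phi_poly (l + 1)) (Phi_poly (l - 1))) u = 0"
    and dW: "poly (pderiv (wronskian (Phi_poly (l + 1)) (Phi_poly (l - 1)))) u = 0"
  shows False
proof -
  obtain R where "subring_of_complex R" "1 / 2 \<notin> R" "\<And>x. x \<in> R \<or> inverse x \<in> R"
    using exists_valuation_ring_over_two by blast
  then interpret dyadic_valuation_ring R by unfold_locales
  obtain n where n: "l = 2 * n" using l by (auto elim: evenE)
  have n0: "n \<noteq> 0" using l n by auto
  define w where "w = wronskian (Phi_poly (l + 1)) (Phi_poly (l - 1))"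
  have w: "poly w v = wronskian_g v n" for v
    using wronskian_Phi_even[of n v] by (simp add: w_def n)
  have "[:2, 1:] * w = cpoly (fpol l) + [:of_int l:]"
    unfolding poly_eq_poly_eq_iff[symmetric]
    using wronskian_g_eq[of _ n] w by (intro ext) (simp add: fval_def n algebra_simps)
  then have "poly (pderiv ([:2, 1:] * w)) u = dfval u l"
    by (simp add: pderiv_add pderiv_pCons dfval_def)
  moreover have "poly (pderiv ([:2, 1:] * w)) u = 0"
    using W dW unfolding pderiv_mult w_def[symmetric] by (simp add: pderiv_pCons)
  ultimately have d: "dfval u l = 0" by simp
  have f: "fval u l = - of_int l" using wronskian_g_eq[of u n] w W by (simp add: n w_def add_eq_0_iff)
  define C where "C = fval u (l + 1) - fval u (l - 1)"
  have "of_int l * (C + u) = 0" using dfval_eq[of u l] d f by (simp add: C_def algebra_simps)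
  moreover have "l \<noteq> 0" using l by auto
  ultimately have C: "C = - u" by (simp add: add_eq_0_iff2)
  have "C ^ 2 = (u ^ 2 - 4) * fval u l ^ 2 + 4"
    using fval_cassini[of u "l - 1"] unfolding C_def by (simp add: fval_Suc) algebra
  then have "(u ^ 2 - 4) * (of_int l ^ 2 - 1) = 0" unfolding C f by (simp add: algebra_simps)
  moreover have "complex_of_int l ^ 2 \<noteq> 1"
  proof -
    have "l ^ 2 \<noteq> 1" using l by (auto simp: power2_eq_1_iff)
    then show ?thesis by (metis of_int_1 of_int_eq_iff of_int_power)
  qed
  ultimately have "u ^ 2 = 2 ^ 2" by simp
  from wronskian_g_nonzero_at_two[OF this n0] w W show False by (simp add: w_def)
qed

section \<open>Evaluation of polynomials in two variables\<close>
definition at_r :: "complex \<Rightarrow> rat poly \<Rightarrow> complex" where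
  "at_r x c = poly (map_poly of_rat c) x"

lemma at_r_0 [simp]: "at_r x 0 = 0"
  by (simp add: at_r_def)

lemma at_r_add: "at_r x (c + d) = at_r x c + at_r x d"
proof -
  have "map_poly complex_of_rat (c + d) = map_poly of_rat c + map_poly of_rat d"
    by (rule poly_eqI) (simp add: coeff_map_poly of_rat_add)
  then show ?thesis by (simp add: at_r_def)
qed

lemma at_r_mult: "at_r x (c * d) = at_r x c * at_r x d"
proof -
  have "map_poly complex_of_rat (c * d) = map_poly of_rat c * map_poly of_rat d"
    by (rule poly_eqI) (simp add: coeff_map_poly coeff_mult of_rat_sum of_rat_mult)
  then show ?thesis by (simp add: at_r_def)
qed

lemma at_r_1: "at_r x 1 = 1"
  by (simp add: at_r_def map_poly_1')

lemma at_r_of_nat: "at_r x (of_nat n) = of_nat n"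
  by (induction n) (auto simp: at_r_add at_r_1)

text \<open>
  The restriction to a line with fixed first coordinate; \<open>slice x\<close> is a ring homomorphism, which
  reduces facts about \<open>eval2\<close> and \<open>d_t\<close> to facts about polynomials in one variable.
\<close>
definition slice :: "complex \<Rightarrow> bipoly \<Rightarrow> complex poly" where
  "slice x G = map_poly (at_r x) G"

lemma slice_0 [simp]: "slice x 0 = 0"
  by (simp add: slice_def)

lemma coeff_slice: "coeff (slice x G) j = at_r x (coeff G j)"
  by (simp add: slice_def coeff_map_poly)

lemma eval2_0 [simp]: "eval2 0 x y = 0"
  by (simp add: eval2_def)

lemma slice_pCons: "slice x (pCons c G) = pCons (at_r x c) (slice x G)"
  by (simp add: slice_def map_poly_pCons)

lemma eval2_slice: "eval2 G x y = poly (slice x G) y"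
  unfolding eval2_def
  by (induction G) (simp_all add: map_poly_pCons slice_pCons at_r_def)

lemma slice_add: "slice x (F + G) = slice x F + slice x G"
  by (rule poly_eqI) (simp add: coeff_slice at_r_add)

lemma slice_diff: "slice x (F - G) = slice x F - slice x G"
  using slice_add[of x "F - G" G] by (simp add: algebra_simps)

lemma slice_mult: "slice x (F * G) = slice x F * slice x G"
proof (induction F)
  case (pCons c F)
  have "slice x (smult c G) = smult (at_r x c) (slice x G)"
    by (rule poly_eqI) (simp add: coeff_slice at_r_mult)
  then show ?case using pCons by (simp add: slice_add slice_pCons)
qed simp

lemma slice_d_t: "slice x (d_t G) = pderiv (slice x G)"
  unfolding d_t_def by (rule poly_eqI) (simp add: coeff_slice coeff_pderiv at_r_mult at_r_of_nat at_r_add at_r_1)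

lemma eval2_d_t: "((\<lambda>y. eval2 G x y) has_field_derivative eval2 (d_t G) x y) (at y)"
  unfolding eval2_slice slice_d_t by (rule poly_DERIV)

lemma at_r_pderiv: "((\<lambda>x. at_r x c) has_field_derivative at_r x (pderiv c)) (at x)"
proof -
  have "map_poly complex_of_rat (pderiv c) = pderiv (map_poly of_rat c)"
    by (rule poly_eqI) (simp add: coeff_map_poly coeff_pderiv of_rat_mult of_rat_add)
  then show ?thesis unfolding at_r_def by (simp add: poly_DERIV)
qed

lemma eval2_d_r: "((\<lambda>x. eval2 G x y) has_field_derivative eval2 (d_r G) x y) (at x)"
proof (induction G)
  case (pCons c G)
  have "d_r (pCons c G) = pCons (pderiv c) (d_r G)"
    by (simp add: d_r_def map_poly_pCons)
  then have "slice x (d_r (pCons c G)) = pCons (at_r x (pderiv c)) (slice x (d_r G))"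
    by (simp only: slice_pCons)
  then show ?case unfolding eval2_slice slice_pCons
    using pCons at_r_pderiv[of c x] by (auto intro!: derivative_eq_intros simp: eval2_slice)
qed (simp add: d_r_def)

lemma isCont_eval2_r: "isCont (\<lambda>x. eval2 G x y) x"
  using eval2_d_r by (rule DERIV_isCont)

lemma isCont_eval2_t: "isCont (\<lambda>y. eval2 G x y) y"
  using eval2_d_t by (rule DERIV_isCont)

lemma eval2_mult: "eval2 (F * G) x y = eval2 F x y * eval2 G x y"
  by (simp add: eval2_slice slice_mult)

lemma eval2_diff: "eval2 (F - G) x y = eval2 F x y - eval2 G x y"
  by (simp add: eval2_slice slice_diff)

lemma eval2_in_r: "eval2 (in_r p) x y = poly (cpoly p) x"
proof -
  have "map_poly complex_of_rat (map_poly of_int p) = cpoly p"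
    by (rule poly_eqI) (simp add: coeff_map_poly)
  then show ?thesis by (simp add: eval2_slice in_r_def slice_pCons at_r_def)
qed

lemma eval2_in_t: "eval2 (in_t p) x y = poly (cpoly p) y"
proof -
  have "slice x (in_t p) = cpoly p"
    by (rule poly_eqI) (simp add: coeff_slice in_t_def coeff_map_poly at_r_def map_poly_pCons)
  then show ?thesis by (simp add: eval2_slice)
qed

lemma eval2_t_minus_r: "eval2 t_minus_r x y = y - x"
  by (simp add: eval2_def t_minus_r_def map_poly_pCons of_rat_minus)

section \<open>The charts at infinity\<close>
lemma degree_coeff_le_degree_r: "degree (coeff G j) \<le> degree_r G"
proof (cases "j \<le> degree G")
  case True
  then show ?thesis unfolding degree_r_def by (intro Max_ge) auto
next
  case False
  then show ?thesis by (simp add: coeff_eq_0)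
qed

lemma coeff_invert_r:
  "coeff (invert_r G) j = monom 1 (degree_r G - degree (coeff G j)) * reflect_poly (coeff G j)"
  unfolding invert_r_def by (subst coeff_map_poly) auto

lemma map_of_rat_reflect: "map_poly complex_of_rat (reflect_poly c) = reflect_poly (map_poly of_rat c)"
  by (rule poly_eqI) (simp add: coeff_map_poly coeff_reflect_poly degree_map_poly)

lemma eval2_invert_r:
  assumes x: "x \<noteq> 0"
  shows "eval2 (invert_r G) x y = x ^ degree_r G * eval2 G (1 / x) y"
proof -
  have "slice x (invert_r G) = smult (x ^ degree_r G) (slice (1 / x) G)"
  proof (rule poly_eqI)
    fix j
    define c where "c = coeff G j"
    have le: "degree c \<le> degree_r G" unfolding c_def by (rule degree_coeff_le_degree_r)
    have "at_r x (reflect_poly c) = x ^ degree c * at_r (1 / x) c"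
      unfolding at_r_def map_of_rat_reflect using x
      by (simp add: poly_reflect_poly_nz degree_map_poly inverse_eq_divide)
    moreover have "at_r x (monom 1 n) = x ^ n" for n
      by (simp add: at_r_def map_poly_monom poly_monom)
    ultimately have "at_r x (coeff (invert_r G) j) = x ^ (degree_r G - degree c) * (x ^ degree c * at_r (1 / x) c)"
      by (simp add: coeff_invert_r at_r_mult c_def)
    also have "\<dots> = x ^ degree_r G * at_r (1 / x) c" using le by (simp flip: power_add mult.assoc)
    finally show "coeff (slice x (invert_r G)) j = coeff (smult (x ^ degree_r G) (slice (1 / x) G)) j"
      by (simp add: coeff_slice c_def)
  qed
  then show ?thesis by (simp add: eval2_slice)
qed

lemma exists_nonroot: "p \<noteq> 0 \<Longrightarrow> \<exists>y. y \<noteq> 0 \<and> poly p y \<noteq> (0 :: complex)"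
proof -
  assume "p \<noteq> 0"
  then have "[:0, 1:] * p \<noteq> 0" by simp
  then obtain y where "poly ([:0, 1:] * p) y \<noteq> 0" using poly_all_0_iff_0 by blast
  then show ?thesis by auto
qed

lemma invert_r_nonzero_at_infinity:
  assumes "G \<noteq> 0"
  shows "slice 0 (invert_r G) \<noteq> 0"
proof -
  have "degree_r G \<in> (\<lambda>j. degree (coeff G j)) ` {..degree G}"
    unfolding degree_r_def by (rule Max_in) auto
  then obtain j where j: "degree (coeff G j) = degree_r G" by auto
  obtain i where i: "degree (coeff G i) = degree_r G" "coeff G i \<noteq> 0"
  proof (cases "coeff G j = 0")
    case True
    then have "degree_r G = 0" using j by simp
    then have "degree (coeff G (degree G)) = degree_r G"
      using degree_coeff_le_degree_r[of G "degree G"] by simp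
    then show ?thesis using that assms by simp
  qed (use j that in auto)
  have "at_r 0 (coeff (invert_r G) i) = of_rat (lead_coeff (coeff G i))"
    unfolding coeff_invert_r using i(1)
    by (simp add: at_r_def poly_0_coeff_0 coeff_map_poly coeff_reflect_poly flip: one_pCons)
  then have "coeff (slice 0 (invert_r G)) i \<noteq> 0" using i(2) by (simp add: coeff_slice)
  then show ?thesis by auto
qed

lemma isCont_eq_at:
  fixes f g :: "complex \<Rightarrow> complex"
  assumes "isCont f a" "isCont g a" "\<And>x. x \<noteq> a \<Longrightarrow> f x = g x"
  shows "f a = g a"
proof -
  have "(f \<longlongrightarrow> f a) (at a)" "(g \<longlongrightarrow> g a) (at a)" using assms by (auto simp: isCont_def)
  moreover have "\<forall>\<^sub>F x in at a. f x = g x" using assms(3) by (simp add: eventually_at_filter)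
  ultimately show ?thesis by (metis tendsto_cong tendsto_unique at_neq_bot)
qed

text \<open>
  The bidegree used for a homogenization can be recognized from its result: two homogenizations
  that do not vanish identically at infinity can differ by no power of the coordinate. This
  identifies charts at infinity without computing \<open>degree_r\<close> or \<open>degree\<close>.
\<close>
lemma chart_unique:
  fixes E K :: "complex \<Rightarrow> 'a \<Rightarrow> complex"
  assumes cont: "\<And>y. isCont (\<lambda>x. E x y) 0" "\<And>y. isCont (\<lambda>x. K x y) 0"
    and nz: "\<exists>y. E 0 y \<noteq> 0" "\<exists>y. K 0 y \<noteq> 0"
    and eq: "\<And>x y. x \<noteq> 0 \<Longrightarrow> x ^ N * E x y = x ^ M * K x y"
  shows "E x y = K x y"
proof -
  have not_less: "\<not> N < M"
    if cE: "\<And>y. isCont (\<lambda>x. E x y) 0" and cK: "\<And>y. isCont (\<lambda>x. K x y) 0"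
      and nE: "\<exists>y. E 0 y \<noteq> 0" and eq: "\<And>x y. x \<noteq> 0 \<Longrightarrow> x ^ N * E x y = x ^ M * K x y"
    for E K :: "complex \<Rightarrow> 'a \<Rightarrow> complex" and N M
  proof
    assume NM: "N < M"
    have "E 0 y = 0" for y
    proof -
      have "E x y = x ^ (M - N) * K x y" if "x \<noteq> 0" for x
      proof -
        have "x ^ N * E x y = x ^ N * (x ^ (M - N) * K x y)"
          using eq[OF that] NM by (simp flip: mult.assoc power_add)
        then show ?thesis using that by simp
      qed
      moreover have "isCont (\<lambda>x. x ^ (M - N) * K x y) 0" by (intro continuous_intros cK)
      ultimately have "E 0 y = 0 ^ (M - N) * K 0 y"
        using isCont_eq_at[of 0 "\<lambda>x. E x y" "\<lambda>x. x ^ (M - N) * K x y"] cE by blast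
      then show ?thesis using NM by simp
    qed
    then show False using nE by blast
  qed
  have "\<not> N < M" using cont nz(1) eq by (rule not_less)
  moreover have "\<not> M < N" using cont(2,1) nz(2) eq[symmetric] by (rule not_less)
  ultimately have "E x y = K x y" if "x \<noteq> 0" for x
    using eq[OF that, of y] that by simp
  then show ?thesis using isCont_eq_at[of 0 "\<lambda>x. E x y" "\<lambda>x. K x y"] cont by (cases "x = 0") blast+
qed

lemma eval2_invert_r_eqI:
  assumes K: "\<And>x y. x \<noteq> 0 \<Longrightarrow> x ^ N * eval2 G (1 / x) y = K x y"
    and cont: "\<And>y. isCont (\<lambda>x. K x y) 0"
    and nz: "\<exists>y. K 0 y \<noteq> 0"
  shows "eval2 (invert_r G) x y = K x y"
proof (rule chart_unique[of "\<lambda>x y. eval2 (invert_r G) x y" K N "degree_r G"])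
  show "x ^ N * eval2 (invert_r G) x y = x ^ degree_r G * K x y" if "x \<noteq> 0" for x y
    using K[OF that, of y] eval2_invert_r[OF that, of G y] by (simp add: mult.left_commute)
  have "G \<noteq> 0"
  proof
    assume "G = 0"
    then have "K x y = 0" if "x \<noteq> 0" for x y using K[OF that, of y] by simp
    then have "K 0 y = 0" for y
      using isCont_eq_at[of 0 "\<lambda>x. K x y" "\<lambda>_. 0"] cont by simp
    then show False using nz by blast
  qed
  from exists_nonroot[OF invert_r_nonzero_at_infinity[OF this]]
  show "\<exists>y. eval2 (invert_r G) 0 y \<noteq> 0" by (auto simp: eval2_slice)
qed (rule isCont_eval2_r cont nz)+

lemma eval2_invert_r_mult:
  assumes "F \<noteq> 0" "G \<noteq> 0"
  shows "eval2 (invert_r (F * G)) x y = eval2 (invert_r F) x y * eval2 (invert_r G) x y"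
proof (rule eval2_invert_r_eqI[where N = "degree_r F + degree_r G"])
  show "x ^ (degree_r F + degree_r G) * eval2 (F * G) (1 / x) y =
      eval2 (invert_r F) x y * eval2 (invert_r G) x y" if "x \<noteq> 0" for x y
    using that by (simp add: eval2_invert_r eval2_mult power_add)
  show "isCont (\<lambda>x. eval2 (invert_r F) x y * eval2 (invert_r G) x y) 0" for y
    by (intro continuous_intros isCont_eval2_r)
  have "slice 0 (invert_r F) * slice 0 (invert_r G) \<noteq> 0"
    using invert_r_nonzero_at_infinity assms by simp
  from exists_nonroot[OF this]
  show "\<exists>y. eval2 (invert_r F) 0 y * eval2 (invert_r G) 0 y \<noteq> 0" by (auto simp: eval2_slice)
qed

lemma eval2_sum:
  assumes "degree G \<le> n"
  shows "eval2 G x y = (\<Sum>j\<le>n. at_r x (coeff G j) * y ^ j)"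
proof -
  have "degree (slice x G) \<le> n"
    using assms by (intro degree_le) (simp add: coeff_slice coeff_eq_0)
  then have "(\<Sum>j\<le>n. coeff (slice x G) j * y ^ j) = poly (slice x G) y"
    unfolding poly_altdef by (intro sum.mono_neutral_right) (auto simp: coeff_eq_0)
  then show ?thesis by (simp add: coeff_slice eval2_slice)
qed

lemma eval2_invert_t:
  assumes "y \<noteq> 0"
  shows "eval2 (invert_t G) x y = y ^ degree G * eval2 G x (1 / y)"
proof -
  have deg: "degree (invert_t G) \<le> degree G" by (simp add: invert_t_def degree_reflect_poly_le)
  have "eval2 (invert_t G) x y = (\<Sum>j\<le>degree G. at_r x (coeff G (degree G - j)) * y ^ j)"
    unfolding eval2_sum[OF deg]
    by (intro sum.cong) (auto simp: invert_t_def coeff_reflect_poly)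
  also have "\<dots> = (\<Sum>j\<le>degree G. at_r x (coeff G j) * y ^ (degree G - j))"
    by (rule sum.reindex_bij_witness[of _ "\<lambda>j. degree G - j" "\<lambda>j. degree G - j"]) auto
  also have "\<dots> = y ^ degree G * eval2 G x (1 / y)"
    using assms by (auto simp: eval2_sum[OF le_refl] sum_distrib_left power_diff field_simps intro!: sum.cong)
  finally show ?thesis .
qed

lemma eval2_invert_t_eqI:
  assumes K: "\<And>x y. y \<noteq> 0 \<Longrightarrow> y ^ N * eval2 G x (1 / y) = K x y"
    and cont: "\<And>x. isCont (\<lambda>y. K x y) 0"
    and nz: "\<exists>x. K x 0 \<noteq> 0"
  shows "eval2 (invert_t G) x y = K x y"
proof (rule chart_unique[of "\<lambda>y x. eval2 (invert_t G) x y" "\<lambda>y x. K x y" N "degree G"])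
  show "y ^ N * eval2 (invert_t G) x y = y ^ degree G * K x y" if "y \<noteq> 0" for x y
    using K[OF that, of x] eval2_invert_t[OF that, of G x] by (simp add: mult.left_commute)
  have "G \<noteq> 0"
  proof
    assume "G = 0"
    then have "K x y = 0" if "y \<noteq> 0" for x y using K[OF that, of x] by simp
    then have "K x 0 = 0" for x
      using isCont_eq_at[of 0 "\<lambda>y. K x y" "\<lambda>_. 0"] cont by simp
    then show False using nz by blast
  qed
  then have "map_poly complex_of_rat (lead_coeff G) \<noteq> 0" by (simp add: map_poly_eq_0_iff)
  moreover have "eval2 (invert_t G) x 0 = poly (map_poly of_rat (lead_coeff G)) x" for x
    by (simp add: eval2_slice poly_0_coeff_0 coeff_slice invert_t_def at_r_def)
  ultimately show "\<exists>x. eval2 (invert_t G) x 0 \<noteq> 0" using exists_nonroot by metis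
qed (rule isCont_eval2_t cont nz)+

section \<open>Singular points\<close>
definition singular :: "bipoly \<Rightarrow> complex \<Rightarrow> complex \<Rightarrow> bool" where
  "singular G x y \<longleftrightarrow> eval2 G x y = 0 \<and> eval2 (d_r G) x y = 0 \<and> eval2 (d_t G) x y = 0"

lemma singular_mult:
  assumes "\<And>x y. eval2 D x y = eval2 G x y * eval2 H x y" "singular G x y"
  shows "singular D x y"
proof -
  have "((\<lambda>x. eval2 D x y) has_field_derivative 0) (at x)" "((\<lambda>y. eval2 D x y) has_field_derivative 0) (at y)"
    unfolding assms(1) using DERIV_mult[OF eval2_d_r[of G y x] eval2_d_r[of H y x]]
      DERIV_mult[OF eval2_d_t[of G x y] eval2_d_t[of H x y]] assms(2)
    by (simp_all add: singular_def)
  then have "eval2 (d_r D) x y = 0" "eval2 (d_t D) x y = 0"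
    using DERIV_unique eval2_d_r eval2_d_t by blast+
  then show ?thesis using assms by (simp add: singular_def)
qed

text \<open>
  Changing the chart multiplies by a power of the coordinate and inverts the coordinate; a double
  zero away from the origin stays a double zero.
\<close>
lemma singular_transfer:
  fixes e :: "complex \<Rightarrow> complex"
  assumes x: "x \<noteq> 0" and e: "(e has_field_derivative 0) (at x)" "e x = 0"
    and eq: "\<And>u. u \<noteq> 0 \<Longrightarrow> e u = u ^ N * g (1 / u)" and g: "(g has_field_derivative g') (at (1 / x))"
  shows "g (1 / x) = 0" "g' = 0"
proof -
  show "g (1 / x) = 0" using eq[OF x] e(2) x by simp
  have g_eq: "g u = u ^ N * e (1 / u)" if "u \<noteq> 0" for u
    using eq[of "1 / u"] that by (simp add: field_simps)
  have d: "((\<lambda>u. u ^ N * e (1 / u)) has_field_derivative 0) (at (1 / x))"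
  proof -
    have "((\<lambda>u. 1 / u) has_field_derivative (- (x ^ 2))) (at (1 / x))"
      using x by (auto intro!: derivative_eq_intros simp: power2_eq_square)
    moreover have "(e has_field_derivative 0) (at (1 / (1 / x)))" using e by simp
    ultimately have "((\<lambda>u. e (1 / u)) has_field_derivative 0 * (- (x ^ 2))) (at (1 / x))"
      by (intro DERIV_chain2[of e 0])
    from DERIV_mult[OF DERIV_power[OF DERIV_ident] this, of N] show ?thesis using e(2) by simp
  qed
  have "\<forall>\<^sub>F u in nhds (1 / x). u \<in> - {0}"
    using x by (intro eventually_nhds_in_open open_Compl) auto
  then have ev: "\<forall>\<^sub>F u in nhds (1 / x). u ^ N * e (1 / u) = g u"
    by eventually_elim (simp add: g_eq)
  have "(g has_field_derivative 0) (at (1 / x))"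
    using d unfolding DERIV_cong_ev[OF refl ev refl] .
  then show "g' = 0" using g DERIV_unique by blast
qed

lemma singular_invert_r:
  assumes "x \<noteq> 0" "singular (invert_r G) x y"
  shows "singular G (1 / x) y"
proof -
  have s: "eval2 (invert_r G) x y = 0" "eval2 (d_r (invert_r G)) x y = 0" "eval2 (d_t (invert_r G)) x y = 0"
    using assms(2) by (simp_all add: singular_def)
  have "eval2 G (1 / x) y = 0 \<and> eval2 (d_r G) (1 / x) y = 0"
    using singular_transfer[of x "\<lambda>x. eval2 (invert_r G) x y" "degree_r G" "\<lambda>x. eval2 G x y"]
      assms(1) s eval2_d_r eval2_invert_r by metis
  moreover have "((\<lambda>y. x ^ degree_r G * eval2 G (1 / x) y) has_field_derivative
      x ^ degree_r G * eval2 (d_t G) (1 / x) y) (at y)"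
    by (intro DERIV_cmult eval2_d_t)
  then have "eval2 (d_t (invert_r G)) x y = x ^ degree_r G * eval2 (d_t G) (1 / x) y"
    using eval2_d_t[of "invert_r G" x y] unfolding eval2_invert_r[OF assms(1)] by (rule DERIV_unique[rotated])
  ultimately show ?thesis using s(3) assms(1) by (simp add: singular_def)
qed

lemma singular_invert_t:
  assumes "y \<noteq> 0" "singular (invert_t G) x y"
  shows "singular G x (1 / y)"
proof -
  have s: "eval2 (invert_t G) x y = 0" "eval2 (d_r (invert_t G)) x y = 0" "eval2 (d_t (invert_t G)) x y = 0"
    using assms(2) by (simp_all add: singular_def)
  have "eval2 G x (1 / y) = 0 \<and> eval2 (d_t G) x (1 / y) = 0"
    using singular_transfer[of y "\<lambda>y. eval2 (invert_t G) x y" "degree G" "\<lambda>y. eval2 G x y"]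
      assms(1) s eval2_d_t eval2_invert_t by metis
  moreover have "((\<lambda>x. y ^ degree G * eval2 G x (1 / y)) has_field_derivative
      y ^ degree G * eval2 (d_r G) x (1 / y)) (at x)"
    by (intro DERIV_cmult eval2_d_r)
  then have "eval2 (d_r (invert_t G)) x y = y ^ degree G * eval2 (d_r G) x (1 / y)"
    using eval2_d_r[of "invert_t G" y x] unfolding eval2_invert_t[OF assms(1)] by (rule DERIV_unique[rotated])
  ultimately show ?thesis using s(2) assms(1) by (simp add: singular_def)
qed

text \<open>
  The gradient of \<open>P(x) Q'(y) - Q(x) P'(y)\<close> involves one Wronskian per variable once the vanishing of
  the polynomial makes the vectors \<open>(P(x), Q(x))\<close> and \<open>(P'(y), Q'(y))\<close> proportional.
\<close>
lemma singular_separated: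
  assumes D: "\<And>x y. eval2 D x y = poly P x * poly Q' y - poly Q x * poly P' y"
    and P: "poly P x \<noteq> 0 \<or> poly Q x \<noteq> 0" and P': "poly P' y \<noteq> 0 \<or> poly Q' y \<noteq> 0"
    and sing: "singular D x y"
  shows "poly (wronskian P Q) x = 0" "poly (wronskian P' Q') y = 0"
    "poly P x * poly Q' y = poly Q x * poly P' y"
proof -
  have "((\<lambda>x. eval2 D x y) has_field_derivative
      poly (pderiv P) x * poly Q' y - poly (pderiv Q) x * poly P' y) (at x)"
    unfolding D by (auto intro!: derivative_eq_intros poly_DERIV)
  then have r: "poly (pderiv P) x * poly Q' y = poly (pderiv Q) x * poly P' y"
    using sing DERIV_unique[OF eval2_d_r] by (simp add: singular_def)
  have "((\<lambda>y. eval2 D x y) has_field_derivative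
      poly P x * poly (pderiv Q') y - poly Q x * poly (pderiv P') y) (at y)"
    unfolding D by (auto intro!: derivative_eq_intros poly_DERIV)
  then have t: "poly P x * poly (pderiv Q') y = poly Q x * poly (pderiv P') y"
    using sing DERIV_unique[OF eval2_d_t] by (simp add: singular_def)
  show z: "poly P x * poly Q' y = poly Q x * poly P' y" using sing D by (simp add: singular_def)
  then obtain s where s: "s \<noteq> 0" "poly P' y = s * poly P x" "poly Q' y = s * poly Q x"
    using proportional_pairs[OF z P P'] by metis
  have "s * poly (wronskian P Q) x = 0" using r unfolding s wronskian_def by simp algebra
  then show "poly (wronskian P Q) x = 0" using s by simp
  have "poly (wronskian P' Q') y = 0 * s" using t unfolding wronskian_def poly_diff poly_mult s by algebra
  then show "poly (wronskian P' Q') y = 0" by simp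
qed

section \<open>Curves with separated variables near infinity\<close>
definition reversed :: "nat \<Rightarrow> complex poly \<Rightarrow> complex poly" where
  "reversed N P = (\<Sum>i\<le>N. monom (coeff P (N - i)) i)"

lemma coeff_reversed: "coeff (reversed N P) i = (if i \<le> N then coeff P (N - i) else 0)"
  unfolding reversed_def by (simp add: coeff_sum if_distrib sum.delta cong: if_cong)

lemma poly_reversed:
  assumes "degree P \<le> N" "x \<noteq> 0"
  shows "poly (reversed N P) x = x ^ N * poly P (1 / x)"
proof -
  have "poly (reversed N P) x = (\<Sum>i\<le>N. coeff P (N - i) * x ^ i)"
    by (simp add: reversed_def poly_sum poly_monom)
  also have "\<dots> = (\<Sum>i\<le>N. coeff P i * x ^ (N - i))"
    by (rule sum.reindex_bij_witness[of _ "\<lambda>i. N - i" "\<lambda>i. N - i"]) auto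
  also have "\<dots> = x ^ N * (\<Sum>i\<le>N. coeff P i * (1 / x) ^ i)"
    using assms(2) by (auto simp: sum_distrib_left power_diff field_simps intro!: sum.cong)
  also have "(\<Sum>i\<le>N. coeff P i * (1 / x) ^ i) = poly P (1 / x)"
    unfolding poly_altdef using assms(1) by (intro sum.mono_neutral_right) (auto simp: coeff_eq_0)
  finally show ?thesis .
qed

lemma poly_reversed_0: "poly (reversed N P) 0 = coeff P N"
  by (simp add: poly_0_coeff_0 coeff_reversed)

text \<open>
  The two products are those in the Wronskian of the reversed polynomials at 0, so the inequality
  says that the map \<open>P/Q\<close> is unramified at infinity.
\<close>
definition unramified_at_infinity :: "nat \<Rightarrow> complex poly \<Rightarrow> complex poly \<Rightarrow> bool" where
  "unramified_at_infinity N P Q \<longleftrightarrow> N \<ge> 1 \<and> degree P \<le> N \<and> degree Q \<le> N \<and>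
     coeff P (N - 1) * coeff Q N \<noteq> coeff P N * coeff Q (N - 1)"

lemma wronskian_reversed_nonzero:
  assumes "unramified_at_infinity N P Q"
  shows "poly (wronskian (reversed N P) (reversed N Q)) 0 \<noteq> 0"
proof -
  have "poly (pderiv (reversed N S)) 0 = coeff S (N - 1)" for S
    using assms by (simp add: poly_0_coeff_0 coeff_pderiv coeff_reversed unramified_at_infinity_def)
  then show ?thesis
    using assms by (simp add: wronskian_def poly_reversed_0 unramified_at_infinity_def)
qed

lemma reversed_coprime:
  assumes "unramified_at_infinity N P Q" "\<And>x. poly P x \<noteq> 0 \<or> poly Q x \<noteq> 0"
  shows "poly (reversed N P) x \<noteq> 0 \<or> poly (reversed N Q) x \<noteq> 0"
proof (cases "x = 0")
  case True
  then show ?thesis using assms(1) by (auto simp: poly_reversed_0 unramified_at_infinity_def)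
next
  case False
  then show ?thesis using assms by (auto simp: poly_reversed unramified_at_infinity_def)
qed

lemma combination_nonzero:
  assumes "coeff P i * coeff Q j \<noteq> coeff P j * coeff Q i" "a \<noteq> 0 \<or> b \<noteq> (0 :: complex)"
  shows "smult a Q - smult b P \<noteq> 0"
proof
  assume "smult a Q - smult b P = 0"
  then have eq: "a * coeff Q n = b * coeff P n" for n
    by (metis coeff_smult eq_iff_diff_eq_0)
  have "a * (coeff P i * coeff Q j - coeff P j * coeff Q i) = 0"
    using eq[of i] eq[of j] by algebra
  moreover have "b * (coeff P i * coeff Q j - coeff P j * coeff Q i) = 0"
    using eq[of i] eq[of j] by algebra
  ultimately have "a * (coeff P i * coeff Q j - coeff P j * coeff Q i) = 0"
    "b * (coeff P i * coeff Q j - coeff P j * coeff Q i) = 0" .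
  then show False using assms by auto
qed

text \<open>
  The curve \<open>P(r)/Q(r) = P'(t)/Q'(t)\<close>, where primes distinguish the second pair and do not denote
  derivatives.
\<close>
locale separated_curve =
  fixes D :: bipoly and P Q P' Q' :: "complex poly" and N N' :: nat
  assumes D: "\<And>x y. eval2 D x y = poly P x * poly Q' y - poly Q x * poly P' y"
    and inf: "unramified_at_infinity N P Q" and inf': "unramified_at_infinity N' P' Q'"
    and cop: "\<And>x. poly P x \<noteq> 0 \<or> poly Q x \<noteq> 0" and cop': "\<And>y. poly P' y \<noteq> 0 \<or> poly Q' y \<noteq> 0"
begin

lemma leading_coeffs_nonzero: "coeff P N \<noteq> 0 \<or> coeff Q N \<noteq> 0" "coeff P' N' \<noteq> 0 \<or> coeff Q' N' \<noteq> 0"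
  using inf inf' by (auto simp: unramified_at_infinity_def)

lemma chart_r: "eval2 (invert_r D) x y = poly (reversed N P) x * poly Q' y - poly (reversed N Q) x * poly P' y"
proof (rule eval2_invert_r_eqI[where N = N])
  have "smult (coeff P N) Q' - smult (coeff Q N) P' \<noteq> 0"
    using inf' leading_coeffs_nonzero(1) by (intro combination_nonzero) (auto simp: unramified_at_infinity_def)
  from exists_nonroot[OF this]
  show "\<exists>y. poly (reversed N P) 0 * poly Q' y - poly (reversed N Q) 0 * poly P' y \<noteq> 0"
    by (auto simp: poly_reversed_0)
qed (use inf in \<open>auto simp: D poly_reversed unramified_at_infinity_def algebra_simps intro!: continuous_intros\<close>)

lemma chart_t: "eval2 (invert_t D) x y = poly P x * poly (reversed N' Q') y - poly Q x * poly (reversed N' P') y"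
proof (rule eval2_invert_t_eqI[where N = N'])
  have "smult (coeff Q' N') P - smult (coeff P' N') Q \<noteq> 0"
    using inf leading_coeffs_nonzero(2) by (intro combination_nonzero[of _ N _ "N - 1"]) (auto simp: unramified_at_infinity_def mult.commute)
  from exists_nonroot[OF this]
  show "\<exists>x. poly P x * poly (reversed N' Q') 0 - poly Q x * poly (reversed N' P') 0 \<noteq> 0"
    by (auto simp: poly_reversed_0 mult.commute)
qed (use inf' in \<open>auto simp: D poly_reversed unramified_at_infinity_def algebra_simps intro!: continuous_intros\<close>)

lemma chart_rt: "eval2 (invert_r (invert_t D)) x y =
   poly (reversed N P) x * poly (reversed N' Q') y - poly (reversed N Q) x * poly (reversed N' P') y"
proof (rule eval2_invert_r_eqI[where N = N])
  have "smult (coeff P N) (reversed N' Q') - smult (coeff Q N) (reversed N' P') \<noteq> 0"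
    using inf' leading_coeffs_nonzero(1) by (intro combination_nonzero[of _ 1 _ 0]) (auto simp: unramified_at_infinity_def coeff_reversed)
  from exists_nonroot[OF this]
  show "\<exists>y. poly (reversed N P) 0 * poly (reversed N' Q') y - poly (reversed N Q) 0 * poly (reversed N' P') y \<noteq> 0"
    by (auto simp: poly_reversed_0)
qed (use inf in \<open>auto simp: chart_t poly_reversed unramified_at_infinity_def algebra_simps intro!: continuous_intros\<close>)

lemma not_singular_at_infinity:
  "\<not> singular (invert_r D) 0 y" "\<not> singular (invert_t D) x 0" "\<not> singular (invert_r (invert_t D)) 0 y"
  using singular_separated(1)[OF chart_r reversed_coprime[OF inf cop] cop']
    singular_separated(2)[OF chart_t cop reversed_coprime[OF inf' cop']]
    singular_separated(1)[OF chart_rt reversed_coprime[OF inf cop] reversed_coprime[OF inf' cop']]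
    wronskian_reversed_nonzero[OF inf] wronskian_reversed_nonzero[OF inf'] by blast+

lemma D_nonzero: "D \<noteq> 0"
proof
  assume "D = 0"
  then have "eval2 (invert_r D) x y = 0" for x y by (simp add: invert_r_def)
  then have "singular (invert_r D) x y" for x y
    using \<open>D = 0\<close> by (simp add: singular_def invert_r_def d_r_def d_t_def)
  then show False using not_singular_at_infinity(1) by blast
qed

text \<open>
  A singular point of the component \<open>G\<close> is one of the whole curve, in every chart, since the charts
  of \<open>D\<close> factor accordingly. So \<open>G\<close> has no singular point at infinity, and all other points are
  visible in the affine chart.
\<close>
lemma smooth_component:
  assumes fac: "D = G * H" and aff: "\<And>x y. \<not> singular G x y"
  shows "smooth_curve (projective_closure {F. G dvd F})"
proof -
  have nz: "G \<noteq> 0" "H \<noteq> 0" using D_nonzero fac by auto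
  have nzt: "invert_t G \<noteq> 0" "invert_t H \<noteq> 0" using nz by (simp_all add: invert_t_def reflect_poly_eq_0_iff)
  have fac_t: "invert_t D = invert_t G * invert_t H" by (simp add: fac invert_t_def reflect_poly_mult)
  have r: "\<not> singular (invert_r G) x y" for x y
  proof (cases "x = 0")
    case True
    then show ?thesis
      using singular_mult[of "invert_r D" "invert_r G" "invert_r H"] not_singular_at_infinity(1)
        eval2_invert_r_mult[OF nz] fac by metis
  qed (use singular_invert_r aff in blast)
  have t: "\<not> singular (invert_t G) x y" for x y
  proof (cases "y = 0")
    case True
    then show ?thesis
      using singular_mult[of "invert_t D" "invert_t G" "invert_t H"] not_singular_at_infinity(2)
        fac_t eval2_mult by metis
  qed (use singular_invert_t aff in blast)
  have rt: "\<not> singular (invert_r (invert_t G)) x y" for x y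
  proof (cases "x = 0")
    case True
    then show ?thesis
      using singular_mult[of "invert_r (invert_t D)" "invert_r (invert_t G)" "invert_r (invert_t H)"]
        not_singular_at_infinity(3) eval2_invert_r_mult[OF nzt] fac_t by metis
  qed (use singular_invert_r t in blast)
  have smooth: "smooth_affine_curve J" if "F \<in> J" "\<And>x y. \<not> singular F x y" for F J
    using that unfolding smooth_affine_curve_def singular_def by blast
  have G: "G \<in> {F. G dvd F}" by simp
  have "smooth_affine_curve {F. G dvd F}" using G aff by (rule smooth)
  moreover have "smooth_affine_curve (invert_r ` {F. G dvd F})"
    by (rule smooth[of "invert_r G"]) (use r in auto)
  moreover have "smooth_affine_curve (invert_t ` {F. G dvd F})"
    by (rule smooth[of "invert_t G"]) (use t in auto)
  moreover have "smooth_affine_curve ((\<lambda>F. invert_r (invert_t F)) ` {F. G dvd F})"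
    by (rule smooth[of "invert_r (invert_t G)"]) (use rt in auto)
  ultimately show ?thesis
    unfolding smooth_curve_def projective_closure_def by simp
qed

end

section \<open>Smoothness\<close>
lemma monic_fpol:
  "coeff (cpoly (fpol (int n + 1))) n = 1 \<and> (\<forall>i>n. coeff (cpoly (fpol (int n + 1))) i = 0)"
proof -
  define S where "S n \<longleftrightarrow> coeff (cpoly (fpol (int n + 1))) n = 1 \<and> (\<forall>i>n. coeff (cpoly (fpol (int n + 1))) i = 0)" for n
  have "S n \<and> S (Suc n)"
  proof (induction n)
    case 0
    have "fpol 2 = [:0, 1:]" using fpol_recurrence[of 1] by (simp add: fpol_0 fpol_1)
    then show ?case by (auto simp: S_def fpol_1 coeff_map_poly coeff_pCons split: nat.split)
  next
    case (Suc n)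
    have rec: "cpoly (fpol (int (Suc (Suc n)) + 1)) = [:0, 1:] * cpoly (fpol (int (Suc n) + 1)) - cpoly (fpol (int n + 1))"
      using cpoly_fpol_Suc[of "int n + 2"] by (simp add: add.commute)
    show ?case using Suc unfolding S_def rec by (auto simp: coeff_pCons split: nat.split)
  qed
  then show ?thesis by (simp add: S_def)
qed

lemma monic_gpol:
  "coeff (cpoly (gpol (int n + 1))) n = 1 \<and> (\<forall>i>n. coeff (cpoly (gpol (int n + 1))) i = 0)"
proof (cases n)
  case 0
  then show ?thesis by (auto simp: gpol_def fpol_0 fpol_1 coeff_map_poly)
next
  case (Suc m)
  have "int n + 1 - 1 = int m + 1" by (simp add: Suc)
  then have "cpoly (gpol (int n + 1)) = cpoly (fpol (int n + 1)) - cpoly (fpol (int m + 1))"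
    unfolding gpol_def cpoly_diff by (simp only:)
  then show ?thesis using monic_fpol[of n] monic_fpol[of m] Suc by simp
qed

lemma Phi_uminus: "Phi_poly (- j) = (if even j then - Phi_poly j else Phi_poly j)"
proof -
  have "poly (Phi_poly (- j)) u = poly (if even j then - Phi_poly j else Phi_poly j) u" for u
  proof (cases "even j")
    case True
    then obtain m where j: "j = 2 * m" by (rule evenE)
    show ?thesis using poly_Phi_even[of "- m" u] poly_Phi_even[of m u] by (simp add: j fval_uminus)
  next
    case False
    then obtain m where j: "j = 2 * m + 1" by (rule oddE)
    have "- j = 2 * (- m) - 1" using j by simp
    then have "poly (Phi_poly (- j)) u = gval u (- m)" by (simp only: poly_Phi_odd)
    also have "\<dots> = gval u (m + 1)" using gval_reflect[of u "m + 1"] by simp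
    also have "\<dots> = poly (Phi_poly j) u" unfolding j by (rule poly_Phi_odd'[symmetric])
    finally show ?thesis using False by simp
  qed
  then show ?thesis unfolding poly_eq_poly_eq_iff[symmetric] by (intro ext)
qed

lemma Phi_unramified_at_infinity:
  assumes k: "\<bar>k\<bar> \<ge> 2"
  shows "\<exists>N. unramified_at_infinity N (Phi_poly (k + 1)) (Phi_poly (k - 1))"
proof -
  have monic: "\<exists>N\<ge>1. coeff (Phi_poly (k + 1)) N = 1 \<and> (\<forall>i>N. coeff (Phi_poly (k + 1)) i = 0) \<and>
      coeff (Phi_poly (k - 1)) (N - 1) = 1 \<and> (\<forall>i>N - 1. coeff (Phi_poly (k - 1)) i = 0)" if "k \<ge> 2" for k
  proof (cases "even k")
    case True
    then obtain m where "k = 2 * m" by (rule evenE)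
    define n where "n = nat (m - 1)"
    have "k + 1 = 2 * (int (Suc n) + 1) - 1" "k - 1 = 2 * (int n + 1) - 1"
      using \<open>k = 2 * m\<close> that by (simp_all add: n_def)
    then have "Phi_poly (k + 1) = cpoly (gpol (int (Suc n) + 1))" "Phi_poly (k - 1) = cpoly (gpol (int n + 1))"
      by (simp_all only: Phi_poly_def Phi_odd)
    then show ?thesis using monic_gpol[of n] monic_gpol[of "Suc n"] by (intro exI[of _ "Suc n"]) simp
  next
    case False
    then obtain m where "k = 2 * m + 1" by (rule oddE)
    define n where "n = nat (m - 1)"
    have "k + 1 = 2 * (int (Suc n) + 1)" "k - 1 = 2 * (int n + 1)"
      using \<open>k = 2 * m + 1\<close> that by (simp_all add: n_def)
    then have "Phi_poly (k + 1) = cpoly (fpol (int (Suc n) + 1))" "Phi_poly (k - 1) = cpoly (fpol (int n + 1))"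
      by (simp_all only: Phi_poly_def Phi_even)
    then show ?thesis using monic_fpol[of n] monic_fpol[of "Suc n"] by (intro exI[of _ "Suc n"]) simp
  qed
  show ?thesis
  proof (cases "k \<ge> 2")
    case True
    then obtain N where "N \<ge> 1" "coeff (Phi_poly (k + 1)) N = 1" "\<forall>i>N. coeff (Phi_poly (k + 1)) i = 0"
      "coeff (Phi_poly (k - 1)) (N - 1) = 1" "\<forall>i>N - 1. coeff (Phi_poly (k - 1)) i = 0"
      using monic by blast
    then have "unramified_at_infinity N (Phi_poly (k + 1)) (Phi_poly (k - 1))"
      unfolding unramified_at_infinity_def by (auto intro!: degree_le)
    then show ?thesis ..
  next
    case False
    then have "- k \<ge> 2" using k by simp
    from monic[OF this] obtain N where N: "N \<ge> 1" "coeff (Phi_poly (- k + 1)) N = 1"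
      "\<forall>i>N. coeff (Phi_poly (- k + 1)) i = 0"
      "coeff (Phi_poly (- k - 1)) (N - 1) = 1" "\<forall>i>N - 1. coeff (Phi_poly (- k - 1)) i = 0"
      by blast
    define s :: complex where "s = (if odd k then - 1 else 1)"
    have s: "s \<noteq> 0" "Phi_poly (k - 1) = smult s (Phi_poly (- k + 1))"
       "Phi_poly (k + 1) = smult s (Phi_poly (- k - 1))"
      using Phi_uminus[of "k - 1"] Phi_uminus[of "k + 1"] by (simp_all add: s_def)
    then have "unramified_at_infinity N (Phi_poly (k + 1)) (Phi_poly (k - 1))"
      using N unfolding unramified_at_infinity_def s(2,3) by (auto intro!: degree_le)
    then show ?thesis ..
  qed
qed

lemma eval2_D_poly:
  "eval2 (D_poly k l) x y = poly (Phi_poly (k + 1)) x * poly (Phi_poly (l - 1)) y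
     - poly (Phi_poly (k - 1)) x * poly (Phi_poly (l + 1)) y"
  by (simp add: D_poly_def eval2_diff eval2_mult eval2_in_r eval2_in_t Phi_poly_def)

text \<open>
  Fix the first coordinate \<open>x\<close>. A double zero of \<open>G(x,y)\<close> at \<open>y = x\<close> is a triple zero of
  \<open>P(x) Q(y) - Q(x) P(y)\<close>, whose first and second derivatives at \<open>y = x\<close> are minus the Wronskian and
  minus the derivative of the Wronskian.
\<close>
lemma diagonal_singularity:
  assumes D: "\<And>y. (y - x) * eval2 G x y = poly P x * poly Q y - poly Q x * poly P y"
    and sing: "singular G x x"
  shows "poly (wronskian P Q) x = 0" "poly (pderiv (wronskian P Q)) x = 0"
proof -
  define S where "S = slice x G"
  have eq: "[:- x, 1:] * S = smult (poly P x) Q - smult (poly Q x) P"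
    unfolding poly_eq_poly_eq_iff[symmetric]
    using D by (intro ext) (simp add: eval2_slice S_def algebra_simps)
  have S0: "poly S x = 0" "poly (pderiv S) x = 0"
    using sing by (simp_all add: S_def singular_def eval2_slice slice_d_t)
  have d1: "pderiv ([:- x, 1:] * S) = [:- x, 1:] * pderiv S + S"
  proof -
    have "pderiv [:- x, 1:] = 1" by (simp add: pderiv_pCons one_pCons)
    then show ?thesis unfolding pderiv_mult by (simp only: mult_1_right)
  qed
  have "poly (pderiv ([:- x, 1:] * S)) x = 0" unfolding d1 using S0 by simp
  then show "poly (wronskian P Q) x = 0"
    unfolding eq wronskian_def by (simp add: pderiv_diff pderiv_smult algebra_simps)
  have "poly (pderiv (pderiv ([:- x, 1:] * S))) x = 0"
    unfolding d1 pderiv_add pderiv_mult using S0 by (simp add: pderiv_pCons)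
  then show "poly (pderiv (wronskian P Q)) x = 0"
    unfolding eq wronskian_def by (simp add: pderiv_diff pderiv_smult pderiv_mult algebra_simps)
qed

theorem theorem5p1:
  fixes l :: int
  assumes "even l" and "\<bar>l\<bar> \<ge> 2"
  shows "(\<forall>k::int. k \<noteq> l \<and> \<bar>k\<bar> \<ge> 2 \<longrightarrow> smooth_curve (curve_D k l)) \<and>
         (\<bar>l\<bar> > 2 \<longrightarrow> smooth_curve (curve_D1 l))"
proof (intro conjI allI impI)
  have curve: "\<exists>N N'. separated_curve (D_poly k l) (Phi_poly (k + 1)) (Phi_poly (k - 1))
      (Phi_poly (l + 1)) (Phi_poly (l - 1)) N N'" if "\<bar>k\<bar> \<ge> 2" for k
    using Phi_unramified_at_infinity[OF that] Phi_unramified_at_infinity[OF assms(2)]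
      eval2_D_poly Phi_coprime unfolding separated_curve_def by blast
  note critical = singular_separated[OF eval2_D_poly Phi_coprime Phi_coprime]
  {
    fix k :: int
    assume k: "k \<noteq> l \<and> \<bar>k\<bar> \<ge> 2"
    then obtain N N' where "separated_curve (D_poly k l) (Phi_poly (k + 1)) (Phi_poly (k - 1))
      (Phi_poly (l + 1)) (Phi_poly (l - 1)) N N'" using curve by blast
    then interpret separated_curve "D_poly k l" "Phi_poly (k + 1)" "Phi_poly (k - 1)"
      "Phi_poly (l + 1)" "Phi_poly (l - 1)" N N' .
    have "\<not> singular (D_poly k l) x y" for x y
      using critical[of k l x y] critical_values_disjoint[OF assms, of k x y] k by blast
    then show "smooth_curve (curve_D k l)"
      unfolding curve_D_def by (intro smooth_component[where H = 1]) simp_all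
  }
  obtain N N' where "separated_curve (D_poly l l) (Phi_poly (l + 1)) (Phi_poly (l - 1))
      (Phi_poly (l + 1)) (Phi_poly (l - 1)) N N'" using curve[OF assms(2)] by blast
  then interpret separated_curve "D_poly l l" "Phi_poly (l + 1)" "Phi_poly (l - 1)"
      "Phi_poly (l + 1)" "Phi_poly (l - 1)" N N' .
  have fac: "D_poly l l = D1_poly l * t_minus_r" using D1_poly_mult[OF assms(1)] by simp
  have ev: "eval2 (D_poly l l) x y = eval2 (D1_poly l) x y * eval2 t_minus_r x y" for x y
    unfolding fac by (rule eval2_mult)
  have "\<not> singular (D1_poly l) x y" for x y
  proof
    assume sing: "singular (D1_poly l) x y"
    then have "singular (D_poly l l) x y" using ev by (rule singular_mult[rotated])
    then have "x = y"
      using critical[of l l x y] critical_values_distinct[OF assms(2), of x y] by blast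
    then have "singular (D1_poly l) x x" using sing by simp
    moreover have "(v - x) * eval2 (D1_poly l) x v = poly (Phi_poly (l + 1)) x * poly (Phi_poly (l - 1)) v
        - poly (Phi_poly (l - 1)) x * poly (Phi_poly (l + 1)) v" for v
      using ev[of x v] eval2_D_poly[of l l x v] by (simp add: eval2_t_minus_r mult.commute)
    ultimately show False
      using diagonal_singularity critical_points_simple[OF assms, of x] by blast
  qed
  then show "smooth_curve (curve_D1 l)"
    unfolding curve_D1_def by (intro smooth_component[OF fac]) blast
qed

end
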